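(* Let $k(u,v,x)$ be an interaction rate of type 1 and assume $k(u,v,x)\ge k_1(x)(u+v)^\alpha$ for all $u,v\ge0$, $x\in\mathbb{T}$, for some $\alpha\in[0,1]$ and some $k_1\in L^\infty(\mathbb{T})$ with $\operatorname{ess\,inf}_{\mathbb{T}}k_1>0$. Let $0\le u_0,v_0\in L^\infty(\mathbb{T})$, $M:=\max\{\|u_0\|_{L^\infty},\|v_0\|_{L^\infty}\}$, and assume $m_\infty:=\frac12\int_{\mathbb{T}}(u_0+v_0)dx>0$. Let $(u,v)$ be the weak solution of the one-dimensional system with initial data $(u_0,v_0)$. Then there exist positive constants $\Lambda_\alpha$ (depending only on $M,m_\infty$, $c$) and $\lambda_\alpha$ (depending only on $M,m_\infty,c,\alpha$, $\operatorname{ess\,inf}k_1$ and the bound $\kappa_1(M)$ of $k$) such that for all $t\ge0$ $$\int_{\mathbb{T}}(u(t)-m_\infty)^2dx+\int_{\mathbb{T}}(v(t)-m_\infty)^2dx\le\Lambda_\alpha e^{-2\lambda_\alpha t}\Big[\int_{\mathbb{T}}(u_0-m_\infty)^2dx+\int_{\mathbb{T}}(v_0-m_\infty)^2dx\Big].$$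
   Context: $\mathbb{T}=\mathbb{R}/\mathbb{Z}$ with Lebesgue measure of total mass $1$; $c>0$ is fixed. The one-dimensional system is $\partial_t u+c\partial_x u=k(u,v,x)(v-u)$, $\partial_t v-c\partial_x v=k(u,v,x)(u-v)$ on $(0,\infty)\times\mathbb{T}$, $u(0)=u_0$, $v(0)=v_0$. A weak solution is a pair of nonnegative $u,v\in L^\infty([0,T)\times\mathbb{T})\cap C([0,T];L^p(\mathbb{T}))$ for all $T>0,p\in[1,\infty)$ satisfying, for all $\psi\in C_c^\infty([0,\infty)\times\mathbb{T})$, $\int_0^\infty\!\int u(\partial_t\psi+c\partial_x\psi)+\int\psi(0)u_0+\int_0^\infty\!\int k(v-u)\psi=0$ and $\int_0^\infty\!\int v(\partial_t\psi-c\partial_x\psi)+\int\psi(0)v_0+\int_0^\infty\!\int k(u-v)\psi=0$. An interaction rate is a nonnegative measurable $k(u,v,x)$ on $[0,\infty)^2\times\mathbb{T}$; it is of type 1 if for every $\gamma>0$ there is $\kappa_1(\gamma)>0$ with $k(u,v,x)\le\kappa_1(\gamma)$ for $0\le u,v\le\gamma$, $x\in\mathbb{T}$. Known fact (Lions–Toscani): for $k$ of type 1 and nonnegative $L^\infty$ data there is a unique weak solution, and it satisfies $0\le u(t),v(t)\le M$ a.e. for all $t\ge0$. *)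

theory Defs
  imports "HOL-Analysis.Analysis"
begin

text \<open>The torus T = R/Z is represented by the fundamental domain [0,1] with
Lebesgue measure (total mass 1).  Functions on T are real functions of which only
the values on [0,1] matter; test functions are required to be 1-periodic in x.\<close>

abbreviation Tmeas :: "real measure" where "Tmeas \<equiv> lebesgue_on {0..1}"

definition Linf_T :: "(real \<Rightarrow> real) \<Rightarrow> bool" where
  "Linf_T f \<longleftrightarrow> f \<in> borel_measurable Tmeas \<and> (\<exists>B. AE x in Tmeas. \<bar>f x\<bar> \<le> B)"

definition Linf_norm :: "(real \<Rightarrow> real) \<Rightarrow> real" where
  "Linf_norm f = Inf {B. AE x in Tmeas. \<bar>f x\<bar> \<le> B}"

definition ess_inf_T :: "(real \<Rightarrow> real) \<Rightarrow> real" where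
  "ess_inf_T f = Sup {B. AE x in Tmeas. B \<le> f x}"

abbreviation d_t :: "(real \<times> real \<Rightarrow> real) \<Rightarrow> real \<times> real \<Rightarrow> real" where
  "d_t f z \<equiv> frechet_derivative f (at z) (1, 0)"

abbreviation d_x :: "(real \<times> real \<Rightarrow> real) \<Rightarrow> real \<times> real \<Rightarrow> real" where
  "d_x f z \<equiv> frechet_derivative f (at z) (0, 1)"

coinductive smooth2 :: "(real \<times> real \<Rightarrow> real) \<Rightarrow> bool" where
  "\<lbrakk>\<forall>z. f differentiable (at z); smooth2 (d_t f); smooth2 (d_x f)\<rbrakk> \<Longrightarrow> smooth2 f"

definition test_fun :: "(real \<times> real \<Rightarrow> real) \<Rightarrow> bool" where
  "test_fun \<psi> \<longleftrightarrow> smooth2 \<psi> \<and> (\<forall>t x. \<psi> (t, x + 1) = \<psi> (t, x))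
     \<and> (\<exists>R. \<forall>t x. t \<ge> R \<longrightarrow> \<psi> (t, x) = 0)"

definition interaction_rate :: "(real \<Rightarrow> real \<Rightarrow> real \<Rightarrow> real) \<Rightarrow> bool" where
  "interaction_rate k \<longleftrightarrow>
     (\<lambda>(a, b, x). k a b x) \<in> borel_measurable (restrict_space borel ({0..} \<times> {0..} \<times> {0..1}))
     \<and> (\<forall>a b x. 0 \<le> a \<longrightarrow> 0 \<le> b \<longrightarrow> x \<in> {0..1} \<longrightarrow> 0 \<le> k a b x)"

definition type1 :: "(real \<Rightarrow> real \<Rightarrow> real \<Rightarrow> real) \<Rightarrow> bool" where
  "type1 k \<longleftrightarrow> (\<forall>\<gamma>>0. \<exists>\<kappa>>0. \<forall>a b x. 0 \<le> a \<longrightarrow> a \<le> \<gamma> \<longrightarrow> 0 \<le> b \<longrightarrow> b \<le> \<gamma>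
                    \<longrightarrow> x \<in> {0..1} \<longrightarrow> k a b x \<le> \<kappa>)"

definition sol_space :: "(real \<Rightarrow> real \<Rightarrow> real) \<Rightarrow> bool" where
  "sol_space u \<longleftrightarrow>
     (\<forall>T>0. (\<lambda>(t, x). u t x) \<in> borel_measurable (lebesgue_on ({0..<T} \<times> {0..1}))
        \<and> (\<exists>B. AE z in lebesgue_on ({0..<T} \<times> {0..1}). \<bar>(\<lambda>(t, x). u t x) z\<bar> \<le> B))
     \<and> (AE z in lebesgue_on ({0..} \<times> {0..1}). 0 \<le> (\<lambda>(t, x). u t x) z)
     \<and> (\<forall>t\<ge>0. \<forall>p\<ge>1. u t \<in> borel_measurable Tmeas
          \<and> integrable Tmeas (\<lambda>x. \<bar>u t x\<bar> powr p)
          \<and> ((\<lambda>s. LINT x|Tmeas. \<bar>u s x - u t x\<bar> powr p) \<longlongrightarrow> 0) (at t within {0..}))"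

text \<open>Weak solution of
  u_t + c u_x = k(u,v,x)(v-u),  v_t - c v_x = k(u,v,x)(u-v),  u(0)=u0, v(0)=v0.\<close>
definition weak_solution ::
  "real \<Rightarrow> (real \<Rightarrow> real \<Rightarrow> real \<Rightarrow> real) \<Rightarrow> (real \<Rightarrow> real) \<Rightarrow> (real \<Rightarrow> real)
     \<Rightarrow> (real \<Rightarrow> real \<Rightarrow> real) \<Rightarrow> (real \<Rightarrow> real \<Rightarrow> real) \<Rightarrow> bool" where
  "weak_solution c k u0 v0 u v \<longleftrightarrow> sol_space u \<and> sol_space v \<and>
     (\<forall>\<psi>. test_fun \<psi> \<longrightarrow>
        (LINT z|lebesgue_on ({0..} \<times> {0..1}).
            (\<lambda>(t, x). u t x * (d_t \<psi> (t, x) + c * d_x \<psi> (t, x))) z)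
        + (LINT x|Tmeas. \<psi> (0, x) * u0 x)
        + (LINT z|lebesgue_on ({0..} \<times> {0..1}).
            (\<lambda>(t, x). k (u t x) (v t x) x * (v t x - u t x) * \<psi> (t, x)) z) = 0
      \<and> (LINT z|lebesgue_on ({0..} \<times> {0..1}).
            (\<lambda>(t, x). v t x * (d_t \<psi> (t, x) - c * d_x \<psi> (t, x))) z)
        + (LINT x|Tmeas. \<psi> (0, x) * v0 x)
        + (LINT z|lebesgue_on ({0..} \<times> {0..1}).
            (\<lambda>(t, x). k (u t x) (v t x) x * (u t x - v t x) * \<psi> (t, x)) z) = 0)"

end

theory Submission
  imports Defs
begin

text \<open>
  Along characteristics a weak solution is, for every \<open>t > 0\<close> and almost every \<open>x\<close>, the time primitive of the
  bounded exchange term \<open>F = k(u,v,x)(v - u)\<close>.  This makes energy identities rigorous: they give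
  conservation of mass, the maximum principle \<open>u, v \<le> M\<close> (from the energy of \<open>(u - M)\<^sub>+\<close> and \<open>(v - M)\<^sub>+\<close>) and
  \<open>H' = -2D\<close>, where \<open>H = \<integral>(u-m)\<^sup>2 + (v-m)\<^sup>2\<close> and \<open>D = \<integral>k(u-v)\<^sup>2\<close>.

  Since \<open>u + v \<le> 2M\<close> and \<open>\<alpha> \<le> 1\<close>, the rate satisfies \<open>k \<ge> k\<^sub>*(u + v)\<close>.  With \<open>\<rho> = u + v\<close> and \<open>j = u - v\<close>,
  adding to \<open>H\<close> a small multiple of \<open>-\<integral>j \<Phi>\<close>, where \<open>\<Phi>\<close> is the periodic primitive of \<open>\<rho> - 2m\<close>, produces the
  missing dissipation \<open>-c\<parallel>\<rho> - 2m\<parallel>\<^sup>2\<close> at the cost of \<open>c\<parallel>j\<parallel>\<^sup>2\<close>.  The degeneracy of \<open>k\<close> at the vacuum is harmless: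
  where \<open>\<rho> < m/2\<close> one has \<open>j\<^sup>2 \<le> \<rho>\<^sup>2 \<le> (\<rho> - 2m)\<^sup>2/9\<close>, and elsewhere \<open>j\<^sup>2\<close> is controlled by \<open>k j\<^sup>2\<close>.
\<close>

section \<open>Lebesgue measure on intervals and on the torus\<close>

text \<open>The obstacle is that \<open>u\<close> and \<open>v\<close> are Lipschitz in time only
  along their own characteristics, and no frame serves both. Each summand of \<open>H\<close> lives
  in one frame; the correction mixes the two. Let S(z) = frac z - 1/2. Then \<Phi>(x) = \<integral>
  \<rho>(y) S(y - x) dy is the mean-free primitive of \<rho> - 2m. Since S is odd up to null sets,
  the uu and vv parts of \<integral> j \<Phi> cancel, and \<integral> j \<Phi> is twice the double
  integral of u(x) v(y) S(y - x). With labels a = x - ct and b = y + ct, both densities are time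
  primitives at fixed label and only the kernel S(b - a - 2ct) moves, at the relative speed 2c. Its
  jump sits where the two characteristics meet, so the derivative contains 2c (\<integral> uv -
  \<integral> u \<integral> v). Conservation of mass bounds four times the bracket below by the
  squared norm of \<rho> - 2m minus that of j, which is how the missing dissipation appears. As the
  kernel jumps and the densities need not be continuous in space, this term is derived in
  time-integrated form, never as a pointwise derivative.\<close>

definition iv :: "real \<Rightarrow> real \<Rightarrow> real measure" where
  "iv a b = density lborel (\<lambda>x. ennreal (indicator {a..b} x))"

text \<open>A density on \<open>lborel\<close> keeps the sigma-algebra Borel on the whole line, so
  measurability is never relative to an interval.\<close>

lemma sets_iv [simp, measurable_cong]: "sets (iv a b) = sets borel"
  and space_iv [simp]: "space (iv a b) = UNIV"
  by (simp_all add: iv_def)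

lemma emeasure_iv: "A \<in> sets borel \<Longrightarrow> emeasure (iv a b) A = emeasure lborel ({a..b} \<inter> A)"
  unfolding iv_def by (simp add: emeasure_density flip: indicator_inter_arith ennreal_mult' ennreal_indicator)
    (simp add: ennreal_indicator indicator_inter_arith[symmetric])

lemma finite_measure_iv [simp]: "finite_measure (iv a b)"
  by standard (cases "a \<le> b", auto simp: emeasure_iv)

lemma sigma_finite_iv [simp]: "sigma_finite_measure (iv a b)"
  by (simp add: finite_measure.axioms)

lemma measure_iv: "a \<le> b \<Longrightarrow> measure (iv a b) UNIV = b - a"
  by (simp add: measure_def emeasure_iv)

lemma AE_iv: "(AE x in iv a b. P x) \<longleftrightarrow> (AE x in lborel. a \<le> x \<and> x \<le> b \<longrightarrow> P x)"
  unfolding iv_def by (subst AE_density) (auto simp: indicator_def)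

lemma AE_ivI: "(\<And>x. a \<le> x \<Longrightarrow> x \<le> b \<Longrightarrow> P x) \<Longrightarrow> AE x in iv a b. P x"
  by (simp add: AE_iv)

lemma AE_iv_mono: "AE x in iv a b. P x \<Longrightarrow> a \<le> s \<Longrightarrow> t \<le> b \<Longrightarrow> AE x in iv s t. P x"
  unfolding AE_iv by (erule AE_mp) auto

lemma integral_iv:
  fixes f :: "real \<Rightarrow> real"
  assumes [measurable]: "f \<in> borel_measurable borel"
  shows "(LINT x|iv a b. f x) = (LINT x|lborel. indicator {a..b} x * f x)"
  unfolding iv_def by (subst integral_density) auto

lemma integrable_iv:
  fixes f :: "real \<Rightarrow> real"
  assumes [measurable]: "f \<in> borel_measurable borel" and "\<And>x. a \<le> x \<Longrightarrow> x \<le> b \<Longrightarrow> \<bar>f x\<bar> \<le> K"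
  shows "integrable (iv a b) f"
  by (rule finite_measure.integrable_const_bound[where B=K]) (auto intro!: AE_ivI assms)

lemma integral_iv_bound:
  fixes f :: "real \<Rightarrow> real"
  assumes "a \<le> b" "\<And>x. a \<le> x \<Longrightarrow> x \<le> b \<Longrightarrow> \<bar>f x\<bar> \<le> K" "0 \<le> K"
  shows "\<bar>LINT x|iv a b. f x\<bar> \<le> K * (b - a)"
proof (cases "f \<in> borel_measurable borel")
  case True
  have "\<bar>LINT x|iv a b. f x\<bar> \<le> (LINT x|iv a b. \<bar>f x\<bar>)"
    by (rule integral_abs_bound)
  also have "\<dots> \<le> (LINT x|iv a b. K)"
    using True assms by (intro integral_mono_AE integrable_iv[where K=K]) (auto intro!: AE_ivI)
  also have "\<dots> = K * (b - a)"
    using assms by (simp add: measure_iv)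
  finally show ?thesis .
next
  \<comment> \<open>A function that is not Borel is not integrable here, and its Bochner integral is
    0 by convention.\<close>
  case False
  then have "\<not> integrable (iv a b) f" by (auto dest: borel_measurable_integrable)
  then show ?thesis using assms by (simp add: not_integrable_integral_eq)
qed

lemma integral_iv_empty: "b \<le> a \<Longrightarrow> (LINT x|iv a b. f x :: real) = 0"
proof -
  assume "b \<le> a"
  have "AE x in iv a b. f x = 0"
    unfolding AE_iv using AE_lborel_singleton[of a] by eventually_elim (use \<open>b \<le> a\<close> in linarith)
  then show ?thesis
    by (rule integral_eq_zero_AE)
qed

lemma integral_iv_combine:
  fixes f :: "real \<Rightarrow> real"
  assumes [measurable]: "f \<in> borel_measurable borel" and K: "\<And>x. a \<le> x \<Longrightarrow> x \<le> d \<Longrightarrow> \<bar>f x\<bar> \<le> K"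
    and "a \<le> b" "b \<le> d"
  shows "(LINT x|iv a d. f x) = (LINT x|iv a b. f x) + (LINT x|iv b d. f x)"
proof -
  have I: "integrable lborel (\<lambda>x. indicator {p..q} x * f x)" if "a \<le> p" "q \<le> d" for p q
  proof -
    have "integrable (iv p q) f" by (rule integrable_iv[where K=K]) (use that K in auto)
    then show ?thesis unfolding iv_def by (subst (asm) integrable_density) auto
  qed
  show ?thesis
    unfolding integral_iv[OF assms(1)] 
    apply (subst Bochner_Integration.integral_add[symmetric])
      apply (rule I; use assms in simp)+
    apply (rule integral_cong_AE)
      apply measurable
    using AE_lborel_singleton[of b] 
    apply eventually_elim
    using assms by (auto simp: indicator_def)
qed

lemma integral_iv_affine:
  fixes f :: "real \<Rightarrow> real"
  assumes [measurable]: "f \<in> borel_measurable borel" and "0 < r"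
  shows "(LINT x|iv (p + r * s) (p + r * t). f x) = r * (LINT x|iv s t. f (p + r * x))"
proof -
  have "(LINT x|iv (p + r * s) (p + r * t). f x) = r * (LINT x|lborel. indicator {p + r * s..p + r * t} (p + r * x) * f (p + r * x))"
    unfolding integral_iv[OF assms(1)]
    by (subst lborel_integral_real_affine[where c=r and t=p]) (use assms in auto)
  also have "\<dots> = r * (LINT x|lborel. indicator {s..t} x * f (p + r * x))"
    by (rule arg_cong[where f="\<lambda>z. r * z"], rule Bochner_Integration.integral_cong)
       (use assms in \<open>auto simp: indicator_def\<close>)
  finally show ?thesis by (simp add: integral_iv)
qed

section \<open>Rotation invariance on the circle\<close>

abbreviation mu :: "real measure" where "mu \<equiv> iv 0 1"

lemma borel_measurable_frac [measurable]: "(frac :: real \<Rightarrow> real) \<in> borel_measurable borel"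
  unfolding frac_def by measurable

text \<open>With \<open>r = frac a\<close>, the rotation carries \<open>[0, 1 - r)\<close> onto
  \<open>[r, 1)\<close> and \<open>[1 - r, 1)\<close> onto \<open>[0, r)\<close>: two translations
  with disjoint images.\<close>

lemma distr_frac_shift: "distr mu borel (\<lambda>x. frac (x + a)) = mu"
proof (rule measure_eqI)
  fix A :: "real set" assume "A \<in> sets (distr mu borel (\<lambda>x. frac (x + a)))"
  then have [measurable]: "A \<in> sets borel" by simp
  define r where "r = frac a"
  have r: "0 \<le> r" "r < 1" by (auto simp: r_def frac_lt_1)
  have fr: "frac (x + a) = (if x + r < 1 then x + r else x + r - 1)" if "0 \<le> x" "x < 1" for x
    using that frac_add[of x a] frac_eq[of x] by (auto simp: r_def)
  have tr: "emeasure lborel {x. x + b \<in> B} = emeasure lborel B" if [measurable]: "B \<in> sets borel" for B and b :: real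
  proof -
    have "emeasure lborel B = emeasure (distr lborel borel ((+) b)) B" by (simp add: lborel_distr_plus)
    also have "\<dots> = emeasure lborel {x. x + b \<in> B}"
      by (subst emeasure_distr) (auto simp: vimage_def add.commute)
    finally show ?thesis ..
  qed
  have "emeasure (distr mu borel (\<lambda>x. frac (x + a))) A = emeasure lborel ({0..1} \<inter> {x. frac (x + a) \<in> A})"
    by (subst emeasure_distr) (auto simp: emeasure_iv vimage_def)
  also have "\<dots> = emeasure lborel ({x. x + r \<in> A \<inter> {r..<1}} \<union> {x. x + (r - 1) \<in> A \<inter> {0..<r}})"
  proof (rule emeasure_eq_AE)
    \<comment> \<open>The point 1 is a second copy of 0 in the fundamental domain and may violate
      the equivalence; it is a null set.\<close>
    show "AE x in lborel. (x \<in> {0..1} \<inter> {x. frac (x + a) \<in> A}) = (x \<in> {x. x + r \<in> A \<inter> {r..<1}} \<union> {x. x + (r - 1) \<in> A \<inter> {0..<r}})"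
      using AE_lborel_singleton[of 1]
    proof eventually_elim
      case (elim x)
      show ?case
      proof (cases "0 \<le> x \<and> x < 1")
        case True
        then show ?thesis using fr[of x] r by (auto simp: algebra_simps)
      next
        case False
        then show ?thesis using elim r by auto
      qed
    qed
  qed measurable
  also have "\<dots> = emeasure lborel {x. x + r \<in> A \<inter> {r..<1}} + emeasure lborel {x. x + (r - 1) \<in> A \<inter> {0..<r}}"
    by (rule plus_emeasure[symmetric]) (use r in auto)
  also have "\<dots> = emeasure lborel (A \<inter> {r..<1}) + emeasure lborel (A \<inter> {0..<r})"
    by (simp only: tr sets.Int \<open>A \<in> sets borel\<close> atLeastLessThan_borel)
  also have "\<dots> = emeasure lborel (A \<inter> {0..<1})"
    by (subst plus_emeasure) (use r in \<open>auto intro!: arg_cong[where f="emeasure lborel"]\<close>)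
  also have "\<dots> = emeasure lborel ({0..1} \<inter> A)"
    by (rule emeasure_eq_AE) (use AE_lborel_singleton[of "1::real"] in \<open>auto elim!: eventually_mono\<close>)
  finally show "emeasure (distr mu borel (\<lambda>x. frac (x + a))) A = emeasure mu A"
    by (simp add: emeasure_iv)
qed simp

lemma integral_frac_shift:
  fixes f :: "real \<Rightarrow> real"
  assumes "f \<in> borel_measurable borel"
  shows "(LINT x|mu. f (frac (x + a))) = (LINT x|mu. f x)"
proof -
  have "(LINT x|mu. f x) = (LINT x|distr mu borel (\<lambda>x. frac (x + a)). f x)" by (simp add: distr_frac_shift)
  also have "\<dots> = (LINT x|mu. f (frac (x + a)))"
    by (rule integral_distr) (use assms in auto)
  finally show ?thesis ..
qed

lemma AE_frac_shift:
  assumes "AE x in mu. P x"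
  shows "AE x in mu. P (frac (x + a))"
proof -
  have "AE x in distr mu borel (\<lambda>x. frac (x + a)). P x" using assms unfolding distr_frac_shift .
  from AE_distrD[OF _ this] show ?thesis by simp
qed

lemma frac_add_frac: "frac (frac x + y) = frac (x + y)" "frac (frac x - y) = frac (x - y :: real)"
  by (simp, metis frac_add_simps(1) diff_conv_add_uminus)

abbreviation borel2 :: "(real \<Rightarrow> real \<Rightarrow> real) \<Rightarrow> bool" where
  "borel2 f \<equiv> case_prod f \<in> borel_measurable (borel \<Otimes>\<^sub>M borel)"

section \<open>Primitives of bounded Borel functions\<close>

lemma measurable_integral_iv:
  fixes g :: "'a \<Rightarrow> real \<Rightarrow> real"
  assumes "case_prod g \<in> borel_measurable (M \<Otimes>\<^sub>M borel)"
  shows "(\<lambda>t. LINT y|iv a b. g t y) \<in> borel_measurable M"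
proof -
  have "case_prod g \<in> borel_measurable (M \<Otimes>\<^sub>M iv a b)"
    using assms measurable_cong_sets[OF sets_pair_measure_cong[OF refl sets_iv] refl] by blast
  then show ?thesis
    by (intro sigma_finite_measure.borel_measurable_lebesgue_integral) simp_all
qed

lemma fubini_iv:
  fixes g :: "real \<Rightarrow> real \<Rightarrow> real"
  assumes [measurable]: "case_prod g \<in> borel_measurable (borel \<Otimes>\<^sub>M borel)"
    and K: "\<And>t y. a \<le> t \<Longrightarrow> t \<le> b \<Longrightarrow> c \<le> y \<Longrightarrow> y \<le> d \<Longrightarrow> \<bar>g t y\<bar> \<le> K"
  shows "(LINT y|iv c d. LINT t|iv a b. g t y) = (LINT t|iv a b. LINT y|iv c d. g t y)"
    and "integrable (iv a b \<Otimes>\<^sub>M iv c d) (case_prod g)"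
proof -
  interpret A: finite_measure "iv a b" by simp
  interpret B: finite_measure "iv c d" by simp
  interpret P: pair_sigma_finite "iv a b" "iv c d" by standard
  interpret AB: finite_measure "iv a b \<Otimes>\<^sub>M iv c d"
    by (rule finite_measure_pair_measure) simp_all
  have "AE z in iv a b \<Otimes>\<^sub>M iv c d. \<bar>case_prod g z\<bar> \<le> K"
  proof (rule P.AE_pair_measure)
    show "AE x in iv a b. AE y in iv c d. \<bar>case_prod g (x, y)\<bar> \<le> K"
      using K by (auto intro!: AE_ivI)
  qed measurable
  then show I: "integrable (iv a b \<Otimes>\<^sub>M iv c d) (case_prod g)"
    by (intro AB.integrable_const_bound[where B=K]) auto
  show "(LINT y|iv c d. LINT t|iv a b. g t y) = (LINT t|iv a b. LINT y|iv c d. g t y)"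
    using P.Fubini_integral[OF I] by simp
qed

text \<open>An increment divided by its step is at most \<open>\<bar>C\<bar>\<close> times the step,
  so the derivative is 0 at every point of \<open>{0..T}\<close>. An additive error of second order
  therefore leaves no trace.\<close>

lemma constant_if_quadratic_increments:
  fixes f :: "real \<Rightarrow> real"
  assumes q: "\<And>s t. 0 \<le> s \<Longrightarrow> s \<le> t \<Longrightarrow> t \<le> T \<Longrightarrow> t - s \<le> d \<Longrightarrow> \<bar>f t - f s\<bar> \<le> C * (t - s)\<^sup>2"
    and "0 < d" "0 \<le> t" "t \<le> T"
  shows "f t = f 0"
proof -
  have "(f has_derivative (\<lambda>h. 0)) (at x within {0..T})" if x: "x \<in> {0..T}" for x
    unfolding has_derivative_iff_norm
  proof (intro conjI)
    show "bounded_linear (\<lambda>h::real. 0::real)" by simp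
    have C: "((\<lambda>y. \<bar>C\<bar> * \<bar>y - x\<bar>) \<longlongrightarrow> 0) (at x within {0..T})"
      by (auto intro!: tendsto_eq_intros)
    show "((\<lambda>y. norm (f y - f x - 0) / norm (y - x)) \<longlongrightarrow> 0) (at x within {0..T})"
    proof (rule tendsto_sandwich[OF _ _ tendsto_const C])
      have "\<forall>\<^sub>F y in at x within {0..T}. y \<in> {0..T} \<and> y \<noteq> x \<and> dist y x < d"
        using assms(2) by (auto simp: eventually_at intro: exI[of _ d])
      then show "\<forall>\<^sub>F y in at x within {0..T}. norm (f y - f x - 0) / norm (y - x) \<le> \<bar>C\<bar> * \<bar>y - x\<bar>"
      proof eventually_elim
        case (elim y)
        have "\<bar>f y - f x\<bar> \<le> C * (y - x)\<^sup>2"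
        proof (cases "x \<le> y")
          case True then show ?thesis using q[of x y] elim x by (auto simp: dist_real_def)
        next
          case False
          have "\<bar>f x - f y\<bar> \<le> C * (x - y)\<^sup>2" using q[of y x] False elim x by (auto simp: dist_real_def)
          then show ?thesis by (simp add: power2_commute abs_minus_commute)
        qed
        also have "\<dots> \<le> \<bar>C\<bar> * (y - x)\<^sup>2" by (intro mult_right_mono) auto
        also have "\<dots> = \<bar>C\<bar> * \<bar>y - x\<bar> * \<bar>y - x\<bar>" by (simp add: power2_eq_square)
        finally show ?case using elim by (simp add: divide_simps)
      qed
    qed auto
  qed
  from has_derivative_zero_constant[OF _ this] obtain k where "\<And>x. x \<in> {0..T} \<Longrightarrow> f x = k" by auto
  then show ?thesis using assms by auto
qed

text \<open>The integral form of being Lipschitz on \<open>{0..T}\<close>, with \<open>g\<close> a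
  bounded Borel version of the derivative. It gives a formula for \<open>p\<close> at every time
  although \<open>g\<close> matters only up to null sets.\<close>

definition prim :: "real \<Rightarrow> (real \<Rightarrow> real) \<Rightarrow> (real \<Rightarrow> real) \<Rightarrow> bool" where
  "prim T p g \<longleftrightarrow> p \<in> borel_measurable borel \<and> g \<in> borel_measurable borel
     \<and> (\<exists>K. \<forall>t\<in>{0..T}. \<bar>g t\<bar> \<le> K) \<and> (\<forall>t\<in>{0..T}. p t = p 0 + (LINT s|iv 0 t. g s))"

lemma primI:
  assumes "p \<in> borel_measurable borel" "g \<in> borel_measurable borel"
    and "\<And>t. 0 \<le> t \<Longrightarrow> t \<le> T \<Longrightarrow> \<bar>g t\<bar> \<le> K"
    and "\<And>t. 0 \<le> t \<Longrightarrow> t \<le> T \<Longrightarrow> p t = p 0 + (LINT s|iv 0 t. g s)"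
  shows "prim T p g"
  unfolding prim_def using assms by (meson atLeastAtMost_iff)

lemma prim_measurable:
  assumes "prim T p g"
  shows "p \<in> borel_measurable borel" "g \<in> borel_measurable borel"
  using assms unfolding prim_def by blast+

lemma prim_bounded_deriv:
  assumes "prim T p g"
  obtains K where "0 \<le> K" "\<And>t. 0 \<le> t \<Longrightarrow> t \<le> T \<Longrightarrow> \<bar>g t\<bar> \<le> K"
proof -
  obtain K where "\<forall>t\<in>{0..T}. \<bar>g t\<bar> \<le> K" using assms unfolding prim_def by blast
  then show thesis by (intro that[of "\<bar>K\<bar>"]) (auto intro: order_trans[OF _ abs_ge_self])
qed

lemma prim_eq:
  assumes "prim T p g" "0 \<le> t" "t \<le> T"
  shows "p t = p 0 + (LINT s|iv 0 t. g s)"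
  using assms unfolding prim_def by (meson atLeastAtMost_iff)

lemma prim_diff:
  assumes "prim T p g" "0 \<le> s" "s \<le> t" "t \<le> T"
  shows "p t - p s = (LINT r|iv s t. g r)"
proof -
  obtain K where "\<And>t. 0 \<le> t \<Longrightarrow> t \<le> T \<Longrightarrow> \<bar>g t\<bar> \<le> K" using prim_bounded_deriv[OF assms(1)] by blast
  then have "(LINT r|iv 0 t. g r) = (LINT r|iv 0 s. g r) + (LINT r|iv s t. g r)"
    using assms by (intro integral_iv_combine[where K=K]) (auto simp: prim_measurable[OF assms(1)])
  then show ?thesis using prim_eq[OF assms(1), of s] prim_eq[OF assms(1), of t] assms by linarith
qed

lemma prim_lipschitz:
  assumes "prim T p g" "0 \<le> K" "\<And>t. 0 \<le> t \<Longrightarrow> t \<le> T \<Longrightarrow> \<bar>g t\<bar> \<le> K" "0 \<le> s" "s \<le> t" "t \<le> T"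
  shows "\<bar>p t - p s\<bar> \<le> K * (t - s)"
  using assms by (subst prim_diff[OF assms(1,4-)]) (auto intro!: integral_iv_bound)

lemma prim_bounded:
  assumes "prim T p g"
  obtains B where "0 \<le> B" "\<And>t. 0 \<le> t \<Longrightarrow> t \<le> T \<Longrightarrow> \<bar>p t\<bar> \<le> B"
proof (cases "0 \<le> T")
  case True
  obtain K where K: "0 \<le> K" "\<And>t. 0 \<le> t \<Longrightarrow> t \<le> T \<Longrightarrow> \<bar>g t\<bar> \<le> K" using prim_bounded_deriv[OF assms(1)] by blast
  have "\<bar>p t\<bar> \<le> \<bar>p 0\<bar> + K * T" if "0 \<le> t" "t \<le> T" for t
    using prim_lipschitz[OF assms K, of 0 t] that mult_left_mono[of t T K] K by auto
  then show thesis using True K by (intro that[of "\<bar>p 0\<bar> + K * T"]) auto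
next
  case False then show thesis by (intro that[of 0]) auto
qed

text \<open>An increment formula with quadratic error is exact; this replaces almost everywhere differentiation of
  Lipschitz functions throughout.\<close>

lemma primI_quadratic:
  assumes [measurable]: "p \<in> borel_measurable borel" "g \<in> borel_measurable borel"
    and K: "\<And>t. 0 \<le> t \<Longrightarrow> t \<le> T \<Longrightarrow> \<bar>g t\<bar> \<le> K" and "0 < d"
    and q: "\<And>s t. 0 \<le> s \<Longrightarrow> s \<le> t \<Longrightarrow> t \<le> T \<Longrightarrow> t - s \<le> d \<Longrightarrow> \<bar>p t - p s - (LINT r|iv s t. g r)\<bar> \<le> C * (t - s)\<^sup>2"
  shows "prim T p g"
proof -
  have "p t - (LINT r|iv 0 t. g r) = p 0 - (LINT r|iv 0 0. g r)" if "0 \<le> t" "t \<le> T" for t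
  proof (rule constant_if_quadratic_increments[where T=T and d=d and C=C])
    fix s t assume st: "0 \<le> s" "s \<le> t" "t \<le> T" "t - s \<le> d"
    have "(LINT r|iv 0 t. g r) = (LINT r|iv 0 s. g r) + (LINT r|iv s t. g r)"
      by (rule integral_iv_combine[where K=K]) (use st K in auto)
    then show "\<bar>p t - (LINT r|iv 0 t. g r) - (p s - (LINT r|iv 0 s. g r))\<bar> \<le> C * (t - s)\<^sup>2"
      using q[OF st] by (simp add: algebra_simps)
  qed (use that assms in auto)
  then have "p t = p 0 + (LINT r|iv 0 t. g r)" if "0 \<le> t" "t \<le> T" for t
    using that integral_iv_empty[of 0 0 g] by fastforce
  from primI[OF assms(1,2) K this] show ?thesis by simp
qed

lemma prim_add:
  assumes "prim T p g" "prim T q h"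
  shows "prim T (\<lambda>t. p t + q t) (\<lambda>t. g t + h t)"
proof -
  obtain K where K: "0 \<le> K" "\<And>t. 0 \<le> t \<Longrightarrow> t \<le> T \<Longrightarrow> \<bar>g t\<bar> \<le> K" using prim_bounded_deriv[OF assms(1)] by blast
  obtain L where L: "0 \<le> L" "\<And>t. 0 \<le> t \<Longrightarrow> t \<le> T \<Longrightarrow> \<bar>h t\<bar> \<le> L" using prim_bounded_deriv[OF assms(2)] by blast
  note [measurable] = prim_measurable[OF assms(1)] prim_measurable[OF assms(2)]
  have ad: "(LINT s|iv 0 t. g s + h s) = (LINT s|iv 0 t. g s) + (LINT s|iv 0 t. h s)" if "0 \<le> t" "t \<le> T" for t
    by (rule Bochner_Integration.integral_add) (use K L that in \<open>auto intro!: integrable_iv[where f=g and K=K] integrable_iv[where f=h and K=L]\<close>)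
  have bd: "\<bar>g t + h t\<bar> \<le> K + L" if "0 \<le> t" "t \<le> T" for t
    using K(2)[OF that] L(2)[OF that] by linarith
  have eq: "p t + q t = p 0 + q 0 + (LINT s|iv 0 t. g s + h s)" if "0 \<le> t" "t \<le> T" for t
    using prim_eq[OF assms(1) that] prim_eq[OF assms(2) that] ad[OF that] by linarith
  show ?thesis by (rule primI[OF _ _ bd eq]) measurable
qed

lemma prim_cmult:
  assumes "prim T p g"
  shows "prim T (\<lambda>t. a * p t) (\<lambda>t. a * g t)"
proof -
  obtain K where K: "0 \<le> K" "\<And>t. 0 \<le> t \<Longrightarrow> t \<le> T \<Longrightarrow> \<bar>g t\<bar> \<le> K" using prim_bounded_deriv[OF assms(1)] by blast
  have bd: "\<bar>a * g t\<bar> \<le> \<bar>a\<bar> * K" if "0 \<le> t" "t \<le> T" for t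
    using K(2)[OF that] by (simp add: abs_mult mult_left_mono)
  have eq: "a * p t = a * p 0 + (LINT s|iv 0 t. a * g s)" if "0 \<le> t" "t \<le> T" for t
    by (subst prim_eq[OF assms that]) (simp add: algebra_simps)
  show ?thesis by (rule primI[OF _ _ bd eq]) (use prim_measurable[OF assms] in measurable)
qed

lemma prim_chain:
  fixes \<phi> \<phi>' :: "real \<Rightarrow> real"
  assumes "prim T p g"
    and [measurable]: "\<phi> \<in> borel_measurable borel" "\<phi>' \<in> borel_measurable borel"
    and taylor: "\<And>x y. \<bar>\<phi> y - \<phi> x - \<phi>' x * (y - x)\<bar> \<le> C * (y - x)\<^sup>2"
    and lip: "\<And>x y. \<bar>\<phi>' y - \<phi>' x\<bar> \<le> C * \<bar>y - x\<bar>"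
  shows "prim T (\<lambda>t. \<phi> (p t)) (\<lambda>t. \<phi>' (p t) * g t)"
proof -
  have C: "0 \<le> C" using order_trans[OF abs_ge_zero lip[of 1 0]] by simp
  obtain K where K: "0 \<le> K" "\<And>t. 0 \<le> t \<Longrightarrow> t \<le> T \<Longrightarrow> \<bar>g t\<bar> \<le> K" using prim_bounded_deriv[OF assms(1)] by blast
  obtain A where A: "0 \<le> A" "\<And>t. 0 \<le> t \<Longrightarrow> t \<le> T \<Longrightarrow> \<bar>p t\<bar> \<le> A" using prim_bounded[OF assms(1)] by blast
  note [measurable] = prim_measurable[OF assms(1)]
  define B where "B = \<bar>\<phi>' 0\<bar> + C * A"
  have B: "\<bar>\<phi>' (p t)\<bar> \<le> B" if "0 \<le> t" "t \<le> T" for t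
    using lip[where y="p t" and x=0] A(2)[OF that] C mult_left_mono[of "\<bar>p t\<bar>" A C] unfolding B_def by auto
  have B0: "0 \<le> B" using A C by (auto simp: B_def)
  have bd: "\<bar>\<phi>' (p t) * g t\<bar> \<le> B * K" if "0 \<le> t" "t \<le> T" for t
    unfolding abs_mult using B[OF that] K(2)[OF that] B0 by (intro mult_mono) auto
  show ?thesis
  proof (rule primI_quadratic[where d=1 and C="2 * (C * K * K)" and K="B * K"])
    fix s t assume st: "0 \<le> s" "s \<le> t" "t \<le> T"
    have I: "integrable (iv s t) g" "integrable (iv s t) (\<lambda>r. \<phi>' (p r) * g r)"
      using st K by (auto intro!: integrable_iv[where f=g and K=K] integrable_iv[where f="\<lambda>r. \<phi>' (p r) * g r" and K="B*K"] bd)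
    have "\<phi>' (p s) * (p t - p s) - (LINT r|iv s t. \<phi>' (p r) * g r) = (LINT r|iv s t. (\<phi>' (p s) - \<phi>' (p r)) * g r)"
      unfolding prim_diff[OF assms(1) st] using I by (simp add: left_diff_distrib)
    moreover have "\<bar>LINT r|iv s t. (\<phi>' (p s) - \<phi>' (p r)) * g r\<bar> \<le> (C * (K * (t - s)) * K) * (t - s)"
    proof (rule integral_iv_bound)
      fix r assume r: "s \<le> r" "r \<le> t"
      have "\<bar>\<phi>' (p s) - \<phi>' (p r)\<bar> \<le> C * \<bar>p r - p s\<bar>" using lip[where x="p r" and y="p s"] by (simp add: abs_minus_commute)
      also have "\<dots> \<le> C * (K * (t - s))"
        using prim_lipschitz[OF assms(1) K, of s r] r st K mult_left_mono[of "r - s" "t - s" K] C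
        by (intro mult_left_mono) auto
      finally show "\<bar>(\<phi>' (p s) - \<phi>' (p r)) * g r\<bar> \<le> C * (K * (t - s)) * K"
        unfolding abs_mult using K r st C by (intro mult_mono) auto
    qed (use st K C in auto)
    moreover have "\<bar>\<phi> (p t) - \<phi> (p s) - \<phi>' (p s) * (p t - p s)\<bar> \<le> C * (K * (t - s))\<^sup>2"
    proof -
      have "(p t - p s)\<^sup>2 \<le> (K * (t - s))\<^sup>2"
        using prim_lipschitz[OF assms(1) K st] by (metis abs_ge_zero power2_abs power_mono)
      then show ?thesis using taylor[of "p t" "p s"] mult_left_mono[OF _ C] by (meson order_trans)
    qed
    ultimately show "\<bar>\<phi> (p t) - \<phi> (p s) - (LINT r|iv s t. \<phi>' (p r) * g r)\<bar> \<le> 2 * (C * K * K) * (t - s)\<^sup>2"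
      by (simp add: algebra_simps power2_eq_square)
  qed (use bd in auto)
qed

lemma prim_square:
  assumes "prim T p g"
  shows "prim T (\<lambda>t. (p t)\<^sup>2) (\<lambda>t. 2 * p t * g t)"
proof (rule prim_chain[OF assms, where C=2])
  fix x y :: real
  have "y\<^sup>2 - x\<^sup>2 - 2 * x * (y - x) = (y - x)\<^sup>2" by (simp add: power2_eq_square algebra_simps)
  then show "\<bar>y\<^sup>2 - x\<^sup>2 - 2 * x * (y - x)\<bar> \<le> 2 * (y - x)\<^sup>2" by simp
  show "\<bar>2 * y - 2 * x\<bar> \<le> 2 * \<bar>y - x\<bar>" by (simp add: abs_if)
qed auto

text \<open>Polarization: the product is a quarter of the square of the sum minus a quarter of the
  square of the difference.\<close>

lemma prim_mult:
  assumes "prim T p g" "prim T q h"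
  shows "prim T (\<lambda>t. p t * q t) (\<lambda>t. g t * q t + p t * h t)"
proof -
  note sum = prim_add[OF assms] and diff = prim_add[OF assms(1) prim_cmult[OF assms(2), of "-1"]]
  show ?thesis
    using prim_add[OF prim_cmult[OF prim_square[OF sum], of "1/4"] prim_cmult[OF prim_square[OF diff], of "-1/4"]]
    by (simp add: power2_eq_square algebra_simps)
qed

lemma prim_integral:
  fixes p g :: "real \<Rightarrow> real \<Rightarrow> real"
  assumes [measurable]: "case_prod p \<in> borel_measurable (borel \<Otimes>\<^sub>M borel)" "case_prod g \<in> borel_measurable (borel \<Otimes>\<^sub>M borel)"
    and K: "\<And>t y. 0 \<le> t \<Longrightarrow> t \<le> T \<Longrightarrow> 0 \<le> y \<Longrightarrow> y \<le> 1 \<Longrightarrow> \<bar>g t y\<bar> \<le> K"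
    and B: "\<And>y. 0 \<le> y \<Longrightarrow> y \<le> 1 \<Longrightarrow> \<bar>p 0 y\<bar> \<le> B"
    and pr: "\<And>y. prim T (\<lambda>t. p t y) (\<lambda>t. g t y)"
  shows "prim T (\<lambda>t. LINT y|mu. p t y) (\<lambda>t. LINT y|mu. g t y)"
  unfolding prim_def
proof (intro conjI ballI exI)
  show "(\<lambda>t. LINT y|mu. p t y) \<in> borel_measurable borel" "(\<lambda>t. LINT y|mu. g t y) \<in> borel_measurable borel"
    by (rule measurable_integral_iv; simp)+
  fix t assume t: "t \<in> {0..T}"
  have KK: "\<bar>g s y\<bar> \<le> \<bar>K\<bar>" if "0 \<le> s" "s \<le> T" "0 \<le> y" "y \<le> 1" for s y
    using K[OF that] by linarith
  show "\<bar>LINT y|mu. g t y\<bar> \<le> \<bar>K\<bar>"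
    using integral_iv_bound[of 0 1 "g t" "\<bar>K\<bar>"] KK t by auto
  have K1: "\<bar>LINT s|iv 0 t. g s y\<bar> \<le> \<bar>K\<bar> * t" if "0 \<le> y" "y \<le> 1" for y
    using integral_iv_bound[of 0 t "\<lambda>s. g s y" "\<bar>K\<bar>"] KK t that by auto
  have mI: "(\<lambda>y. LINT s|iv 0 t. g s y) \<in> borel_measurable borel"
    by (rule measurable_integral_iv) measurable
  have "(LINT y|mu. p t y) = (LINT y|mu. p 0 y + (LINT s|iv 0 t. g s y))"
    using t by (intro Bochner_Integration.integral_cong refl prim_eq[OF pr]) auto
  also have "\<dots> = (LINT y|mu. p 0 y) + (LINT y|mu. LINT s|iv 0 t. g s y)"
    by (rule Bochner_Integration.integral_add)
       (use B K1 mI in \<open>auto intro!: integrable_iv[where f="p 0" and K=B] integrable_iv[where f="\<lambda>y. LINT s|iv 0 t. g s y" and K="\<bar>K\<bar> * t"]\<close>)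
  also have "(LINT y|mu. LINT s|iv 0 t. g s y) = (LINT s|iv 0 t. LINT y|mu. g s y)"
    by (rule fubini_iv[where K=K]) (use K t in auto)
  finally show "(LINT y|mu. p t y) = (LINT y|mu. p 0 y) + (LINT s|iv 0 t. LINT y|mu. g s y)" .
qed

section \<open>Transport along characteristics\<close>

lemma measurable_comp2:
  fixes f :: "real \<Rightarrow> real \<Rightarrow> real"
  assumes "case_prod f \<in> borel_measurable (borel \<Otimes>\<^sub>M borel)" "g \<in> borel_measurable M" "h \<in> borel_measurable M"
  shows "(\<lambda>x. f (g x) (h x)) \<in> borel_measurable M"
  using measurable_compose[OF measurable_Pair[OF assms(2,3)] assms(1)] by simp

lemma measurable_section2:
  fixes f :: "real \<Rightarrow> real \<Rightarrow> real"
  assumes "case_prod f \<in> borel_measurable (borel \<Otimes>\<^sub>M borel)"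
  shows "f t \<in> borel_measurable borel"
  using measurable_Pair2[OF assms, of t] by simp

text \<open>The substitution \<open>x = frac (y + a)\<close> moves the shift from one argument to
  the other. It translates between integrals over characteristic labels and integrals over physical
  points.\<close>

lemma integral_frac_shift_pair:
  fixes f :: "real \<Rightarrow> real \<Rightarrow> real"
  assumes [measurable]: "case_prod f \<in> borel_measurable (borel \<Otimes>\<^sub>M borel)"
  shows "(LINT y|mu. f y (frac (y + a))) = (LINT x|mu. f (frac (x - a)) x)"
proof -
  have [measurable]: "(\<lambda>x. f (g x) (h x)) \<in> borel_measurable borel"
    if [measurable]: "g \<in> borel_measurable borel" "h \<in> borel_measurable borel" for g h
    by (rule measurable_comp2[OF assms that])
  have "(LINT x|mu. f (frac (x - a)) x) = (LINT y|mu. f (frac (frac (y + a) - a)) (frac (y + a)))"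
    by (rule integral_frac_shift[symmetric]) measurable
  also have "\<dots> = (LINT y|mu. f y (frac (y + a)))"
  proof (rule integral_cong_AE)
    show "AE y in mu. f (frac (frac (y + a) - a)) (frac (y + a)) = f y (frac (y + a))"
      unfolding AE_iv using AE_lborel_singleton[of 1]
    proof eventually_elim
      case (elim y)
      show ?case
      proof
        assume "0 \<le> y \<and> y \<le> 1"
        then have "frac y = y" using elim by (simp add: frac_eq)
        then show "f (frac (frac (y + a) - a)) (frac (y + a)) = f y (frac (y + a))"
          by (simp add: frac_add_frac)
      qed
    qed
  qed measurable
  finally show ?thesis ..
qed

text \<open>Here \<open>y\<close> is the foot of a characteristic of speed \<open>c\<close>. In this
  co-moving frame the density is a time primitive for each fixed \<open>y\<close>;
  \<open>mild\<close> reads the same function at the physical point.\<close>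

definition transport :: "real \<Rightarrow> (real \<Rightarrow> real \<Rightarrow> real) \<Rightarrow> (real \<Rightarrow> real) \<Rightarrow> real \<Rightarrow> real \<Rightarrow> real" where
  "transport c F w t y = w y + (LINT s|iv 0 t. F s (frac (y + c * s)))"

definition mild :: "real \<Rightarrow> (real \<Rightarrow> real \<Rightarrow> real) \<Rightarrow> (real \<Rightarrow> real) \<Rightarrow> real \<Rightarrow> real \<Rightarrow> real" where
  "mild c F w t x = transport c F w t (frac (x - c * t))"

locale transport_data =
  fixes c K B :: real and F :: "real \<Rightarrow> real \<Rightarrow> real" and w :: "real \<Rightarrow> real"
  assumes F_measurable [measurable]: "case_prod F \<in> borel_measurable (borel \<Otimes>\<^sub>M borel)"
    and w_measurable [measurable]: "w \<in> borel_measurable borel"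
    and F_bound: "\<And>t x. \<bar>F t x\<bar> \<le> K"
    and w_bound: "\<And>y. \<bar>w y\<bar> \<le> B"
begin

lemma K_nonneg: "0 \<le> K" using F_bound[of 0 0] by linarith
lemma B_nonneg: "0 \<le> B" using w_bound[of 0] by linarith

lemmas F_comp [measurable (raw)] = measurable_comp2[OF F_measurable]

lemma transport_measurable: "case_prod (transport c F w) \<in> borel_measurable (borel \<Otimes>\<^sub>M borel)"
proof -
  \<comment> \<open>Moving the time cutoff into the integrand makes the integrating measure
    independent of \<open>t\<close>, as joint measurability in \<open>(t, y)\<close>
    requires.\<close>
  have eq: "transport c F w t y = w y + (LINT s|lborel. (if 0 \<le> s \<and> s \<le> t then 1 else 0) * F s (frac (y + c * s)))" for t y
    unfolding transport_def by (subst integral_iv) (auto simp: indicator_def intro!: Bochner_Integration.integral_cong)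
  show ?thesis unfolding eq[abs_def] by measurable
qed

lemmas transport_comp [measurable (raw)] = measurable_comp2[OF transport_measurable]

lemma mild_comp [measurable (raw)]:
  assumes [measurable]: "g \<in> borel_measurable M" "h \<in> borel_measurable M"
  shows "(\<lambda>x. mild c F w (g x) (h x)) \<in> borel_measurable M"
  unfolding mild_def by measurable

lemma prim_transport: "prim T (\<lambda>t. transport c F w t y) (\<lambda>t. F t (frac (y + c * t)))"
proof (rule primI)
  show "transport c F w t y = transport c F w 0 y + (LINT s|iv 0 t. F s (frac (y + c * s)))" for t
    by (simp add: transport_def integral_iv_empty)
qed (auto intro: F_bound)

lemma transport_bound: "t \<le> T \<Longrightarrow> 0 \<le> T \<Longrightarrow> \<bar>transport c F w t y\<bar> \<le> B + K * T"
proof -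
  assume T: "t \<le> T" "0 \<le> T"
  have "\<bar>LINT s|iv 0 t. F s (frac (y + c * s))\<bar> \<le> K * T"
  proof (cases "0 \<le> t")
    case True
    have "\<bar>LINT s|iv 0 t. F s (frac (y + c * s))\<bar> \<le> K * (t - 0)"
      by (rule integral_iv_bound) (use True F_bound K_nonneg in auto)
    also have "\<dots> \<le> K * T" using T K_nonneg by (auto intro: mult_left_mono)
    finally show ?thesis .
  next
    case False then show ?thesis using T K_nonneg by (simp add: integral_iv_empty)
  qed
  then show ?thesis using w_bound[of y] unfolding transport_def by linarith
qed

lemma mild_bound: "t \<le> T \<Longrightarrow> 0 \<le> T \<Longrightarrow> \<bar>mild c F w t x\<bar> \<le> B + K * T"
  unfolding mild_def by (rule transport_bound)

lemma integral_transport_mild: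
  fixes g :: "real \<Rightarrow> real \<Rightarrow> real"
  assumes [measurable]: "case_prod g \<in> borel_measurable (borel \<Otimes>\<^sub>M borel)"
  shows "(LINT y|mu. g (transport c F w t y) (frac (y + c * t))) = (LINT x|mu. g (mild c F w t x) x)"
proof -
  have "case_prod (\<lambda>y z. g (transport c F w t y) z) \<in> borel_measurable (borel \<Otimes>\<^sub>M borel)"
  proof -
    have "(\<lambda>z. case_prod g (transport c F w t (fst z), snd z)) \<in> borel_measurable (borel \<Otimes>\<^sub>M borel)"
      by measurable
    then show ?thesis by (simp add: case_prod_unfold)
  qed
  from integral_frac_shift_pair[OF this, of "c * t"] show ?thesis
    by (simp add: mild_def)
qed

text \<open>No flux term appears because rotations preserve \<open>mu\<close>: the integral over
  \<open>x\<close> equals the integral over the label \<open>y\<close>, and at a fixed label the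
  chain rule applies in time alone.\<close>

lemma prim_energy:
  fixes \<phi> \<phi>' :: "real \<Rightarrow> real"
  assumes T: "0 \<le> T"
    and [measurable]: "\<phi> \<in> borel_measurable borel" "\<phi>' \<in> borel_measurable borel"
    and taylor: "\<And>x y. \<bar>\<phi> y - \<phi> x - \<phi>' x * (y - x)\<bar> \<le> C * (y - x)\<^sup>2"
    and lip: "\<And>x y. \<bar>\<phi>' y - \<phi>' x\<bar> \<le> C * \<bar>y - x\<bar>"
  shows "prim T (\<lambda>t. LINT x|mu. \<phi> (mild c F w t x)) (\<lambda>t. LINT x|mu. \<phi>' (mild c F w t x) * F t x)"
proof -
  have C: "0 \<le> C" using order_trans[OF abs_ge_zero lip[of 1 0]] by simp
  define A where "A = B + K * T"
  have A: "0 \<le> A" using B_nonneg K_nonneg T by (simp add: A_def)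
  have b': "\<bar>\<phi>' z\<bar> \<le> \<bar>\<phi>' 0\<bar> + C * A" if "\<bar>z\<bar> \<le> A" for z
    using lip[where y=z and x=0] mult_left_mono[OF that C] by simp
  have b: "\<bar>\<phi> z\<bar> \<le> \<bar>\<phi> 0\<bar> + \<bar>\<phi>' 0\<bar> * A + C * A\<^sup>2" if "\<bar>z\<bar> \<le> A" for z
  proof -
    have "\<bar>\<phi>' 0 * z\<bar> \<le> \<bar>\<phi>' 0\<bar> * A" unfolding abs_mult using that by (auto intro: mult_left_mono)
    moreover have "C * z\<^sup>2 \<le> C * A\<^sup>2" using that C by (intro mult_left_mono) (auto simp: abs_le_square_iff[symmetric])
    moreover have "\<bar>\<phi> z - \<phi> 0 - \<phi>' 0 * z\<bar> \<le> C * z\<^sup>2" using taylor[where y=z and x=0] by simp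
    ultimately show ?thesis by linarith
  qed
  have "prim T (\<lambda>t. LINT y|mu. \<phi> (transport c F w t y))
     (\<lambda>t. LINT y|mu. \<phi>' (transport c F w t y) * F t (frac (y + c * t)))"
  proof (rule prim_integral[where K="(\<bar>\<phi>' 0\<bar> + C * A) * K" and B="\<bar>\<phi> 0\<bar> + \<bar>\<phi>' 0\<bar> * A + C * A\<^sup>2"])
    show "\<bar>\<phi>' (transport c F w t y) * F t (frac (y + c * t))\<bar> \<le> (\<bar>\<phi>' 0\<bar> + C * A) * K" if "t \<le> T" for t y
      unfolding abs_mult using b'[OF transport_bound[OF that T, folded A_def], of y] F_bound C A
      by (intro mult_mono) auto
    show "\<bar>\<phi> (transport c F w 0 y)\<bar> \<le> \<bar>\<phi> 0\<bar> + \<bar>\<phi>' 0\<bar> * A + C * A\<^sup>2" for y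
      using b[OF transport_bound[OF T T, folded A_def], of y] b[OF transport_bound[of 0, OF T T, folded A_def], of y] by blast
    show "prim T (\<lambda>t. \<phi> (transport c F w t y)) (\<lambda>t. \<phi>' (transport c F w t y) * F t (frac (y + c * t)))" for y
      by (rule prim_chain[OF prim_transport _ _ taylor lip]) measurable
  qed measurable
  moreover have "(LINT y|mu. \<phi> (transport c F w t y)) = (LINT x|mu. \<phi> (mild c F w t x))" for t
    using integral_transport_mild[of "\<lambda>u x. \<phi> u"] by simp
  moreover have "(LINT y|mu. \<phi>' (transport c F w t y) * F t (frac (y + c * t))) = (LINT x|mu. \<phi>' (mild c F w t x) * F t x)" for t
    using integral_transport_mild[of "\<lambda>u x. \<phi>' u * F t x"] by simp
  ultimately show ?thesis by simp
qed

end

section \<open>The periodic sawtooth kernel\<close>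

lemma integral_sawtooth: "(LINT b|mu. frac (b + z) - 1/2) = 0"
proof -
  have "(LINT b|mu. frac (b + z) - 1/2) = (LINT x|mu. x - 1/2)"
    using integral_frac_shift[of "\<lambda>x. x - 1/2" z] by simp
  also have "\<dots> = (LINT x|lborel. indicator {0..1} x *\<^sub>R (x - 1/2))"
    by (subst integral_iv) auto
  also have "\<dots> = (1\<^sup>2 / 2 - 1/2) - (0\<^sup>2 / 2 - 0 :: real)"
    by (rule integral_FTC_atLeastAtMost[where F="\<lambda>x. x\<^sup>2/2 - x/2"  , THEN trans])
       (auto intro!: derivative_eq_intros continuous_intros simp: has_real_derivative_iff_has_vector_derivative[symmetric])
  finally show ?thesis by simp
qed

text \<open>Going back by \<delta> lowers the sawtooth by \<delta>, except where it wraps around and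
  gains 1. Divided by \<delta>, this is the discrete form of a unit mass at the jump minus the
  constant 1.\<close>

lemma frac_step:
  fixes w \<delta> :: real
  assumes "0 \<le> \<delta>" "\<delta> \<le> 1"
  shows "frac (w - \<delta>) - frac w = indicator {..<\<delta>} (frac w) - \<delta>"
proof (cases "frac w < \<delta>")
  case True
  have "frac (w - \<delta>) = frac w - \<delta> + 1"
    unfolding frac_unique_iff
  proof (intro conjI)
    show "0 \<le> frac w - \<delta> + 1" "frac w - \<delta> + 1 < 1" using True assms frac_ge_0[of w] by linarith+
  qed (simp add: frac_def)
  then show ?thesis using True by simp
next
  case False
  have "frac (w - \<delta>) = frac w - \<delta>"
    unfolding frac_unique_iff using False assms frac_lt_1[of w] by (auto simp: frac_def)
  then show ?thesis using False by simp
qed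

lemma integral_indicator_mu:
  fixes f :: "real \<Rightarrow> real"
  assumes "0 \<le> \<delta>" "\<delta> \<le> 1" and [measurable]: "f \<in> borel_measurable borel"
  shows "(LINT x|mu. indicator {..<\<delta>} x * f x) = (LINT x|iv 0 \<delta>. f x)"
proof -
  have "(LINT x|mu. indicator {..<\<delta>} x * f x) = (LINT x|lborel. indicator {0..1} x * (indicator {..<\<delta>} x * f x))"
    by (rule integral_iv) measurable
  also have "\<dots> = (LINT x|lborel. indicator {0..\<delta>} x * f x)"
  proof (rule integral_cong_AE)
    show "AE x in lborel. indicator {0..1} x * (indicator {..<\<delta>} x * f x) = indicator {0..\<delta>} x * f x"
      using AE_lborel_singleton[of \<delta>] by eventually_elim (use assms in \<open>auto simp: indicator_def\<close>)
  qed measurable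
  finally show ?thesis by (simp add: integral_iv)
qed

lemma integral_sawtooth_diff:
  fixes f :: "real \<Rightarrow> real"
  assumes \<delta>: "0 \<le> \<delta>" "\<delta> \<le> 1" and [measurable]: "f \<in> borel_measurable borel" and B: "\<And>b. \<bar>f b\<bar> \<le> B"
  shows "(LINT b|mu. f b * (frac (b + z - \<delta>) - frac (b + z))) = (LINT y|iv 0 \<delta>. f (frac (y - z))) - \<delta> * (LINT b|mu. f b)"
proof -
  have m: "case_prod (\<lambda>b x. f b * indicator {..<\<delta>} x) \<in> borel_measurable (borel \<Otimes>\<^sub>M borel)" by measurable
  have "(LINT b|mu. f b * (frac (b + z - \<delta>) - frac (b + z))) = (LINT b|mu. f b * indicator {..<\<delta>} (frac (b + z)) - \<delta> * f b)"
    by (simp add: frac_step[OF \<delta>] algebra_simps)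
  also have "\<dots> = (LINT b|mu. f b * indicator {..<\<delta>} (frac (b + z))) - (LINT b|mu. \<delta> * f b)"
  proof (rule Bochner_Integration.integral_diff)
    show "integrable mu (\<lambda>b. f b * indicator {..<\<delta>} (frac (b + z)))"
      by (rule integrable_iv[where K=B]) (use B order_trans[OF abs_ge_zero B] in \<open>auto split: split_indicator\<close>)
    show "integrable mu (\<lambda>b. \<delta> * f b)"
      by (rule integrable_mult_right, rule integrable_iv[where K=B]) (use B in auto)
  qed
  also have "(LINT b|mu. f b * indicator {..<\<delta>} (frac (b + z))) = (LINT x|mu. indicator {..<\<delta>} x * f (frac (x - z)))"
    using integral_frac_shift_pair[OF m, of z] by (simp add: mult.commute)
  also have "\<dots> = (LINT y|iv 0 \<delta>. f (frac (y - z)))"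
    by (rule integral_indicator_mu[OF \<delta>]) measurable
  finally show ?thesis by simp
qed

text \<open>Near its jump the kernel does not change by a small amount pointwise. In L1 the change
  is of order \<delta>, which is enough against a bounded factor.\<close>

lemma integral_abs_sawtooth_diff:
  fixes \<delta> z :: real
  assumes \<delta>: "0 \<le> \<delta>" "\<delta> \<le> 1"
  shows "(LINT b|mu. \<bar>frac (b + z - \<delta>) - frac (b + z)\<bar>) \<le> 2 * \<delta>"
proof -
  have "(LINT b|mu. \<bar>frac (b + z - \<delta>) - frac (b + z)\<bar>) \<le> (LINT b|mu. indicator {..<\<delta>} (frac (b + z)) + \<delta>)"
    using \<delta> by (intro integral_mono integrable_iv[where K=2]) (auto simp: frac_step[OF \<delta>] indicator_def)
  also have "\<dots> = (LINT b|mu. indicator {..<\<delta>} b + \<delta>)"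
    by (rule integral_frac_shift[where f="\<lambda>b. indicator {..<\<delta>} b + \<delta>"]) measurable
  also have "\<dots> = (LINT b|mu. indicator {..<\<delta>} b * 1) + \<delta>"
    by (subst Bochner_Integration.integral_add) (use \<delta> in \<open>auto intro!: integrable_iv[where K=1] simp: measure_iv\<close>)
  also have "\<dots> = 2 * \<delta>"
    using \<delta> by (subst integral_indicator_mu[OF \<delta>]) (auto simp: measure_iv)
  finally show ?thesis .
qed

text \<open>The kernel moves with speed \<open>e\<close>, and its time derivative is
  \<open>e\<close> times a unit mass at \<open>b = a + e * t\<close> minus \<open>e\<close>. As
  \<open>V t\<close> need not be continuous, the mass term is derived over a time interval: the jump
  sweeps an arc, and the integral of \<open>V\<close> over this arc turns into a time integral of
  the values met by the jump.\<close>

lemma prim_moving_sawtooth: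
  fixes V G :: "real \<Rightarrow> real \<Rightarrow> real"
  assumes V[measurable]: "case_prod V \<in> borel_measurable (borel \<Otimes>\<^sub>M borel)"
    and G[measurable]: "case_prod G \<in> borel_measurable (borel \<Otimes>\<^sub>M borel)"
    and K: "\<And>t y. \<bar>G t y\<bar> \<le> K"
    and B: "\<And>t y. t \<le> T \<Longrightarrow> \<bar>V t y\<bar> \<le> B"
    and pr: "\<And>y. prim T (\<lambda>t. V t y) (\<lambda>t. G t y)" and "0 < e" "0 \<le> T"
  shows "prim T (\<lambda>t. LINT b|mu. V t b * (frac (b - a - e * t) - 1/2))
     (\<lambda>t. (LINT b|mu. G t b * (frac (b - a - e * t) - 1/2)) + e * (V t (frac (a + e * t)) - (LINT b|mu. V t b)))"
proof -
  let ?I = "\<lambda>f t. LINT b|mu. f b * (frac (b - a - e * t) - 1/2)"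
  have K0: "0 \<le> K" using order_trans[OF abs_ge_zero K] .
  have B0: "0 \<le> B" using order_trans[OF abs_ge_zero B[OF order_refl]] .
  have V1[measurable]: "V t \<in> borel_measurable borel" and G1[measurable]: "G t \<in> borel_measurable borel" for t
    by (rule measurable_section2, fact)+
  note [measurable (raw)] = measurable_comp2[OF V] measurable_comp2[OF G]
  have S: "\<bar>frac x - 1/2\<bar> \<le> 1" for x :: real using frac_lt_1[of x] frac_ge_0[of x] by linarith
  have m1: "(\<lambda>t. ?I (V t) t) \<in> borel_measurable borel"
    "(\<lambda>t. ?I (G t) t) \<in> borel_measurable borel"
    "(\<lambda>t. LINT b|mu. V t b) \<in> borel_measurable borel"
    by (rule measurable_integral_iv, measurable)+
  have VS: "\<bar>V t b * (frac x - 1/2)\<bar> \<le> B * 1" if "t \<le> T" for t b x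
    unfolding abs_mult using B[OF that] S B0 by (intro mult_mono) auto
  have GS: "\<bar>G t b * (frac x - 1/2)\<bar> \<le> K * 1" for t b x
    unfolding abs_mult using K S K0 by (intro mult_mono) auto
  have IV: "\<bar>LINT b|mu. V t b\<bar> \<le> B" if "t \<le> T" for t
    using integral_iv_bound[of 0 1 "V t" B] B[OF that] B0 by simp
  have IG: "\<bar>?I (G t) t\<bar> \<le> K" for t
    using integral_iv_bound[of 0 1 "\<lambda>b. G t b * (frac (b - a - e * t) - 1/2)" K] GS K0 by simp
  have lip: "\<bar>V r y - V s y\<bar> \<le> K * (r - s)" if "0 \<le> s" "s \<le> r" "r \<le> T" for r s y
    using prim_lipschitz[OF pr K0 K that] by simp
  show ?thesis
  \<comment> \<open>The limit \<open>1/e\<close> keeps the shift \<open>e * (t - s)\<close> within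
    one period, as \<open>frac_step\<close> requires. Half of \<open>4 * e * K\<close> pays for the
    displacement of the kernel against \<open>G\<close>, a quarter each for freezing
    \<open>V\<close> at time \<open>s\<close> in the trace and in the mean.\<close>
  proof (rule primI_quadratic[where d="1/e" and K="K + e * (2 * B)" and C="4 * e * K"])
    show "(\<lambda>t. ?I (G t) t + e * (V t (frac (a + e * t)) - (LINT b|mu. V t b))) \<in> borel_measurable borel"
      using m1 by measurable
    show "0 < 1/e" using \<open>0 < e\<close> by simp
    show "\<bar>?I (G t) t + e * (V t (frac (a + e * t)) - (LINT b|mu. V t b))\<bar> \<le> K + e * (2 * B)"
      if "t \<le> T" for t
    proof -
      have "\<bar>V t (frac (a + e * t)) - (LINT b|mu. V t b)\<bar> \<le> 2 * B" using IV[OF that] B[OF that, of "frac (a + e * t)"] by linarith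
      then have "\<bar>e * (V t (frac (a + e * t)) - (LINT b|mu. V t b))\<bar> \<le> e * (2 * B)"
        using \<open>0 < e\<close> unfolding abs_mult by (intro mult_mono) auto
      then show ?thesis using IG[of t] by linarith
    qed
    fix s t assume st: "0 \<le> s" "s \<le> t" "t \<le> T" and d: "t - s \<le> 1/e"
    have step: "0 \<le> e * (t - r)" "e * (t - r) \<le> 1" if "s \<le> r" "r \<le> t" for r
    proof -
      show "0 \<le> e * (t - r)" using that \<open>0 < e\<close> by simp
      have "e * (t - r) \<le> e * (1 / e)" using that d \<open>0 < e\<close> by (intro mult_left_mono) auto
      then show "e * (t - r) \<le> 1" using \<open>0 < e\<close> by simp
    qed
    have I1: "integrable mu (\<lambda>b. V s b * (frac (b - a - e * t) - 1/2))" "integrable mu (\<lambda>b. V s b * (frac (b - a - e * s) - 1/2))"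
      "integrable mu (\<lambda>b. V t b * (frac (b - a - e * t) - 1/2))"
      using st by (auto intro!: integrable_iv[where K="B*1"] VS)
    \<comment> \<open>First \<open>V\<close> changes while the kernel stays at its final position,
      then the kernel moves while \<open>V\<close> stays at its initial value.\<close>
    have "?I (V t) t - ?I (V s) s
      = (LINT b|mu. (V t b - V s b) * (frac (b - a - e * t) - 1/2)) 
        + (LINT b|mu. V s b * (frac (b + (- a - e * s) - e * (t - s)) - frac (b + (- a - e * s))))"
    proof -
      have "(LINT b|mu. (V t b - V s b) * (frac (b - a - e * t) - 1/2)) 
        = ?I (V t) t - ?I (V s) t"
        using I1 by (subst Bochner_Integration.integral_diff[symmetric]) (auto simp: algebra_simps)
      moreover have "(LINT b|mu. V s b * (frac (b + (- a - e * s) - e * (t - s)) - frac (b + (- a - e * s))))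
        = ?I (V s) t - ?I (V s) s"
        using I1 by (subst Bochner_Integration.integral_diff[symmetric]) (auto simp: algebra_simps)
      ultimately show ?thesis by simp
    qed
    also have "(LINT b|mu. (V t b - V s b) * (frac (b - a - e * t) - 1/2)) = (LINT r|iv s t. ?I (G r) t)"
    proof -
      have "(LINT b|mu. (V t b - V s b) * (frac (b - a - e * t) - 1/2)) = (LINT b|mu. LINT r|iv s t. G r b * (frac (b - a - e * t) - 1/2))"
        by (simp add: prim_diff[OF pr st])
      also have "\<dots> = (LINT r|iv s t. ?I (G r) t)"
        by (rule fubini_iv[where K="K * 1"]) (use GS in auto)
      finally show ?thesis .
    qed
    also have "(LINT b|mu. V s b * (frac (b + (- a - e * s) - e * (t - s)) - frac (b + (- a - e * s)))) 
      = (LINT y|iv 0 (e * (t - s)). V s (frac (y + a + e * s))) - e * (t - s) * (LINT b|mu. V s b)"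
      using integral_sawtooth_diff[OF step[of s] V1 B, of s "- a - e * s"] st by (simp add: algebra_simps)
    \<comment> \<open>The substitution \<open>y = e * (r - s)\<close> reparametrizes the swept arc
      by the time \<open>r\<close> at which the jump passes.\<close>
    also have "(LINT y|iv 0 (e * (t - s)). V s (frac (y + a + e * s))) = e * (LINT r|iv s t. V s (frac (a + e * r)))"
      using integral_iv_affine[of "\<lambda>y. V s (frac (y + a + e * s))" e "- e * s" s t] \<open>0 < e\<close>
      by (simp add: algebra_simps)
    finally have eq1: "?I (V t) t - ?I (V s) s
      = (LINT r|iv s t. ?I (G r) t) + 
        (e * (LINT r|iv s t. V s (frac (a + e * r))) - e * (t - s) * (LINT b|mu. V s b))" .
    have mG: "(\<lambda>r. ?I (G r) t) \<in> borel_measurable borel"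
      by (rule measurable_integral_iv) measurable
    have I2: "integrable (iv s t) (\<lambda>r. ?I (G r) t)"
      "integrable (iv s t) (\<lambda>r. ?I (G r) r)"
      "integrable (iv s t) (\<lambda>r. V s (frac (a + e * r)))" "integrable (iv s t) (\<lambda>r. V r (frac (a + e * r)))"
      "integrable (iv s t) (\<lambda>r. LINT b|mu. V r b)" "integrable (iv s t) (\<lambda>r. LINT b|mu. V s b)"
    proof -
      have "\<bar>?I (G r) t\<bar> \<le> K" for r
        using integral_iv_bound[of 0 1 "\<lambda>b. G r b * (frac (b - a - e * t) - 1/2)" K] GS K0 by simp
      with mG show "integrable (iv s t) (\<lambda>r. ?I (G r) t)"
        by (intro integrable_iv[where K=K])
      show "integrable (iv s t) (\<lambda>r. ?I (G r) r)"
        by (intro integrable_iv[where K=K] m1 IG)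
      show "integrable (iv s t) (\<lambda>r. V s (frac (a + e * r)))" "integrable (iv s t) (\<lambda>r. V r (frac (a + e * r)))"
        using st by (auto intro!: integrable_iv[where K=B] B)
      show "integrable (iv s t) (\<lambda>r. LINT b|mu. V r b)"
        by (intro integrable_iv[where K=B] m1 IV) (use st in auto)
      show "integrable (iv s t) (\<lambda>r. LINT b|mu. V s b)"
        by (rule integrable_iv[where K="\<bar>LINT b|mu. V s b\<bar>"]) auto
    qed
    have c1: "e * (t - s) * (LINT b|mu. V s b) = e * (LINT r|iv s t. (LINT b|mu. V s b))"
      using st by (simp add: measure_iv)
    have "?I (V t) t - ?I (V s) s
      - (LINT r|iv s t. ?I (G r) r + e * (V r (frac (a + e * r)) - (LINT b|mu. V r b)))
      = ((LINT r|iv s t. ?I (G r) t) - (LINT r|iv s t. ?I (G r) r))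
       + e * (((LINT r|iv s t. V s (frac (a + e * r))) - (LINT r|iv s t. V r (frac (a + e * r))))
          - ((LINT r|iv s t. (LINT b|mu. V s b)) - (LINT r|iv s t. (LINT b|mu. V r b))))"
      unfolding eq1 c1 using I2 by (simp add: algebra_simps)
    also have "\<dots> = (LINT r|iv s t. ?I (G r) t - ?I (G r) r)
       + e * ((LINT r|iv s t. V s (frac (a + e * r)) - V r (frac (a + e * r)))
          - (LINT r|iv s t. (LINT b|mu. V s b) - (LINT b|mu. V r b)))"
      by (simp only: Bochner_Integration.integral_diff[OF I2(1,2)] Bochner_Integration.integral_diff[OF I2(3,4)] Bochner_Integration.integral_diff[OF I2(6,5)])
    finally have eq2: "?I (V t) t - ?I (V s) s
      - (LINT r|iv s t. ?I (G r) r + e * (V r (frac (a + e * r)) - (LINT b|mu. V r b)))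
      = \<dots>" .
    have b1: "\<bar>LINT r|iv s t. ?I (G r) t - ?I (G r) r\<bar>
       \<le> (K * (2 * (e * (t - s)))) * (t - s)"
    proof (rule integral_iv_bound)
      fix r assume r: "s \<le> r" "r \<le> t"
      have I3: "integrable mu (\<lambda>b. G r b * (frac (b - a - e * t) - 1/2))" "integrable mu (\<lambda>b. G r b * (frac (b - a - e * r) - 1/2))"
        using GS by (auto intro!: integrable_iv[where K="K*1"])
      have "\<bar>?I (G r) t - ?I (G r) r\<bar>
        = \<bar>LINT b|mu. G r b * (frac (b + (- a - e * r) - e * (t - r)) - frac (b + (- a - e * r)))\<bar>"
        using I3 by (subst Bochner_Integration.integral_diff[symmetric]) (auto simp: algebra_simps)
      also have "\<dots> \<le> (LINT b|mu. \<bar>G r b * (frac (b + (- a - e * r) - e * (t - r)) - frac (b + (- a - e * r)))\<bar>)"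
        by (rule integral_abs_bound)
      also have "\<dots> \<le> (LINT b|mu. K * \<bar>frac (b + (- a - e * r) - e * (t - r)) - frac (b + (- a - e * r))\<bar>)"
      proof (rule integral_mono)
        have f1: "\<bar>frac x - frac y\<bar> \<le> 1" for x y :: real
          using frac_lt_1[of x] frac_ge_0[of x] frac_lt_1[of y] frac_ge_0[of y] by linarith
        show "integrable mu (\<lambda>b. K * \<bar>frac (b + (- a - e * r) - e * (t - r)) - frac (b + (- a - e * r))\<bar>)"
          by (rule integrable_iv[where K="K * 1"]) (use f1 K0 in \<open>auto simp: abs_mult intro!: mult_left_le\<close>)
        show "integrable mu (\<lambda>b. \<bar>G r b * (frac (b + (- a - e * r) - e * (t - r)) - frac (b + (- a - e * r)))\<bar>)"
          by (rule integrable_iv[where K="K * 1"]) (use f1 K K0 in \<open>auto simp: abs_mult simp del: mult_1_right intro!: mult_mono\<close>)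
        show "\<bar>G r b * (frac (b + (- a - e * r) - e * (t - r)) - frac (b + (- a - e * r)))\<bar>
          \<le> K * \<bar>frac (b + (- a - e * r) - e * (t - r)) - frac (b + (- a - e * r))\<bar>" for b
          unfolding abs_mult using K by (intro mult_right_mono) auto
      qed
      also have "\<dots> = K * (LINT b|mu. \<bar>frac (b + (- a - e * r) - e * (t - r)) - frac (b + (- a - e * r))\<bar>)"
        by simp
      also have "\<dots> \<le> K * (2 * (e * (t - r)))"
        by (intro mult_left_mono integral_abs_sawtooth_diff K0 step r)
      also have "\<dots> \<le> K * (2 * (e * (t - s)))" using r K0 \<open>0 < e\<close> by (intro mult_left_mono) auto
      finally show "\<bar>?I (G r) t - ?I (G r) r\<bar> \<le> K * (2 * (e * (t - s)))" .
    qed (use st K0 \<open>0 < e\<close> in auto)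
    have Kr: "K * (r - s) \<le> K * (t - s)" if "r \<le> t" for r using that K0 by (auto intro: mult_left_mono)
    have b2: "\<bar>LINT r|iv s t. V s (frac (a + e * r)) - V r (frac (a + e * r))\<bar> \<le> (K * (t - s)) * (t - s)"
    proof (rule integral_iv_bound)
      fix r assume r: "s \<le> r" "r \<le> t"
      then show "\<bar>V s (frac (a + e * r)) - V r (frac (a + e * r))\<bar> \<le> K * (t - s)"
        using lip[of s r "frac (a + e * r)"] st Kr[of r] by (auto simp: abs_minus_commute)
    qed (use st K0 in auto)
    have b3: "\<bar>LINT r|iv s t. (LINT b|mu. V s b) - (LINT b|mu. V r b)\<bar> \<le> (K * (t - s)) * (t - s)"
    proof (rule integral_iv_bound)
      fix r assume r: "s \<le> r" "r \<le> t"
      have "(LINT b|mu. V s b) - (LINT b|mu. V r b) = (LINT b|mu. V s b - V r b)"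
        using r st by (intro Bochner_Integration.integral_diff[symmetric] integrable_iv[where K=B] B) auto
      moreover have "\<bar>LINT b|mu. V s b - V r b\<bar> \<le> (K * (t - s)) * (1 - 0)"
      proof (rule integral_iv_bound)
        show "\<bar>V s b - V r b\<bar> \<le> K * (t - s)" for b
          using lip[of s r b] st Kr[of r] r by (auto simp: abs_minus_commute)
      qed (use st K0 in auto)
      ultimately show "\<bar>(LINT b|mu. V s b) - (LINT b|mu. V r b)\<bar> \<le> K * (t - s)" by simp
    qed (use st K0 in auto)
    have "\<bar>e * ((LINT r|iv s t. V s (frac (a + e * r)) - V r (frac (a + e * r)))
          - (LINT r|iv s t. (LINT b|mu. V s b) - (LINT b|mu. V r b)))\<bar> \<le> e * (2 * ((K * (t - s)) * (t - s)))"
      using \<open>0 < e\<close> b2 b3 unfolding abs_mult by (intro mult_mono) (auto simp del: mult.assoc)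
    with b1 show "\<bar>?I (V t) t - ?I (V s) s
      - (LINT r|iv s t. ?I (G r) r + e * (V r (frac (a + e * r)) - (LINT b|mu. V r b)))\<bar>
      \<le> 4 * e * K * (t - s)\<^sup>2"
      unfolding eq2 by (simp add: power2_eq_square algebra_simps)
  qed (use m1 in simp)
qed

section \<open>The dissipation inequality\<close>

definition bdd_borel :: "(real \<Rightarrow> real) \<Rightarrow> bool" where
  "bdd_borel f \<longleftrightarrow> f \<in> borel_measurable borel \<and> (\<exists>K. \<forall>x. \<bar>f x\<bar> \<le> K)"

lemma bdd_borelI: "f \<in> borel_measurable borel \<Longrightarrow> (\<And>x. \<bar>f x\<bar> \<le> K) \<Longrightarrow> bdd_borel f"
  by (auto simp: bdd_borel_def)

lemma bdd_borel_measurable: "bdd_borel f \<Longrightarrow> f \<in> borel_measurable borel"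
  by (simp add: bdd_borel_def)

lemma bdd_borel_const: "bdd_borel (\<lambda>x. k)"
  by (auto simp: bdd_borel_def)

lemma bdd_borel_add:
  assumes "bdd_borel f" "bdd_borel g"
  shows "bdd_borel (\<lambda>x. f x + g x)"
proof -
  obtain K L where "\<And>x. \<bar>f x\<bar> \<le> K" "\<And>x. \<bar>g x\<bar> \<le> L" using assms by (auto simp: bdd_borel_def)
  then have "\<bar>f x + g x\<bar> \<le> K + L" for x by (meson abs_triangle_ineq add_mono order_trans)
  then show ?thesis using assms by (intro bdd_borelI) (auto simp: bdd_borel_def)
qed

lemma bdd_borel_mult:
  assumes "bdd_borel f" "bdd_borel g"
  shows "bdd_borel (\<lambda>x. f x * g x)"
proof -
  obtain K L where K: "\<And>x. \<bar>f x\<bar> \<le> K" and L: "\<And>x. \<bar>g x\<bar> \<le> L" using assms by (auto simp: bdd_borel_def)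
  have "\<bar>f x * g x\<bar> \<le> K * L" for x
    unfolding abs_mult using K[of x] L[of x] by (intro mult_mono) auto
  then show ?thesis using assms by (intro bdd_borelI) (auto simp: bdd_borel_def)
qed

lemma bdd_borel_abs: "bdd_borel f \<Longrightarrow> bdd_borel (\<lambda>x. \<bar>f x\<bar>)"
  by (auto simp: bdd_borel_def)

lemma bdd_borel_diff: "bdd_borel f \<Longrightarrow> bdd_borel g \<Longrightarrow> bdd_borel (\<lambda>x. f x - g x)"
  using bdd_borel_add[of f "\<lambda>x. (-1) * g x"] bdd_borel_mult[OF bdd_borel_const, of g "-1"] by simp

lemma bdd_borel_power2: "bdd_borel f \<Longrightarrow> bdd_borel (\<lambda>x. (f x)\<^sup>2)"
  unfolding power2_eq_square by (rule bdd_borel_mult)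

lemma bdd_borel_integrable: "bdd_borel f \<Longrightarrow> integrable (iv a b) f"
  by (auto simp: bdd_borel_def intro: integrable_iv)

lemmas bdd_borel_intros = bdd_borel_const bdd_borel_add bdd_borel_mult bdd_borel_abs bdd_borel_diff bdd_borel_power2

text \<open>The variance is nonnegative, \<open>mu\<close> having total mass 1.\<close>

lemma power2_integral_mu_le:
  assumes "bdd_borel f"
  shows "(LINT x|mu. f x)\<^sup>2 \<le> (LINT x|mu. (f x)\<^sup>2)"
proof -
  define I where "I = (LINT x|mu. f x)"
  note bi = bdd_borel_integrable bdd_borel_intros assms
  have "0 \<le> (LINT x|mu. (f x - I)\<^sup>2)" by simp
  also have "\<dots> = (LINT x|mu. (f x)\<^sup>2 - 2 * I * f x + I\<^sup>2)"
    by (simp add: power2_eq_square algebra_simps)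
  also have "\<dots> = (LINT x|mu. (f x)\<^sup>2) - 2 * I * I + I\<^sup>2"
    by (simp add: Bochner_Integration.integral_add Bochner_Integration.integral_diff bi measure_iv I_def)
  finally show ?thesis by (simp add: I_def power2_eq_square)
qed

lemma prim_nonpos:
  assumes "prim T p g" "AE t in iv 0 T. g t \<le> 0" "0 \<le> t" "t \<le> T"
  shows "p t \<le> p 0"
proof -
  have "AE s in iv 0 t. g s \<le> 0" using AE_iv_mono[OF assms(2), of 0 t] assms(4) by simp
  then have "0 \<le> (LINT s|iv 0 t. - g s)" by (intro integral_nonneg_AE) auto
  then show ?thesis using prim_eq[OF assms(1,3,4)] by simp
qed

lemma prim_exp: "prim T (\<lambda>t. exp (b * t)) (\<lambda>t. b * exp (b * t))"
proof (rule primI[where K="\<bar>b\<bar> * exp (\<bar>b\<bar> * \<bar>T\<bar>)"])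
  fix t assume t: "0 \<le> t" "t \<le> T"
  have "\<bar>b\<bar> * \<bar>t\<bar> \<le> \<bar>b\<bar> * \<bar>T\<bar>" using t by (intro mult_left_mono) auto
  then have "b * t \<le> \<bar>b\<bar> * \<bar>T\<bar>" using abs_ge_self[of "b * t"] unfolding abs_mult by linarith
  then have "\<bar>b\<bar> * exp (b * t) \<le> \<bar>b\<bar> * exp (\<bar>b\<bar> * \<bar>T\<bar>)" by (intro mult_left_mono) auto
  then show "\<bar>b * exp (b * t)\<bar> \<le> \<bar>b\<bar> * exp (\<bar>b\<bar> * \<bar>T\<bar>)" by (simp add: abs_mult)
  have "(LINT s|iv 0 t. b * exp (b * s)) = (LINT s|lborel. indicator {0..t} s *\<^sub>R (b * exp (b * s)))"
    by (subst integral_iv) auto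
  also have "\<dots> = exp (b * t) - exp (b * 0)"
    by (rule integral_FTC_atLeastAtMost)
       (use t in \<open>auto intro!: derivative_eq_intros continuous_intros simp: has_real_derivative_iff_has_vector_derivative[symmetric]\<close>)
  finally show "exp (b * t) = exp (b * 0) + (LINT s|iv 0 t. b * exp (b * s))" by simp
qed auto

text \<open>With the integrating factor \<open>exp (b * t)\<close> the product has a derivative that
  is nonpositive at almost every time, which is all that \<open>prim_nonpos\<close> asks
  for.\<close>

lemma prim_gronwall:
  assumes "prim T p g" "AE t in iv 0 T. g t \<le> - b * p t" "0 \<le> t" "t \<le> T"
  shows "p t \<le> exp (- b * t) * p 0"
proof -
  have "exp (b * t) * p t \<le> exp (b * 0) * p 0"
  proof (rule prim_nonpos[OF prim_mult[OF prim_exp assms(1)] _ assms(3,4)])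
    show "AE t in iv 0 T. b * exp (b * t) * p t + exp (b * t) * g t \<le> 0"
      using assms(2)
    proof eventually_elim
      case (elim t)
      have "b * exp (b * t) * p t + exp (b * t) * g t = exp (b * t) * (b * p t + g t)" by (simp add: algebra_simps)
      also have "\<dots> \<le> 0" using elim by (intro mult_nonneg_nonpos) auto
      finally show ?case .
    qed
  qed
  then have "exp (- b * t) * (exp (b * t) * p t) \<le> exp (- b * t) * p 0" by (intro mult_left_mono) auto
  moreover have "exp (- b * t) * (exp (b * t) * p t) = p t" by (simp flip: mult.assoc exp_add)
  ultimately show ?thesis by linarith
qed

text \<open>The cap 1/3 keeps the corrected energy between 2/3 and 4/3 of the energy. The other
  entry is the reciprocal of the coefficient with which the correction charges the dissipation
  \<open>D\<close>, so that at most one of the two copies of \<open>D\<close> in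
  \<open>H' = - 2 D\<close> is spent on it.\<close>

definition hypo_weight :: "real \<Rightarrow> real \<Rightarrow> real \<Rightarrow> real \<Rightarrow> real" where
  "hypo_weight c m ks \<kappa> = min (1/3) (1 / (c * (12/5) / (m * ks) + 5 * \<kappa> / c))"

text \<open>The minimum compares what is left of the dissipation,
  \<open>D + 2/3 * \<epsilon> * c * R\<close>, with the energy, which is at most
  \<open>5/9 * R + D / (m * ks)\<close>. The factor 3/4 passes from the energy to the corrected
  energy, which can be 4/3 as large.\<close>

definition decay_rate :: "real \<Rightarrow> real \<Rightarrow> real \<Rightarrow> real \<Rightarrow> real" where
  "decay_rate c m ks \<kappa> = 3/4 * min (m * ks) (6/5 * hypo_weight c m ks \<kappa> * c)"

lemma hypo_weight_bounds:
  assumes "0 < c" "0 < m" "0 < ks" "0 < \<kappa>"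
  shows "0 < hypo_weight c m ks \<kappa>" "hypo_weight c m ks \<kappa> \<le> 1/3"
    "hypo_weight c m ks \<kappa> * (c * (12/5) / (m * ks) + 5 * \<kappa> / c) \<le> 1"
proof -
  define d where "d = c * (12/5) / (m * ks) + 5 * \<kappa> / c"
  have d: "0 < d" unfolding d_def using assms by (intro add_pos_pos) auto
  show "0 < hypo_weight c m ks \<kappa>" "hypo_weight c m ks \<kappa> \<le> 1/3"
    unfolding hypo_weight_def d_def[symmetric] using d by auto
  have "hypo_weight c m ks \<kappa> * d \<le> 1 / d * d"
    unfolding hypo_weight_def d_def[symmetric] using d by (intro mult_right_mono) auto
  then show "hypo_weight c m ks \<kappa> * (c * (12/5) / (m * ks) + 5 * \<kappa> / c) \<le> 1" using d by (simp add: d_def)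
qed

lemma decay_rate_pos:
  assumes "0 < c" "0 < m" "0 < ks" "0 < \<kappa>"
  shows "0 < decay_rate c m ks \<kappa>"
  unfolding decay_rate_def using hypo_weight_bounds(1)[OF assms] assms by auto

text \<open>The factor 1/9 has to be small enough to be absorbed: per unit of
  \<open>\<epsilon> * c\<close>, the later balance gains 4/5 of the squared norm of \<rho> - 2m and
  pays 6/5 of that of j, so any factor below 2/3 could be accommodated.\<close>

lemma flux_split_bound:
  fixes u v q :: real
  assumes "0 \<le> u" "0 \<le> v" "0 \<le> q" "ks * (u + v) \<le> q" "0 < m" "0 < ks"
  shows "(u - v)\<^sup>2 \<le> (u + v - 2 * m)\<^sup>2 / 9 + 2 / (m * ks) * (q * (v - u) * (v - u))"
proof (cases "u + v < m / 2")
  case True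
  have "\<bar>u - v\<bar> \<le> u + v" using assms(1,2) by linarith
  \<comment> \<open>The threshold \<open>m / 2\<close> is exactly where \<open>u + v\<close> equals
    a third of \<open>2 * m - (u + v)\<close>; squaring gives 1/9.\<close>
  moreover have "u + v \<le> - ((u + v - 2 * m) / 3)" using True by (simp add: field_simps)
  ultimately have "\<bar>u - v\<bar> \<le> \<bar>(u + v - 2 * m) / 3\<bar>" using abs_ge_minus_self[of "(u + v - 2 * m) / 3"] by (meson order_trans)
  then have "(u - v)\<^sup>2 \<le> ((u + v - 2 * m) / 3)\<^sup>2" by (simp only: abs_le_square_iff)
  moreover have "0 \<le> 2 / (m * ks) * (q * (v - u) * (v - u))" using assms by (simp add: mult.assoc)
  ultimately show ?thesis by (simp add: power_divide)
next
  case False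
  have "ks * (m / 2) \<le> ks * (u + v)" using False assms by (intro mult_left_mono) auto
  then have "ks * (m / 2) \<le> q" using assms by linarith
  then have "ks * (m / 2) * (v - u)\<^sup>2 \<le> q * (v - u)\<^sup>2" by (intro mult_right_mono) auto
  then have "2 / (m * ks) * (ks * (m / 2) * (v - u)\<^sup>2) \<le> 2 / (m * ks) * (q * (v - u)\<^sup>2)"
    using assms by (intro mult_left_mono) auto
  moreover have "2 / (m * ks) * (ks * (m / 2) * (v - u)\<^sup>2) = (u - v)\<^sup>2"
    using assms by (simp add: field_simps power2_commute)
  ultimately have "(u - v)\<^sup>2 \<le> 2 / (m * ks) * (q * (v - u)\<^sup>2)" by simp
  then show ?thesis by (simp add: power2_eq_square add_increasing mult.assoc)
qed

text \<open>The left side bounds the time derivative of the corrected energy from above: its first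
  term is \<open>H'\<close>, the others are \<open>- 2 * \<epsilon>\<close> times the lower bound in
  \<open>cross_deriv_ge\<close>. The time is fixed, so only integrals over the circle occur, and all
  of them reduce to \<open>D\<close>, \<open>R\<close> and \<open>J\<close> through
  \<open>R + J = 2 * H\<close>.\<close>

lemma dissipation_inequality:
  fixes u v f :: "real \<Rightarrow> real"
  assumes b: "bdd_borel u" "bdd_borel v" "bdd_borel f"
    and mass: "(LINT x|mu. u x) + (LINT x|mu. v x) = 2 * m"
    and flux: "AE x in mu. \<exists>q. f x = q * (v x - u x) \<and> 0 \<le> q \<and> 0 \<le> u x \<and> 0 \<le> v x \<and> q \<le> \<kappa> \<and> ks * (u x + v x) \<le> q"
    and pos: "0 < c" "0 < m" "0 < ks" "0 < \<kappa>"
  defines "\<epsilon> \<equiv> hypo_weight c m ks \<kappa>"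
  shows "(LINT x|mu. 2 * (u x - v x) * f x)
      - 4 * \<epsilon> * c * ((LINT x|mu. u x * v x) - (LINT x|mu. u x) * (LINT x|mu. v x))
      + \<epsilon> * (LINT x|mu. \<bar>f x\<bar>) * ((LINT x|mu. \<bar>u x - m\<bar>) + (LINT x|mu. \<bar>v x - m\<bar>))
     \<le> - decay_rate c m ks \<kappa> * (4/3 * ((LINT x|mu. (u x - m)\<^sup>2) + (LINT x|mu. (v x - m)\<^sup>2)))"
proof -
  note bi = bdd_borel_integrable bdd_borel_intros b
  define D where "D = (LINT x|mu. f x * (v x - u x))"
  define R where "R = (LINT x|mu. (u x + v x - 2 * m)\<^sup>2)"
  define J where "J = (LINT x|mu. (u x - v x)\<^sup>2)"
  define X where "X = (LINT x|mu. u x * v x) - (LINT x|mu. u x) * (LINT x|mu. v x)"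
  define n where "n = (LINT x|mu. \<bar>f x\<bar>)"
  define a1 where "a1 = (LINT x|mu. \<bar>u x - m\<bar>)"
  define a2 where "a2 = (LINT x|mu. \<bar>v x - m\<bar>)"
  define H where "H = (LINT x|mu. (u x - m)\<^sup>2) + (LINT x|mu. (v x - m)\<^sup>2)"
  have e: "0 < \<epsilon>" "\<epsilon> \<le> 1/3" "\<epsilon> * (c * (12/5) / (m * ks) + 5 * \<kappa> / c) \<le> 1"
    using hypo_weight_bounds[OF pos] by (auto simp: \<epsilon>_def)
  have D1: "(LINT x|mu. 2 * (u x - v x) * f x) = - 2 * D"
  proof -
    have "(LINT x|mu. 2 * (u x - v x) * f x) = (LINT x|mu. - 2 * (f x * (v x - u x)))"
      by (rule Bochner_Integration.integral_cong) (auto simp: algebra_simps)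
    then show ?thesis by (simp add: D_def)
  qed
  have RJ: "R + J = 2 * H"
  proof -
    have "R + J = (LINT x|mu. (u x + v x - 2 * m)\<^sup>2 + (u x - v x)\<^sup>2)"
      unfolding R_def J_def by (rule Bochner_Integration.integral_add[symmetric]; intro bi)
    also have "\<dots> = (LINT x|mu. 2 * ((u x - m)\<^sup>2 + (v x - m)\<^sup>2))"
      by (rule Bochner_Integration.integral_cong) (auto simp: power2_eq_square algebra_simps)
    also have "\<dots> = 2 * H" unfolding H_def
      by (subst Bochner_Integration.integral_add[symmetric]; (intro bi)?) (simp only: integral_mult_right_zero)
    finally show ?thesis .
  qed
  have X4: "R - J \<le> 4 * X"
  proof -
    have "R - J = (LINT x|mu. (u x + v x - 2 * m)\<^sup>2 - (u x - v x)\<^sup>2)"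
      unfolding R_def J_def by (rule Bochner_Integration.integral_diff[symmetric]; intro bi)
    also have "\<dots> = (LINT x|mu. 4 * (u x * v x) - 4 * m * u x - 4 * m * v x + 4 * m\<^sup>2)"
      by (rule Bochner_Integration.integral_cong) (auto simp: power2_eq_square algebra_simps)
    also have "\<dots> = 4 * (LINT x|mu. u x * v x) - 4 * m * (LINT x|mu. u x) - 4 * m * (LINT x|mu. v x) + 4 * m\<^sup>2"
      by (simp add: Bochner_Integration.integral_add Bochner_Integration.integral_diff bi measure_iv)
    also have "\<dots> = 4 * (LINT x|mu. u x * v x) - 4 * m\<^sup>2"
      using mass by (simp add: algebra_simps power2_eq_square flip: distrib_left)
    finally have 1: "R - J = 4 * (LINT x|mu. u x * v x) - 4 * m\<^sup>2" .
    \<comment> \<open>The masses of \<open>u\<close> and \<open>v\<close> are not conserved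
      separately. With their sum fixed, the product is largest when both equal \<open>m\<close>, and
      this is the favourable direction.\<close>
    have "4 * ((LINT x|mu. u x) * (LINT x|mu. v x)) = ((LINT x|mu. u x) + (LINT x|mu. v x))\<^sup>2 - ((LINT x|mu. u x) - (LINT x|mu. v x))\<^sup>2"
      by (simp add: power2_eq_square algebra_simps)
    also have "\<dots> \<le> (2 * m)\<^sup>2" unfolding mass by simp
    finally show ?thesis unfolding X_def using 1 by (simp add: power2_eq_square)
  qed
  have J9: "J \<le> R / 9 + 2 / (m * ks) * D"
  proof -
    have "J \<le> (LINT x|mu. (u x + v x - 2 * m)\<^sup>2 * (1 / 9) + 2 / (m * ks) * (f x * (v x - u x)))"
      unfolding J_def
    proof (rule integral_mono_AE)
      show "AE x in mu. (u x - v x)\<^sup>2 \<le> (u x + v x - 2 * m)\<^sup>2 * (1 / 9) + 2 / (m * ks) * (f x * (v x - u x))"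
        using flux by eventually_elim (use flux_split_bound pos in \<open>auto simp del: divide_const_simps\<close>)
    qed (intro bi)+
    also have "\<dots> = R / 9 + 2 / (m * ks) * D"
      unfolding R_def D_def by (subst Bochner_Integration.integral_add; (intro bi)?) simp
    finally show ?thesis .
  qed
  have n2: "n\<^sup>2 \<le> \<kappa> * D"
  proof -
    have "n\<^sup>2 \<le> (LINT x|mu. (\<bar>f x\<bar>)\<^sup>2)" unfolding n_def by (intro power2_integral_mu_le bi)
    also have "\<dots> \<le> (LINT x|mu. \<kappa> * (f x * (v x - u x)))"
    proof (rule integral_mono_AE)
      show "AE x in mu. (\<bar>f x\<bar>)\<^sup>2 \<le> \<kappa> * (f x * (v x - u x))"
        using flux
      proof eventually_elim
        case (elim x)
        then obtain q where q: "f x = q * (v x - u x)" "0 \<le> q" "q \<le> \<kappa>" by blast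
        \<comment> \<open>One factor \<open>q\<close> of the squared exchange term is traded for its
          bound \<kappa>; the other belongs to the dissipation.\<close>
        have "q * (q * (v x - u x)\<^sup>2) \<le> \<kappa> * (q * (v x - u x)\<^sup>2)" using q by (intro mult_right_mono) auto
        then show ?case by (simp add: q(1) power2_eq_square mult_ac)
      qed
    qed (intro bi)+
    finally show ?thesis by (simp add: D_def)
  qed
  have D0: "0 \<le> D"
  proof -
    have "0 \<le> \<kappa> * D" using n2 by (meson order_trans zero_le_power2)
    then show ?thesis using pos by (simp add: zero_le_mult_iff)
  qed
  have a: "(a1 + a2)\<^sup>2 \<le> R + J"
  proof -
    have "a1\<^sup>2 \<le> (LINT x|mu. \<bar>u x - m\<bar>\<^sup>2)" "a2\<^sup>2 \<le> (LINT x|mu. \<bar>v x - m\<bar>\<^sup>2)"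
      unfolding a1_def a2_def by (rule power2_integral_mu_le; intro bi)+
    then have H: "a1\<^sup>2 + a2\<^sup>2 \<le> H" by (simp add: H_def)
    have "(a1 + a2)\<^sup>2 \<le> 2 * (a1\<^sup>2 + a2\<^sup>2)" using sum_squares_bound[of a1 a2] by (simp add: power2_sum)
    also have "\<dots> \<le> 2 * H" using H by (rule mult_left_mono) simp
    finally show ?thesis unfolding RJ .
  qed
  have na: "n * (a1 + a2) \<le> c / 5 * (R + J) + 5 * \<kappa> / c * D"
  proof -
    \<comment> \<open>The Young weight \<open>c/5\<close> gives up one fifth of the gain in
      \<open>R\<close>; the part with \<open>n\<close> is paid by \<open>D\<close>, at the price
      \<open>5 * \<kappa> / c\<close>.\<close>
    have "2 * (c/5) * (n * (a1 + a2)) \<le> n\<^sup>2 + (c/5)\<^sup>2 * (a1 + a2)\<^sup>2"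
      using sum_squares_bound[of n "c/5 * (a1 + a2)"] by (simp only: power_mult_distrib mult_ac)
    also have "\<dots> \<le> \<kappa> * D + (c/5)\<^sup>2 * (R + J)" using n2 a by (intro add_mono mult_left_mono) auto
    finally have "5 / c * (2 * (c/5) * (n * (a1 + a2))) \<le> 5 / c * (\<kappa> * D + (c/5)\<^sup>2 * (R + J))"
      using pos by (intro mult_left_mono) auto
    moreover have "5 / c * (2 * (c/5) * (n * (a1 + a2))) = 2 * (n * (a1 + a2))"
      "5 / c * (\<kappa> * D + (c/5)\<^sup>2 * (R + J)) = 5 * \<kappa> / c * D + c / 5 * (R + J)"
      using pos by (simp_all add: field_simps power2_eq_square)
    ultimately have 1: "2 * (n * (a1 + a2)) \<le> 5 * \<kappa> / c * D + c / 5 * (R + J)" by metis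
    have "0 \<le> 5 * \<kappa> / c * D" "0 \<le> c / 5 * (R + J)" using pos D0 RJ by (auto simp: H_def)
    moreover have "x \<le> q + p" if "2 * x \<le> p + q" "0 \<le> p" "0 \<le> q" for x p q :: real using that by linarith
    ultimately show ?thesis using 1 by blast
  qed
  have R0: "0 \<le> R" by (simp add: R_def)
  \<comment> \<open>Per unit of \<open>\<epsilon> * c\<close>, \<open>R\<close> has the coefficient
    \<open>- 4/5\<close> and receives \<open>6/5 * 1/9\<close> back from \<open>J\<close>, which
    leaves \<open>- 2/3\<close>. The total charge on \<open>D\<close> is at most 1 by the choice of
    \<open>hypo_weight\<close>.\<close>
  have step1: "- 2 * D - \<epsilon> * c * (R - J) + \<epsilon> * (c / 5 * (R + J) + 5 * \<kappa> / c * D) \<le> - D - 2/3 * \<epsilon> * c * R"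
  proof -
    have "- 2 * D - \<epsilon> * c * (R - J) + \<epsilon> * (c / 5 * (R + J) + 5 * \<kappa> / c * D) = - 2 * D - 4/5 * (\<epsilon> * c) * R + 6/5 * (\<epsilon> * c) * J + \<epsilon> * (5 * \<kappa> / c) * D"
      by (simp add: algebra_simps add_divide_distrib)
    also have "\<dots> \<le> - 2 * D - 4/5 * (\<epsilon> * c) * R + 6/5 * (\<epsilon> * c) * (R / 9 + 2 / (m * ks) * D) + \<epsilon> * (5 * \<kappa> / c) * D"
      using J9 e pos by (intro add_mono mult_left_mono) auto
    also have "\<dots> = - 2 * D - 2/3 * \<epsilon> * c * R + (\<epsilon> * (c * (12/5) / (m * ks) + 5 * \<kappa> / c)) * D"
      by (simp add: algebra_simps add_divide_distrib)
    also have "\<dots> \<le> - 2 * D - 2/3 * \<epsilon> * c * R + 1 * D" using e D0 by (intro add_mono mult_right_mono) auto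
    finally show ?thesis by simp
  qed
  \<comment> \<open>As \<open>5/9 * 6/5 = 2/3\<close>, the two entries of the minimum match the
    multiples of \<open>D\<close> and \<open>R\<close> that step1 leaves over.\<close>
  define \<mu> where "\<mu> = min (m * ks) (6/5 * \<epsilon> * c)"
  have \<mu>: "0 \<le> \<mu>" "\<mu> \<le> m * ks" "\<mu> \<le> 6/5 * \<epsilon> * c" using pos e by (auto simp: \<mu>_def)
  have "\<mu> * H \<le> \<mu> * (5/9 * R + 1 / (m * ks) * D)"
    using J9 RJ \<mu> by (intro mult_left_mono) auto
  also have "\<dots> = 5/9 * (\<mu> * R) + \<mu> * (1 / (m * ks) * D)" by (simp add: algebra_simps add_divide_distrib)
  also have "\<dots> \<le> 5/9 * ((6/5 * \<epsilon> * c) * R) + (m * ks) * (1 / (m * ks) * D)"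
    using \<mu> R0 D0 pos by (intro add_mono mult_left_mono mult_right_mono) auto
  also have "\<dots> = 2/3 * \<epsilon> * c * R + D" using pos by simp
  finally have muH: "\<mu> * H \<le> 2/3 * \<epsilon> * c * R + D" .
  have "- 2 * D - 4 * \<epsilon> * c * X + \<epsilon> * n * (a1 + a2) \<le> - 2 * D - \<epsilon> * c * (R - J) + \<epsilon> * (c / 5 * (R + J) + 5 * \<kappa> / c * D)"
  proof -
    have "\<epsilon> * c * (R - J) \<le> \<epsilon> * c * (4 * X)" using X4 e pos by (intro mult_left_mono) auto
    moreover have "\<epsilon> * (n * (a1 + a2)) \<le> \<epsilon> * (c / 5 * (R + J) + 5 * \<kappa> / c * D)" using na e by (intro mult_left_mono) auto
    moreover have "4 * \<epsilon> * c * X = \<epsilon> * c * (4 * X)" "\<epsilon> * n * (a1 + a2) = \<epsilon> * (n * (a1 + a2))" by simp_all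
    ultimately show ?thesis by (metis add_mono diff_mono order_refl)
  qed
  also have "\<dots> \<le> - (\<mu> * H)" using step1 muH by linarith
  also have "\<dots> = - decay_rate c m ks \<kappa> * (4/3 * H)"
    by (simp add: decay_rate_def \<mu>_def \<epsilon>_def)
  finally show ?thesis by (simp only: D1 X_def n_def a1_def a2_def H_def)
qed

section \<open>Decay of mild solutions\<close>

lemma bdd_borel_pos_part:
  assumes "bdd_borel f"
  shows "bdd_borel (\<lambda>x. max (f x) 0)"
proof -
  note [measurable] = bdd_borel_measurable[OF assms]
  obtain K where K: "\<And>x. \<bar>f x\<bar> \<le> K" using assms by (auto simp: bdd_borel_def)
  have "\<bar>max (f x) 0\<bar> \<le> K" for x using K[of x] by linarith
  then show ?thesis by (rule bdd_borelI[rotated]) measurable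
qed

lemma abs_integral_mult_le:
  assumes "bdd_borel f" "bdd_borel g" "\<And>x. \<bar>g x\<bar> \<le> C"
  shows "\<bar>LINT x|mu. f x * g x\<bar> \<le> (LINT x|mu. \<bar>f x\<bar>) * C"
proof -
  note bi = bdd_borel_integrable bdd_borel_intros assms(1,2)
  have "\<bar>LINT x|mu. f x * g x\<bar> \<le> (LINT x|mu. \<bar>f x * g x\<bar>)"
    by (rule integral_abs_bound)
  also have "\<dots> \<le> (LINT x|mu. \<bar>f x\<bar> * C)"
    by (rule integral_mono; (intro bi)?) (auto simp only: abs_mult intro!: mult_left_mono assms(3))
  finally show ?thesis by simp
qed

text \<open>The squared positive part has a kink in its derivative at \<open>M\<close>, so the
  remainder is bounded by cases. It lies between 0, by convexity, and the squared increment.\<close>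

lemma pos_part_square_taylor:
  fixes x y M :: real
  shows "\<bar>(max (y - M) 0)\<^sup>2 - (max (x - M) 0)\<^sup>2 - 2 * max (x - M) 0 * (y - x)\<bar> \<le> 2 * (y - x)\<^sup>2"
proof -
  have "(max (y - M) 0)\<^sup>2 - (max (x - M) 0)\<^sup>2 - 2 * max (x - M) 0 * (y - x) \<in> {0..(y - x)\<^sup>2}"
  proof (cases "x \<le> M")
    case True
    have "(max (y - M) 0)\<^sup>2 \<le> (y - x)\<^sup>2"
      using True by (cases "y \<le> M") (auto intro!: power_mono)
    then show ?thesis using True by simp
  next
    case x: False
    show ?thesis
    proof (cases "y \<le> M")
      case True
      have 1: "(max (y - M) 0)\<^sup>2 - (max (x - M) 0)\<^sup>2 - 2 * max (x - M) 0 * (y - x) = (x - M)\<^sup>2 + 2 * ((x - M) * (M - y))"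
        using True x by (simp add: power2_eq_square algebra_simps)
      have 2: "(y - x)\<^sup>2 = (x - M)\<^sup>2 + 2 * ((x - M) * (M - y)) + (M - y)\<^sup>2"
        by (simp add: power2_eq_square algebra_simps)
      have "0 \<le> (x - M) * (M - y)" using True x by simp
      then show ?thesis unfolding 1 2 by simp
    next
      case False
      then have "(max (y - M) 0)\<^sup>2 - (max (x - M) 0)\<^sup>2 - 2 * max (x - M) 0 * (y - x) = (y - x)\<^sup>2"
        using x by (simp add: power2_eq_square algebra_simps)
      then show ?thesis by simp
    qed
  qed
  moreover have "0 \<le> (y - x)\<^sup>2" by simp
  ultimately show ?thesis by auto
qed

text \<open>The witness \<open>q\<close> is the value of the rate at the point. Its bounds by
  \<kappa> and \<open>ks\<close> are assumed only where both densities are at most \<open>M\<close>.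
  This avoids a circle: the maximum principle is proved inside the locale from
  \<open>0 \<le> q\<close> and the cruder bound \<open>K\<close> on \<open>F\<close>, and then
  releases the conditional bounds.\<close>

locale relaxation =
  fixes c T K B m M \<kappa> ks :: real and F :: "real \<Rightarrow> real \<Rightarrow> real" and U0 V0 :: "real \<Rightarrow> real"
  assumes c: "0 < c" and T: "0 \<le> T"
    and F_meas: "case_prod F \<in> borel_measurable (borel \<Otimes>\<^sub>M borel)"
    and F_bdd: "\<And>t x. \<bar>F t x\<bar> \<le> K"
    and U0_meas: "U0 \<in> borel_measurable borel" and V0_meas: "V0 \<in> borel_measurable borel"
    and U0_bdd: "\<And>y. \<bar>U0 y\<bar> \<le> B" and V0_bdd: "\<And>y. \<bar>V0 y\<bar> \<le> B"
    and U0_le: "\<And>y. U0 y \<le> M" and V0_le: "\<And>y. V0 y \<le> M"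
    and total_mass: "(LINT y|mu. U0 y) + (LINT y|mu. V0 y) = 2 * m"
    and pos: "0 < m" "0 < ks" "0 < \<kappa>"
    and flux: "AE t in iv 0 T. AE x in mu. \<exists>q. 
        F t x = q * (mild (- c) (\<lambda>t x. - F t x) V0 t x - mild c F U0 t x) \<and> 0 \<le> q
        \<and> 0 \<le> mild c F U0 t x \<and> 0 \<le> mild (- c) (\<lambda>t x. - F t x) V0 t x
        \<and> (mild c F U0 t x \<le> M \<longrightarrow> mild (- c) (\<lambda>t x. - F t x) V0 t x \<le> M
           \<longrightarrow> q \<le> \<kappa> \<and> ks * (mild c F U0 t x + mild (- c) (\<lambda>t x. - F t x) V0 t x) \<le> q)"
begin

sublocale U: transport_data c K B F U0
  by unfold_locales (fact F_meas U0_meas F_bdd U0_bdd)+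

sublocale V: transport_data "- c" K B "\<lambda>t x. - F t x" V0
proof
  have "(\<lambda>z. - case_prod F z) \<in> borel_measurable (borel \<Otimes>\<^sub>M borel)" using F_meas by measurable
  then show "(\<lambda>(t, x). - F t x) \<in> borel_measurable (borel \<Otimes>\<^sub>M borel)" by (simp add: case_prod_unfold)
qed (use V0_meas F_bdd V0_bdd in auto)

abbreviation "U \<equiv> transport c F U0"
abbreviation "V \<equiv> transport (- c) (\<lambda>t x. - F t x) V0"
abbreviation "u \<equiv> mild c F U0"
abbreviation "v \<equiv> mild (- c) (\<lambda>t x. - F t x) V0"

lemma F_section: "F t \<in> borel_measurable borel"
  by (rule measurable_section2[OF F_meas])

lemma bdd_borel_sol:
  assumes "t \<le> T"
  shows "bdd_borel (u t)" "bdd_borel (v t)" "bdd_borel (F t)" "bdd_borel (U t)" "bdd_borel (V t)"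
proof -
  show "bdd_borel (u t)"
    by (rule bdd_borelI[OF _ U.mild_bound[OF assms T]]) (rule U.mild_comp[of "\<lambda>_. t" borel "\<lambda>x. x"]; simp)
  show "bdd_borel (v t)"
    by (rule bdd_borelI[OF _ V.mild_bound[OF assms T]]) (rule V.mild_comp[of "\<lambda>_. t" borel "\<lambda>x. x"]; simp)
  show "bdd_borel (F t)" by (rule bdd_borelI[OF F_section F_bdd])
  show "bdd_borel (U t)"
    by (rule bdd_borelI[OF measurable_section2[OF U.transport_measurable] U.transport_bound[OF assms T]])
  show "bdd_borel (V t)"
    by (rule bdd_borelI[OF measurable_section2[OF V.transport_measurable] V.transport_bound[OF assms T]])
qed

lemma integral_initial:
  fixes \<phi> :: "real \<Rightarrow> real"
  assumes [measurable]: "\<phi> \<in> borel_measurable borel"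
  shows "(LINT x|mu. \<phi> (u 0 x)) = (LINT x|mu. \<phi> (U0 x))" "(LINT x|mu. \<phi> (v 0 x)) = (LINT x|mu. \<phi> (V0 x))"
proof -
  note [measurable] = U0_meas V0_meas
  show "(LINT x|mu. \<phi> (u 0 x)) = (LINT x|mu. \<phi> (U0 x))" "(LINT x|mu. \<phi> (v 0 x)) = (LINT x|mu. \<phi> (V0 x))"
    using integral_frac_shift[of "\<lambda>x. \<phi> (U0 x)" 0] integral_frac_shift[of "\<lambda>x. \<phi> (V0 x)" 0]
    by (simp_all add: mild_def transport_def integral_iv_empty)
qed

lemma prim_energy_sum:
  fixes \<phi> \<phi>' :: "real \<Rightarrow> real"
  assumes [measurable]: "\<phi> \<in> borel_measurable borel" "\<phi>' \<in> borel_measurable borel"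
    and "\<And>x y. \<bar>\<phi> y - \<phi> x - \<phi>' x * (y - x)\<bar> \<le> C * (y - x)\<^sup>2"
    and "\<And>x y. \<bar>\<phi>' y - \<phi>' x\<bar> \<le> C * \<bar>y - x\<bar>"
  shows "prim T (\<lambda>t. (LINT x|mu. \<phi> (u t x)) + (LINT x|mu. \<phi> (v t x)))
    (\<lambda>t. (LINT x|mu. \<phi>' (u t x) * F t x) + (LINT x|mu. \<phi>' (v t x) * - F t x))"
  by (rule prim_add[OF U.prim_energy[OF T assms] V.prim_energy[OF T assms]])

text \<open>The exchange pulls \<open>u\<close> and \<open>v\<close> towards each other, which
  cannot increase any sum of the form \<integral> \<phi>(u) + \<phi>(v) with \<phi> convex. The
  chosen \<phi> vanishes exactly on values at most \<open>M\<close>, hence initially.\<close>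

lemma maximum_principle:
  assumes "0 \<le> t" "t \<le> T"
  shows "AE x in mu. u t x \<le> M" "AE x in mu. v t x \<le> M"
proof -
  define \<phi> where "\<phi> s = (max (s - M) 0)\<^sup>2" for s
  define \<phi>' where "\<phi>' s = 2 * max (s - M) 0" for s
  have [measurable]: "\<phi> \<in> borel_measurable borel" "\<phi>' \<in> borel_measurable borel"
    unfolding \<phi>_def[abs_def] \<phi>'_def[abs_def] by measurable
  have b: "bdd_borel (\<lambda>x. \<phi> (u s x))" "bdd_borel (\<lambda>x. \<phi> (v s x))" 
    "bdd_borel (\<lambda>x. \<phi>' (u s x))" "bdd_borel (\<lambda>x. \<phi>' (v s x))" if "s \<le> T" for s
    unfolding \<phi>_def \<phi>'_def by (intro bdd_borel_intros bdd_borel_pos_part bdd_borel_sol[OF that])+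
  have "(LINT x|mu. \<phi> (u t x)) + (LINT x|mu. \<phi> (v t x)) \<le> (LINT x|mu. \<phi> (u 0 x)) + (LINT x|mu. \<phi> (v 0 x))"
  proof (rule prim_nonpos[OF prim_energy_sum[where \<phi>'=\<phi>' and C=2]])
    show "\<bar>\<phi> y - \<phi> x - \<phi>' x * (y - x)\<bar> \<le> 2 * (y - x)\<^sup>2" for x y
      unfolding \<phi>_def \<phi>'_def by (rule pos_part_square_taylor)
    show "\<bar>\<phi>' y - \<phi>' x\<bar> \<le> 2 * \<bar>y - x\<bar>" for x y
      unfolding \<phi>'_def by (auto simp: max_def abs_if)
    have "AE s in iv 0 T. s \<le> T" by (rule AE_ivI)
    with flux show "AE s in iv 0 T. (LINT x|mu. \<phi>' (u s x) * F s x) + (LINT x|mu. \<phi>' (v s x) * - F s x) \<le> 0"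
    proof eventually_elim
      case (elim s)
      note bi = bdd_borel_integrable bdd_borel_intros b[OF elim(2)] bdd_borel_sol[OF elim(2)]
      have "(LINT x|mu. \<phi>' (u s x) * F s x) + (LINT x|mu. \<phi>' (v s x) * - F s x)
        = (LINT x|mu. \<phi>' (u s x) * F s x) - (LINT x|mu. \<phi>' (v s x) * F s x)" by simp
      also have "\<dots> = (LINT x|mu. \<phi>' (u s x) * F s x - \<phi>' (v s x) * F s x)"
        by (rule Bochner_Integration.integral_diff[symmetric]; intro bi)
      also have "\<dots> = - (LINT x|mu. - (\<phi>' (u s x) * F s x - \<phi>' (v s x) * F s x))"
        by (simp only: Bochner_Integration.integral_minus minus_minus)
      also have "\<dots> \<le> 0"
      proof (subst neg_le_0_iff_le, rule integral_nonneg_AE)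
        show "AE x in mu. 0 \<le> - (\<phi>' (u s x) * F s x - \<phi>' (v s x) * F s x)"
          using elim(1)
        proof eventually_elim
          case (elim x)
          then obtain q where q: "F s x = q * (v s x - u s x)" "0 \<le> q" by blast
          \<comment> \<open>Monotonicity of \<phi>' in the form that is multiplied by
            \<open>q\<close>.\<close>
          have "0 \<le> (\<phi>' (v s x) - \<phi>' (u s x)) * (v s x - u s x)"
            unfolding \<phi>'_def by (cases "u s x \<le> v s x") (auto intro!: mult_nonneg_nonneg mult_nonpos_nonpos simp: max_def)
          then have "0 \<le> q * ((\<phi>' (v s x) - \<phi>' (u s x)) * (v s x - u s x))" using q by simp
          also have "\<dots> = - (\<phi>' (u s x) * F s x - \<phi>' (v s x) * F s x)" by (simp add: q(1) algebra_simps)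
          finally show ?case .
        qed
      qed
      finally show ?case .
    qed
  qed (use assms in simp_all)
  also have "\<dots> = 0"
    using U0_le V0_le by (simp add: mild_def transport_def integral_iv_empty \<phi>_def max_def)
  finally have "(LINT x|mu. \<phi> (u t x)) + (LINT x|mu. \<phi> (v t x)) \<le> 0" .
  moreover have nn: "0 \<le> \<phi> s" for s by (simp add: \<phi>_def)
  then have "0 \<le> (LINT x|mu. \<phi> (u t x))" "0 \<le> (LINT x|mu. \<phi> (v t x))" by simp_all
  ultimately have z: "(LINT x|mu. \<phi> (u t x)) = 0" "(LINT x|mu. \<phi> (v t x)) = 0" by linarith+
  have \<phi>0: "s \<le> M" if "\<phi> s = 0" for s using that by (auto simp: \<phi>_def max_def split: if_splits)
  show "AE x in mu. u t x \<le> M"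
    using integral_nonneg_eq_0_iff_AE[of mu "\<lambda>x. \<phi> (u t x)"] z nn bdd_borel_integrable[OF b(1)] assms \<phi>0 by auto
  show "AE x in mu. v t x \<le> M"
    using integral_nonneg_eq_0_iff_AE[of mu "\<lambda>x. \<phi> (v t x)"] z nn bdd_borel_integrable[OF b(2)] assms \<phi>0 by auto
qed

lemma mass_conservation:
  assumes "0 \<le> t" "t \<le> T"
  shows "(LINT x|mu. u t x) + (LINT x|mu. v t x) = 2 * m"
proof -
  have "prim T (\<lambda>t. (LINT x|mu. u t x) + (LINT x|mu. v t x)) (\<lambda>t. (LINT x|mu. 1 * F t x) + (LINT x|mu. 1 * - F t x))"
    by (rule prim_energy_sum[where C=0]) auto
  from prim_eq[OF this assms] integral_initial[of "\<lambda>x. x"] total_mass show ?thesis by simp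
qed

section \<open>The energy and its hypocoercive correction\<close>

definition "energy t = (LINT x|mu. (u t x - m)\<^sup>2) + (LINT x|mu. (v t x - m)\<^sup>2)"

lemma prim_L2: "prim T energy (\<lambda>t. (LINT x|mu. 2 * (u t x - m) * F t x) + (LINT x|mu. 2 * (v t x - m) * - F t x))"
  unfolding energy_def[abs_def]
proof (rule prim_energy_sum[where C=2])
  fix x y :: real
  have "(y - m)\<^sup>2 - (x - m)\<^sup>2 - 2 * (x - m) * (y - x) = (y - x)\<^sup>2" by (simp add: power2_eq_square algebra_simps)
  then show "\<bar>(y - m)\<^sup>2 - (x - m)\<^sup>2 - 2 * (x - m) * (y - x)\<bar> \<le> 2 * (y - x)\<^sup>2" by simp
  show "\<bar>2 * (y - m) - 2 * (x - m)\<bar> \<le> 2 * \<bar>y - x\<bar>" by (simp add: abs_if)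
qed auto

lemma L2_derivative:
  assumes "t \<le> T"
  shows "(LINT x|mu. 2 * (u t x - m) * F t x) + (LINT x|mu. 2 * (v t x - m) * - F t x) = (LINT x|mu. 2 * (u t x - v t x) * F t x)"
proof -
  note bi = bdd_borel_integrable bdd_borel_intros bdd_borel_sol[OF assms]
  have "(LINT x|mu. 2 * (u t x - m) * F t x) + (LINT x|mu. 2 * (v t x - m) * - F t x)
     = (LINT x|mu. 2 * (u t x - m) * F t x) - (LINT x|mu. 2 * (v t x - m) * F t x)" by simp
  also have "\<dots> = (LINT x|mu. 2 * (u t x - m) * F t x - 2 * (v t x - m) * F t x)"
    by (rule Bochner_Integration.integral_diff[symmetric]; intro bi)
  also have "\<dots> = (LINT x|mu. 2 * (u t x - v t x) * F t x)"
    by (rule Bochner_Integration.integral_cong) (auto simp: algebra_simps)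
  finally show ?thesis .
qed

text \<open>The hypocoercive correction, in characteristic coordinates: the kernel is the periodic sawtooth, i.e. the
  Green function of the antiderivative on the torus.\<close>

definition "potential t a = (LINT b|mu. V t b * (frac (b - a - 2 * c * t) - 1/2))"
definition "potential_src t a = (LINT b|mu. - F t (frac (b + - c * t)) * (frac (b - a - 2 * c * t) - 1/2))"
definition "cross t = (LINT a|mu. (U t a - m) * potential t a)"
definition "cross_deriv t = (LINT a|mu. F t (frac (a + c * t)) * potential t a
    + (U t a - m) * (potential_src t a + 2 * c * (V t (frac (a + 2 * c * t)) - (LINT b|mu. V t b))))"

lemma sawtooth_half: "\<bar>frac x - 1/2 :: real\<bar> \<le> 1/2"
  using frac_lt_1[of x] frac_ge_0[of x] by linarith

lemma abs_integral_sawtooth_le: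
  assumes "bdd_borel f"
  shows "\<bar>LINT b|mu. f b * (frac (b - z) - 1/2)\<bar> \<le> 1/2 * (LINT b|mu. \<bar>f b\<bar>)"
proof -
  have S: "bdd_borel (\<lambda>b. frac (b - z) - 1/2)" by (rule bdd_borelI[OF _ sawtooth_half]) measurable
  show ?thesis using abs_integral_mult_le[OF assms S sawtooth_half] by simp
qed

lemma potential_measurable: 
  "case_prod potential \<in> borel_measurable (borel \<Otimes>\<^sub>M borel)" "case_prod potential_src \<in> borel_measurable (borel \<Otimes>\<^sub>M borel)"
proof -
  note [measurable (raw)] = V.transport_comp U.F_comp
  show "case_prod potential \<in> borel_measurable (borel \<Otimes>\<^sub>M borel)" "case_prod potential_src \<in> borel_measurable (borel \<Otimes>\<^sub>M borel)"
    unfolding potential_def[abs_def] potential_src_def[abs_def] case_prod_unfold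
    by (rule measurable_integral_iv, measurable)+
qed

lemma shifted_source_bdd: "bdd_borel (\<lambda>b. F t (frac (b + z)))"
proof -
  note [measurable (raw)] = U.F_comp
  show ?thesis by (rule bdd_borelI[OF _ F_bdd]) measurable
qed

lemma L1_identities:
  shows "(LINT y|mu. \<bar>V t y - m\<bar>) = (LINT x|mu. \<bar>v t x - m\<bar>)" "(LINT y|mu. \<bar>U t y - m\<bar>) = (LINT x|mu. \<bar>u t x - m\<bar>)"
    "(LINT y|mu. \<bar>F t (frac (y + z))\<bar>) = (LINT x|mu. \<bar>F t x\<bar>)"
  using V.integral_transport_mild[of "\<lambda>u x. \<bar>u - m\<bar>"] U.integral_transport_mild[of "\<lambda>u x. \<bar>u - m\<bar>"]
    integral_frac_shift[of "\<lambda>x. \<bar>F t x\<bar>" z] F_section by simp_all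

text \<open>The sawtooth has mean zero, so \<open>V\<close> may be replaced by \<open>V - m\<close>.
  The bound then vanishes at equilibrium, and the correction is controlled by the energy.\<close>

lemma potential_le:
  assumes "t \<le> T"
  shows "\<bar>potential t a\<bar> \<le> 1/2 * (LINT x|mu. \<bar>v t x - m\<bar>)"
proof -
  note bV = bdd_borel_sol(5)[OF assms]
  have S: "bdd_borel (\<lambda>b. frac (b - (a + 2 * c * t)) - 1/2)" by (rule bdd_borelI[OF _ sawtooth_half]) measurable
  have "(LINT b|mu. (V t b - m) * (frac (b - (a + 2 * c * t)) - 1/2))
      = (LINT b|mu. V t b * (frac (b - (a + 2 * c * t)) - 1/2)) - (LINT b|mu. m * (frac (b + - (a + 2 * c * t)) - 1/2))"
    unfolding left_diff_distrib add_uminus_conv_diff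
    by (rule Bochner_Integration.integral_diff; intro bdd_borel_integrable bdd_borel_mult bV S bdd_borel_const)
  also have "\<dots> = potential t a"
    unfolding integral_mult_right_zero integral_sawtooth by (simp add: potential_def diff_diff_eq)
  finally have "potential t a = (LINT b|mu. (V t b - m) * (frac (b - (a + 2 * c * t)) - 1/2))" ..
  then show ?thesis
    using abs_integral_sawtooth_le[OF bdd_borel_diff[OF bV bdd_borel_const], of m "a + 2 * c * t"] L1_identities(1)[of t]
    by simp
qed

lemma potential_src_le: "\<bar>potential_src t a\<bar> \<le> 1/2 * (LINT x|mu. \<bar>F t x\<bar>)"
  using abs_integral_sawtooth_le[OF shifted_source_bdd, of t "- c * t" "a + 2 * c * t"] L1_identities(3)[of t "- c * t"]
  by (simp add: potential_src_def diff_diff_eq)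

lemma bdd_borel_potential:
  assumes "t \<le> T"
  shows "bdd_borel (potential t)" "bdd_borel (potential_src t)"
  by (rule bdd_borelI[OF measurable_section2[OF potential_measurable(1)] potential_le[OF assms]])
     (rule bdd_borelI[OF measurable_section2[OF potential_measurable(2)] potential_src_le])

text \<open>At a fixed label \<open>a\<close> both factors are time primitives: \<open>U\<close>
  along its characteristic, and \<open>potential\<close> by the moving sawtooth with the relative
  speed \<open>2 * c\<close>. The product rule precedes the integration over
  \<open>a\<close>.\<close>

lemma prim_cross: "prim T cross cross_deriv"
  unfolding cross_def[abs_def] cross_deriv_def[abs_def]
proof (rule prim_integral)
  note [measurable (raw)] = V.transport_comp U.transport_comp U.F_comp measurable_comp2[OF potential_measurable(1)] measurable_comp2[OF potential_measurable(2)]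
  have [measurable]: "(\<lambda>t. LINT b|mu. V t b) \<in> borel_measurable borel"
    by (rule measurable_integral_iv) measurable
  show "(\<lambda>(t, a). (U t a - m) * potential t a) \<in> borel_measurable (borel \<Otimes>\<^sub>M borel)" by measurable
  show "(\<lambda>(t, a). F t (frac (a + c * t)) * potential t a
      + (U t a - m) * (potential_src t a + 2 * c * (V t (frac (a + 2 * c * t)) - (LINT b|mu. V t b)))) \<in> borel_measurable (borel \<Otimes>\<^sub>M borel)"
    by measurable
  define A where "A = B + K * T"
  have A: "0 \<le> A" using U.B_nonneg U.K_nonneg T by (simp add: A_def)
  have UA: "\<bar>U t y\<bar> \<le> A" "\<bar>V t y\<bar> \<le> A" if "t \<le> T" for t y
    using U.transport_bound[OF that T] V.transport_bound[OF that T] by (auto simp: A_def)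
  have IV: "\<bar>LINT b|mu. V t b\<bar> \<le> A" if "t \<le> T" for t
    using integral_iv_bound[of 0 1 "V t" A] UA[OF that] A by simp
  have VS: "\<bar>V t b * (frac x - 1/2)\<bar> \<le> A * (1/2)" if "t \<le> T" for t b x
    unfolding abs_mult using UA[OF that] sawtooth_half A by (intro mult_mono) auto
  have PA: "\<bar>potential t a\<bar> \<le> A" if "t \<le> T" for t a
    unfolding potential_def using integral_iv_bound[of 0 1 "\<lambda>b. V t b * (frac (b - a - 2 * c * t) - 1/2)" "A * (1/2)"] VS[OF that] A by simp
  have FS: "\<bar>- F t y * (frac x - 1/2)\<bar> \<le> K * (1/2)" for t y x
    unfolding abs_mult using F_bdd sawtooth_half U.K_nonneg by (intro mult_mono) auto
  have SK: "\<bar>potential_src t a\<bar> \<le> K" for t a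
    unfolding potential_src_def using integral_iv_bound[of 0 1 "\<lambda>b. - F t (frac (b + - c * t)) * (frac (b - a - 2 * c * t) - 1/2)" "K * (1/2)"] FS U.K_nonneg by simp
  show "\<bar>F t (frac (a + c * t)) * potential t a
      + (U t a - m) * (potential_src t a + 2 * c * (V t (frac (a + 2 * c * t)) - (LINT b|mu. V t b)))\<bar>
      \<le> K * A + (A + m) * (K + 2 * c * (A + A))" if "t \<le> T" for t a
  proof -
    have "\<bar>V t (frac (a + 2 * c * t)) - (LINT b|mu. V t b)\<bar> \<le> A + A"
      using UA(2)[OF that, of "frac (a + 2 * c * t)"] IV[OF that] by linarith
    then have "\<bar>2 * c * (V t (frac (a + 2 * c * t)) - (LINT b|mu. V t b))\<bar> \<le> 2 * c * (A + A)"
      unfolding abs_mult using c by (intro mult_mono) auto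
    then have 1: "\<bar>potential_src t a + 2 * c * (V t (frac (a + 2 * c * t)) - (LINT b|mu. V t b))\<bar> \<le> K + 2 * c * (A + A)"
      using SK[of t a] by linarith
    have 2: "\<bar>U t a - m\<bar> \<le> A + m" using UA(1)[OF that, of a] pos by linarith
    have "\<bar>(U t a - m) * (potential_src t a + 2 * c * (V t (frac (a + 2 * c * t)) - (LINT b|mu. V t b)))\<bar> \<le> (A + m) * (K + 2 * c * (A + A))"
      unfolding abs_mult using 1 2 pos A by (intro mult_mono) auto
    moreover have "\<bar>F t (frac (a + c * t)) * potential t a\<bar> \<le> K * A"
      unfolding abs_mult using F_bdd PA[OF that] U.K_nonneg by (intro mult_mono) auto
    ultimately show ?thesis by linarith
  qed
  show "\<bar>(U 0 a - m) * potential 0 a\<bar> \<le> (A + m) * A" for a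
  proof -
    have "\<bar>U 0 a - m\<bar> \<le> A + m" using UA(1)[OF T, of a] pos by linarith
    then show ?thesis unfolding abs_mult using PA[OF T] A pos by (intro mult_mono) auto
  qed
  fix a
  have P: "prim T (\<lambda>t. potential t a) (\<lambda>t. potential_src t a + 2 * c * (V t (frac (a + 2 * c * t)) - (LINT b|mu. V t b)))"
    unfolding potential_def potential_src_def
    by (rule prim_moving_sawtooth[where G="\<lambda>t b. - F t (frac (b + - c * t))" and K=K and B=A])
       (use UA F_bdd V.prim_transport V.transport_measurable c T in \<open>auto\<close>)
  have "prim T (\<lambda>t. U t a + - m) (\<lambda>t. F t (frac (a + c * t)) + 0)"
    by (rule prim_add[OF U.prim_transport]) (rule primI[where K=0]; simp)
  from prim_mult[OF this P]
  show "prim T (\<lambda>t. (U t a - m) * potential t a) (\<lambda>t. F t (frac (a + c * t)) * potential t a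
      + (U t a - m) * (potential_src t a + 2 * c * (V t (frac (a + 2 * c * t)) - (LINT b|mu. V t b))))"
    by simp
qed

text \<open>Each density contributes its L1 distance to \<open>m\<close> and the kernel a factor
  1/2; on a space of mass 1 the squared L1 distance is at most the squared L2 distance.\<close>

lemma cross_le:
  assumes "t \<le> T"
  shows "\<bar>2 * cross t\<bar> \<le> energy t"
proof -
  note bi = bdd_borel_integrable bdd_borel_intros bdd_borel_sol[OF assms] bdd_borel_potential[OF assms]
  define a1 where "a1 = (LINT x|mu. \<bar>u t x - m\<bar>)"
  define a2 where "a2 = (LINT x|mu. \<bar>v t x - m\<bar>)"
  have "\<bar>cross t\<bar> \<le> (LINT a|mu. \<bar>U t a - m\<bar>) * (1/2 * a2)"
    unfolding cross_def a2_def by (intro abs_integral_mult_le potential_le assms bi)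
  then have "\<bar>2 * cross t\<bar> \<le> a1 * a2" by (simp add: L1_identities a1_def)
  also have "\<dots> \<le> a1\<^sup>2 + a2\<^sup>2" using sum_squares_bound[of a1 a2] zero_le_power2[of a1] zero_le_power2[of a2] by linarith
  also have "\<dots> \<le> (LINT x|mu. \<bar>u t x - m\<bar>\<^sup>2) + (LINT x|mu. \<bar>v t x - m\<bar>\<^sup>2)"
    unfolding a1_def a2_def by (intro add_mono power2_integral_mu_le bi)
  finally show ?thesis by (simp add: energy_def)
qed

text \<open>The main term is the covariance of \<open>u\<close> and \<open>v\<close>, created by the
  jump of the kernel. The two terms in which \<open>F\<close> replaces a derivative carry no sign
  and are estimated in L1.\<close>

lemma cross_deriv_ge:
  assumes "t \<le> T"
  shows "2 * c * ((LINT x|mu. u t x * v t x) - (LINT x|mu. u t x) * (LINT x|mu. v t x))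
     - 1/2 * (LINT x|mu. \<bar>F t x\<bar>) * ((LINT x|mu. \<bar>u t x - m\<bar>) + (LINT x|mu. \<bar>v t x - m\<bar>)) \<le> cross_deriv t"
proof -
  define n where "n = (LINT x|mu. \<bar>F t x\<bar>)"
  define a1 where "a1 = (LINT x|mu. \<bar>u t x - m\<bar>)"
  define a2 where "a2 = (LINT x|mu. \<bar>v t x - m\<bar>)"
  define vb where "vb = (LINT x|mu. v t x)"
  have vb: "(LINT b|mu. V t b) = vb"
    using V.integral_transport_mild[of "\<lambda>u x. u"] by (simp add: vb_def)
  note [measurable (raw)] = V.transport_comp V.mild_comp
  have bVf: "bdd_borel (\<lambda>a. V t (frac (a + z)))" for z
    by (rule bdd_borelI[OF _ V.transport_bound[OF assms T]]) measurable
  note bi = bdd_borel_integrable bdd_borel_intros bdd_borel_sol[OF assms] bdd_borel_potential[OF assms] shifted_source_bdd bVf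
  have split: "cross_deriv t = (LINT a|mu. F t (frac (a + c * t)) * potential t a) + (LINT a|mu. (U t a - m) * potential_src t a)
     + (LINT a|mu. 2 * c * ((U t a - m) * (V t (frac (a + 2 * c * t)) - vb)))"
  proof -
    have "cross_deriv t = (LINT a|mu. (F t (frac (a + c * t)) * potential t a + (U t a - m) * potential_src t a) 
       + 2 * c * ((U t a - m) * (V t (frac (a + 2 * c * t)) - vb)))"
      unfolding cross_deriv_def vb by (rule Bochner_Integration.integral_cong) (auto simp: algebra_simps)
    also have "\<dots> = (LINT a|mu. F t (frac (a + c * t)) * potential t a + (U t a - m) * potential_src t a) 
      + (LINT a|mu. 2 * c * ((U t a - m) * (V t (frac (a + 2 * c * t)) - vb)))"
      by (rule Bochner_Integration.integral_add; intro bi)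
    also have "(LINT a|mu. F t (frac (a + c * t)) * potential t a + (U t a - m) * potential_src t a)
      = (LINT a|mu. F t (frac (a + c * t)) * potential t a) + (LINT a|mu. (U t a - m) * potential_src t a)"
      by (rule Bochner_Integration.integral_add; intro bi)
    finally show ?thesis .
  qed
  have 1: "\<bar>LINT a|mu. F t (frac (a + c * t)) * potential t a\<bar> \<le> n * (1/2 * a2)"
    unfolding n_def a2_def L1_identities(3)[of t "c * t", symmetric] by (intro abs_integral_mult_le potential_le assms bi)
  have 2: "\<bar>LINT a|mu. (U t a - m) * potential_src t a\<bar> \<le> a1 * (1/2 * n)"
    unfolding n_def a1_def L1_identities(2)[symmetric] by (intro abs_integral_mult_le potential_src_le bi)
  have 3: "(LINT a|mu. 2 * c * ((U t a - m) * (V t (frac (a + 2 * c * t)) - vb))) = 2 * c * ((LINT x|mu. u t x * v t x) - (LINT x|mu. u t x) * vb)"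
  proof -
    \<comment> \<open>The characteristics with labels \<open>a\<close> and
      \<open>a + 2 * c * t\<close> meet at time \<open>t\<close> in the physical point
      \<open>a + c * t\<close>, so both densities are evaluated at one point.\<close>
    have eq: "V t (frac (a + 2 * c * t)) = v t (frac (a + c * t))" for a
      unfolding mild_def by (simp add: algebra_simps)
    have "(LINT a|mu. (U t a - m) * (V t (frac (a + 2 * c * t)) - vb)) = (LINT x|mu. (u t x - m) * (v t x - vb))"
      unfolding eq by (rule U.integral_transport_mild[of "\<lambda>p x. (p - m) * (v t x - vb)"]) measurable
    also have "\<dots> = (LINT x|mu. u t x * v t x - vb * u t x - m * v t x + m * vb)"
      by (rule Bochner_Integration.integral_cong) (auto simp: algebra_simps)
    also have "\<dots> = (LINT x|mu. u t x * v t x) - vb * (LINT x|mu. u t x) - m * (LINT x|mu. v t x) + m * vb"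
      by (simp add: Bochner_Integration.integral_add Bochner_Integration.integral_diff bi measure_iv)
    finally show ?thesis by (simp add: vb_def)
  qed
  have "1/2 * n * (a1 + a2) = n * (1/2 * a2) + a1 * (1/2 * n)" by (simp add: algebra_simps)
  then show ?thesis using 1 2
    unfolding split 3 n_def[symmetric] a1_def[symmetric] a2_def[symmetric] vb_def[symmetric] by linarith
qed

text \<open>The factor 2 is the quotient of 4/3 and 2/3, the constants comparing the corrected
  energy with the energy.\<close>

theorem energy_decay:
  assumes "0 \<le> t" "t \<le> T"
  shows "energy t \<le> 2 * exp (- decay_rate c m ks \<kappa> * t) * energy 0"
proof -
  define \<epsilon> where "\<epsilon> = hypo_weight c m ks \<kappa>"
  define \<beta> where "\<beta> = decay_rate c m ks \<kappa>"
  have e: "0 < \<epsilon>" "\<epsilon> \<le> 1/3" unfolding \<epsilon>_def using hypo_weight_bounds[OF c pos] by auto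
  have \<beta>: "0 < \<beta>" unfolding \<beta>_def by (rule decay_rate_pos[OF c pos])
  define L where "L t = energy t + (- 2 * \<epsilon>) * cross t" for t
  have Lb: "2/3 * energy s \<le> L s" "L s \<le> 4/3 * energy s" if "s \<le> T" for s
  proof -
    have "\<bar>\<epsilon> * (2 * cross s)\<bar> \<le> 1/3 * energy s"
      unfolding abs_mult using e cross_le[OF that] by (intro mult_mono) auto
    then show "2/3 * energy s \<le> L s" "L s \<le> 4/3 * energy s" unfolding L_def by (auto simp: abs_le_iff)
  qed
  have "L t \<le> exp (- \<beta> * t) * L 0"
    unfolding L_def
  proof (rule prim_gronwall[OF prim_add[OF prim_L2 prim_cmult[OF prim_cross]] _ assms])
    have "AE s in iv 0 T. 0 \<le> s \<and> s \<le> T" by (rule AE_ivI) auto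
    with flux show "AE s in iv 0 T. (LINT x|mu. 2 * (u s x - m) * F s x) + (LINT x|mu. 2 * (v s x - m) * - F s x)
        + - 2 * \<epsilon> * cross_deriv s \<le> - \<beta> * (energy s + - 2 * \<epsilon> * cross s)"
    proof eventually_elim
      case (elim s)
      have s: "0 \<le> s" "s \<le> T" using elim by auto
      define X where "X = (LINT x|mu. u s x * v s x) - (LINT x|mu. u s x) * (LINT x|mu. v s x)"
      define n where "n = (LINT x|mu. \<bar>F s x\<bar>)"
      define a where "a = (LINT x|mu. \<bar>u s x - m\<bar>) + (LINT x|mu. \<bar>v s x - m\<bar>)"
      \<comment> \<open>The maximum principle makes the conditional bounds on \<open>q\<close>
        unconditional at almost every point.\<close>
      have "AE x in mu. \<exists>q. F s x = q * (v s x - u s x) \<and> 0 \<le> q \<and> 0 \<le> u s x \<and> 0 \<le> v s x \<and> q \<le> \<kappa> \<and> ks * (u s x + v s x) \<le> q"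
        using elim(1) maximum_principle[OF s] by eventually_elim auto
      from dissipation_inequality[OF bdd_borel_sol(1-3)[OF s(2)] mass_conservation[OF s] this c pos]
      have 1: "(LINT x|mu. 2 * (u s x - v s x) * F s x) - 4 * \<epsilon> * c * X + \<epsilon> * n * a \<le> - \<beta> * (4/3 * energy s)"
        by (simp only: \<epsilon>_def \<beta>_def X_def n_def a_def energy_def)
      have "2 * c * X - 1/2 * n * a \<le> cross_deriv s" 
        using cross_deriv_ge[OF s(2)] by (simp only: X_def n_def a_def)
      then have "2 * \<epsilon> * (2 * c * X - 1/2 * n * a) \<le> 2 * \<epsilon> * cross_deriv s" using e by (intro mult_left_mono) auto
      then have 2: "4 * \<epsilon> * c * X - \<epsilon> * n * a \<le> 2 * \<epsilon> * cross_deriv s" by (simp add: algebra_simps)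
      have "\<beta> * L s \<le> \<beta> * (4/3 * energy s)" using Lb(2)[OF s(2)] \<beta> by (intro mult_left_mono) auto
      with 1 2 show ?case unfolding L2_derivative[OF s(2)] L_def by linarith
    qed
  qed
  also have "\<dots> \<le> exp (- \<beta> * t) * (4/3 * energy 0)" using Lb(2)[OF T] by (intro mult_left_mono) auto
  finally have "2/3 * energy t \<le> exp (- \<beta> * t) * (4/3 * energy 0)" using Lb(1)[OF assms(2)] by linarith
  then show ?thesis unfolding \<beta>_def by linarith
qed

end

section \<open>Test functions\<close>

text \<open>All derivatives of the standard cutoff \<open>exp (- d / s)\<close> are combinations of
  these functions, \<open>j\<close> counting the power of \<open>s\<close> in the denominator. For
  \<open>j = 0\<close> they tend to the indicator of \<open>{0<..}\<close> as \<open>d\<close> tends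
  to 0.\<close>

definition flat :: "nat \<Rightarrow> real \<Rightarrow> real \<Rightarrow> real" where
  "flat j d s = (if 0 < s then exp (- d / s) / s ^ j else 0)"

lemma flat_nonneg: "0 \<le> flat j d s"
  by (simp add: flat_def)

lemma flat_le_one: "0 \<le> d \<Longrightarrow> flat 0 d s \<le> 1"
  by (auto simp: flat_def)

text \<open>With \<open>x = d / s\<close>, the n-th power of \<open>x / n\<close> is at most that of
  \<open>1 + x / n\<close>, hence at most \<open>exp x\<close>: the exponential beats every pole at
  0.\<close>

lemma exp_neg_div_power_le:
  fixes s d :: real
  assumes "0 < s" "0 < d" "0 < n"
  shows "exp (- d / s) / s ^ n \<le> (real n / d) ^ n"
proof -
  have "(d / s / real n) ^ n \<le> (1 + d / s / real n) ^ n" using assms by (intro power_mono) auto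
  also have "\<dots> \<le> exp (d / s)" using assms by (intro exp_ge_one_plus_x_over_n_power_n) (auto intro: order_trans[of _ 0])
  finally have "exp (- d / s) * (d / s / real n) ^ n \<le> exp (- d / s) * exp (d / s)" by (intro mult_left_mono) auto
  then have "exp (- d / s) * (d / s / real n) ^ n \<le> 1" by (simp flip: exp_add)
  moreover have "exp (- d / s) * (d / s / real n) ^ n = (exp (- d / s) / s ^ n) / (real n / d) ^ n"
    by (simp add: power_divide power_mult_distrib)
  ultimately have "(exp (- d / s) / s ^ n) / (real n / d) ^ n \<le> 1" by metis
  then show ?thesis using assms by (simp add: divide_le_eq mult.commute)
qed

lemma flat_le: "0 < d \<Longrightarrow> 0 < j \<Longrightarrow> flat j d s \<le> (real j / d) ^ j"
  using exp_neg_div_power_le[of s d j] by (cases "0 < s") (simp_all add: flat_def)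

text \<open>Quadratic decay at 0, for every \<open>j\<close>, is what glues the two branches
  differentiably.\<close>

lemma flat_quadratic: 
  assumes "0 < d"
  shows "\<bar>flat j d s\<bar> \<le> (real (j + 2) / d) ^ (j + 2) * s\<^sup>2"
proof (cases "0 < s")
  case True
  have "exp (- d / s) / s ^ (j + 2) * s\<^sup>2 \<le> (real (j + 2) / d) ^ (j + 2) * s\<^sup>2"
    by (intro mult_right_mono exp_neg_div_power_le) (use assms True in auto)
  moreover have "exp (- d / s) / s ^ (j + 2) * s\<^sup>2 = flat j d s"
    using True by (simp add: flat_def power_add power2_eq_square)
  ultimately show ?thesis by (simp add: flat_nonneg)
next
  case False then show ?thesis using assms by (simp add: flat_def)
qed

lemma flat_deriv:
  assumes "0 < d"
  shows "(flat j d has_real_derivative (d * flat (j + 2) d s - real j * flat (j + 1) d s)) (at s)"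
proof (cases s "0 :: real" rule: linorder_cases)
  case less
  have "((\<lambda>_. 0) has_real_derivative (d * flat (j + 2) d s - real j * flat (j + 1) d s)) (at s)"
    using less by (simp add: flat_def)
  then show ?thesis
    by (rule has_field_derivative_transform_within_open[where S="{..<0}"]) (use less in \<open>auto simp: flat_def\<close>)
next
  case equal
  define C where "C = (real (j + 2) / d) ^ (j + 2)"
  have C: "\<bar>flat j d y\<bar> \<le> C * y\<^sup>2" for y unfolding C_def by (rule flat_quadratic[OF assms])
  have C0: "0 \<le> C" using order_trans[OF abs_ge_zero C[of 1]] by simp
  have "((\<lambda>y. flat j d y / y) \<longlongrightarrow> 0) (at 0)"
  proof (rule tendsto_rabs_zero_cancel, rule tendsto_sandwich[OF _ _ tendsto_const])
    show "((\<lambda>y. C * \<bar>y\<bar>) \<longlongrightarrow> 0) (at 0)" by (auto intro!: tendsto_eq_intros)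
    have "\<bar>flat j d y / y\<bar> \<le> C * \<bar>y\<bar>" for y
    proof (cases "y = 0")
      case False
      have "\<bar>flat j d y\<bar> \<le> C * \<bar>y\<bar> * \<bar>y\<bar>" using C[of y] by (simp add: power2_eq_square mult.assoc)
      then show ?thesis using False by (simp add: divide_le_eq)
    qed simp
    then show "\<forall>\<^sub>F y in at 0. \<bar>flat j d y / y\<bar> \<le> C * \<bar>y\<bar>" by simp
  qed simp
  then show ?thesis using equal by (simp add: has_field_derivative_iff flat_def)
next
  case greater
  have "((\<lambda>s. exp (- d / s) / s ^ j) has_real_derivative (d * flat (j + 2) d s - real j * flat (j + 1) d s)) (at s)"
    using greater
    apply (auto intro!: derivative_eq_intros simp: flat_def)
    apply (cases j)
     apply (simp_all add: field_simps power2_eq_square)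
    done
  then show ?thesis
    by (rule has_field_derivative_transform_within_open[where S="{0<..}"]) (use greater in \<open>auto simp: flat_def\<close>)
qed

lemma flat_continuous: "0 < d \<Longrightarrow> continuous_on UNIV (flat j d)"
  by (intro continuous_at_imp_continuous_on ballI DERIV_isCont[OF flat_deriv])

lemma flat_lipschitz:
  assumes "0 < d"
  shows "\<bar>flat 0 d x - flat 0 d y\<bar> \<le> 4 / d * \<bar>x - y\<bar>"
proof -
  have "norm (flat 0 d x - flat 0 d y) \<le> 4 / d * norm (x - y)"
  proof (rule field_differentiable_bound[of UNIV])
    show "(flat 0 d has_field_derivative d * flat 2 d z) (at z within UNIV)" for z
      using flat_deriv[OF assms, of 0 z] by (simp add: numeral_2_eq_2)
    show "norm (d * flat 2 d z) \<le> 4 / d" for z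
    proof -
      have "d * flat 2 d z \<le> d * (real 2 / d) ^ 2" using assms by (intro mult_left_mono flat_le) auto
      also have "\<dots> = 4 / d" using assms by (simp add: power2_eq_square)
      finally show ?thesis using assms flat_nonneg[of 2 d z] by (simp add: abs_mult)
    qed
  qed auto
  then show ?thesis by simp
qed

text \<open>As \<open>smooth2\<close> is coinductive, smoothness is proved by exhibiting a class
  closed under both partial derivatives. Differentiation keeps \<open>flat\<close> in the class by
  raising \<open>j\<close>, and the cosine by shifting its phase \<theta> by a quarter
  period.\<close>

inductive transported_smooth :: "real \<Rightarrow> (real \<times> real \<Rightarrow> real) \<Rightarrow> bool" for c where
  const: "transported_smooth c (\<lambda>z. k)"
| time: "transported_smooth c (\<lambda>z. fst z)"
| cosine: "transported_smooth c (\<lambda>z. cos (2 * pi * (snd z - c * fst z) + \<theta>))"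
| add: "transported_smooth c f \<Longrightarrow> transported_smooth c g \<Longrightarrow> transported_smooth c (\<lambda>z. f z + g z)"
| mult: "transported_smooth c f \<Longrightarrow> transported_smooth c g \<Longrightarrow> transported_smooth c (\<lambda>z. f z * g z)"
| flat_comp: "transported_smooth c f \<Longrightarrow> 0 < d \<Longrightarrow> transported_smooth c (\<lambda>z. flat j d (f z))"

lemma transported_smooth_derivative:
  assumes "transported_smooth c f"
  shows "\<exists>ft fx. transported_smooth c ft \<and> transported_smooth c fx
    \<and> (\<forall>z. (f has_derivative (\<lambda>h. ft z * fst h + fx z * snd h)) (at z))"
  using assms
proof induction
  case (const k)
  show ?case
    by (rule exI[of _ "\<lambda>z. 0"], rule exI[of _ "\<lambda>z. 0"]) (auto intro: transported_smooth.const)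
next
  case time
  show ?case
    by (rule exI[of _ "\<lambda>z. 1"], rule exI[of _ "\<lambda>z. 0"])
       (auto intro: transported_smooth.const has_derivative_fst[OF has_derivative_ident])
next
  case (cosine \<theta>)
  let ?\<theta> = "\<lambda>z. 2 * pi * (snd z - c * fst z) + \<theta>"
  show ?case
  proof (rule exI[of _ "\<lambda>z. - 2 * pi * c * cos (2 * pi * (snd z - c * fst z) + (\<theta> + pi / 2))"],
      rule exI[of _ "\<lambda>z. 2 * pi * cos (2 * pi * (snd z - c * fst z) + (\<theta> + pi / 2))"], intro conjI allI)
    have "cos (2 * pi * (snd z - c * fst z) + (\<theta> + pi / 2)) = - sin (?\<theta> z)" for z :: "real \<times> real"
      using cos_add[of "?\<theta> z" "pi / 2"] by (simp add: add.assoc)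
    then show "((\<lambda>z. cos (?\<theta> z)) has_derivative
      (\<lambda>h. - 2 * pi * c * cos (2 * pi * (snd z - c * fst z) + (\<theta> + pi / 2)) * fst h
        + 2 * pi * cos (2 * pi * (snd z - c * fst z) + (\<theta> + pi / 2)) * snd h)) (at z)" for z
      by (auto intro!: derivative_eq_intros simp: algebra_simps)
  qed (intro transported_smooth.mult transported_smooth.const transported_smooth.cosine)+
next
  case (add f g)
  then obtain ft fx gt gx where d: "transported_smooth c ft" "transported_smooth c fx" "transported_smooth c gt" "transported_smooth c gx"
    "\<And>z. (f has_derivative (\<lambda>h. ft z * fst h + fx z * snd h)) (at z)" "\<And>z. (g has_derivative (\<lambda>h. gt z * fst h + gx z * snd h)) (at z)"
    by blast
  show ?case
  proof (rule exI[of _ "\<lambda>z. ft z + gt z"], rule exI[of _ "\<lambda>z. fx z + gx z"], intro conjI allI)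
    show "((\<lambda>z. f z + g z) has_derivative (\<lambda>h. (ft z + gt z) * fst h + (fx z + gx z) * snd h)) (at z)" for z
      by (rule has_derivative_eq_rhs[OF has_derivative_add[OF d(5,6)]]) (auto simp: algebra_simps)
  qed (intro transported_smooth.add d)+
next
  case (mult f g)
  then obtain ft fx gt gx where d: "transported_smooth c ft" "transported_smooth c fx" "transported_smooth c gt" "transported_smooth c gx"
    "\<And>z. (f has_derivative (\<lambda>h. ft z * fst h + fx z * snd h)) (at z)" "\<And>z. (g has_derivative (\<lambda>h. gt z * fst h + gx z * snd h)) (at z)"
    by blast
  show ?case
  proof (rule exI[of _ "\<lambda>z. f z * gt z + ft z * g z"], rule exI[of _ "\<lambda>z. f z * gx z + fx z * g z"], intro conjI allI)
    show "((\<lambda>z. f z * g z) has_derivative (\<lambda>h. (f z * gt z + ft z * g z) * fst h + (f z * gx z + fx z * g z) * snd h)) (at z)" for z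
      by (rule has_derivative_eq_rhs[OF has_derivative_mult[OF d(5,6)]]) (auto simp: algebra_simps)
  qed (intro transported_smooth.add transported_smooth.mult d mult)+
next
  case (flat_comp f d j)
  then obtain ft fx where d: "transported_smooth c ft" "transported_smooth c fx"
    "\<And>z. (f has_derivative (\<lambda>h. ft z * fst h + fx z * snd h)) (at z)"
    by blast
  show ?case
  proof (rule exI[of _ "\<lambda>z. (d * flat (j + 2) d (f z) + - real j * flat (j + 1) d (f z)) * ft z"], 
      rule exI[of _ "\<lambda>z. (d * flat (j + 2) d (f z) + - real j * flat (j + 1) d (f z)) * fx z"], intro conjI allI)
    show "((\<lambda>z. flat j d (f z)) has_derivative (\<lambda>h. (d * flat (j + 2) d (f z) + - real j * flat (j + 1) d (f z)) * ft z * fst h 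
       + (d * flat (j + 2) d (f z) + - real j * flat (j + 1) d (f z)) * fx z * snd h)) (at z)" for z
      by (rule has_derivative_eq_rhs[OF has_derivative_compose[OF d(3) flat_deriv[OF \<open>0 < d\<close>, of j "f z", unfolded has_field_derivative_def]]])
         (auto simp: algebra_simps)
  qed (intro transported_smooth.intros d flat_comp)+
qed

lemma transported_smooth_smooth2:
  assumes "transported_smooth c f"
  shows "smooth2 f"
  using assms
proof (coinduction arbitrary: f)
  case smooth2
  then obtain ft fx where d: "transported_smooth c ft" "transported_smooth c fx"
    "\<And>z. (f has_derivative (\<lambda>h. ft z * fst h + fx z * snd h)) (at z)"
    using transported_smooth_derivative by blast
  have fd: "frechet_derivative f (at z) = (\<lambda>h. ft z * fst h + fx z * snd h)" for z
    by (rule frechet_derivative_at[symmetric, OF d(3)])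
  have "f differentiable at z" for z using d(3)[of z] unfolding differentiable_def by blast
  moreover have "d_t f = ft" "d_x f = fx" by (simp_all add: fd)
  ultimately show ?case using d(1,2) by simp
qed

text \<open>A smooth function that is positive exactly on the arc around \<open>y\<close> where the
  cosine exceeds \<open>s\<close>. Composing with a cosine gives periodicity at once, and
  \<open>e\<close> tending to 0 yields the indicator of the arc.\<close>

definition bump :: "real \<Rightarrow> real \<Rightarrow> real \<Rightarrow> real \<Rightarrow> real" where
  "bump e y s x = flat 0 e (cos (2 * pi * (x - y)) - s)"

lemma bump_bounds: "0 < e \<Longrightarrow> 0 \<le> bump e y s x" "0 < e \<Longrightarrow> bump e y s x \<le> 1"
  by (auto simp: bump_def flat_nonneg intro: flat_le_one)

lemma bump_periodic: "bump e y s (x + of_int k) = bump e y s x"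
proof -
  have "cos (2 * pi * (x + of_int k - y)) = cos (2 * pi * (x - y) + 2 * pi * of_int k)" by (simp add: algebra_simps)
  also have "\<dots> = cos (2 * pi * (x - y))" by (simp add: cos_add)
  finally show ?thesis by (simp add: bump_def)
qed

lemma bump_frac: "bump e y s (frac x) = bump e y s x"
  using bump_periodic[of e y s "x" "- \<lfloor>x\<rfloor>"] by (simp add: frac_def)

lemma bump_measurable [measurable]: "0 < e \<Longrightarrow> bump e y s \<in> borel_measurable borel"
proof -
  assume "0 < e"
  then have [measurable]: "flat 0 e \<in> borel_measurable borel"
    by (intro borel_measurable_continuous_onI flat_continuous)
  show ?thesis unfolding bump_def[abs_def] by measurable
qed

lemma bump_lipschitz:
  assumes "0 < e"
  shows "\<bar>bump e y s x - bump e y s x'\<bar> \<le> (8 * pi / e) * \<bar>x - x'\<bar>"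
proof -
  have "norm (cos (2 * pi * (x - y)) - cos (2 * pi * (x' - y))) \<le> 2 * pi * norm (x - x')"
  proof (rule field_differentiable_bound[of UNIV])
    show "((\<lambda>x. cos (2 * pi * (x - y))) has_field_derivative - sin (2 * pi * (z - y)) * (2 * pi)) (at z within UNIV)" for z
      by (auto intro!: derivative_eq_intros)
    show "norm (- sin (2 * pi * (z - y)) * (2 * pi)) \<le> 2 * pi" for z
      using abs_sin_le_one[of "2 * pi * (z - y)"] by (simp add: abs_mult)
  qed auto
  then have le: "4 / e * \<bar>cos (2 * pi * (x - y)) - s - (cos (2 * pi * (x' - y)) - s)\<bar> \<le> 4 / e * (2 * pi * \<bar>x - x'\<bar>)"
    using assms by (intro mult_left_mono) auto
  have "\<bar>bump e y s x - bump e y s x'\<bar> \<le> 4 / e * \<bar>cos (2 * pi * (x - y)) - s - (cos (2 * pi * (x' - y)) - s)\<bar>"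
    unfolding bump_def by (rule flat_lipschitz[OF assms])
  also note le
  also have "4 / e * (2 * pi * \<bar>x - x'\<bar>) = (8 * pi / e) * \<bar>x - x'\<bar>" by simp
  finally show ?thesis .
qed

text \<open>A weight in the characteristic label \<open>x - c * t\<close>, times a time cutoff that
  vanishes from \<open>R\<close> on and tends to 1 before \<open>R\<close> as \<open>d\<close> tends
  to 0.\<close>

definition probe :: "real \<Rightarrow> real \<Rightarrow> real \<Rightarrow> real \<Rightarrow> real \<Rightarrow> real \<Rightarrow> real \<times> real \<Rightarrow> real" where
  "probe c R d e y s z = flat 0 d (R - fst z) * bump e y s (snd z - c * fst z)"

lemma probe_smooth:
  assumes "0 < d" "0 < e"
  shows "transported_smooth c (probe c R d e y s)"
proof -
  have "probe c R d e y s = (\<lambda>z. flat 0 d (R + (-1) * fst z) * flat 0 e (cos (2 * pi * (snd z - c * fst z) + - (2 * pi * y)) + - s))"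
    by (simp add: probe_def[abs_def] bump_def right_diff_distrib)
  then show ?thesis by (simp only:) (intro transported_smooth.intros assms)
qed

lemma probe_test_fun:
  assumes "0 < d" "0 < e"
  shows "test_fun (probe c R d e y s)"
  unfolding test_fun_def
proof (intro conjI allI exI impI)
  show "smooth2 (probe c R d e y s)" by (rule transported_smooth_smooth2[OF probe_smooth[OF assms]])
  show "probe c R d e y s (t, x + 1) = probe c R d e y s (t, x)" for t x
    using bump_periodic[of e y s "x - c * t" 1] by (simp add: probe_def algebra_simps)
  show "probe c R d e y s (t, x) = 0" if "R \<le> t" for t x
    using that by (simp add: probe_def flat_def)
qed

text \<open>Along the line \<open>(t + r, x + c * r)\<close> the label is constant, so the
  directional derivative only sees the time cutoff.\<close>

lemma probe_transport:
  assumes "0 < d" "0 < e"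
  shows "d_t (probe c R d e y s) (t, x) + c * d_x (probe c R d e y s) (t, x)
    = - (d * flat 2 d (R - t)) * bump e y s (x - c * t)"
proof -
  let ?f = "probe c R d e y s"
  obtain ft fx where d: "\<And>z. (?f has_derivative (\<lambda>h. ft z * fst h + fx z * snd h)) (at z)"
    using transported_smooth_derivative[OF probe_smooth[OF assms]] by blast
  have fd: "frechet_derivative ?f (at z) = (\<lambda>h. ft z * fst h + fx z * snd h)" for z
    by (rule frechet_derivative_at[symmetric, OF d])
  have line: "((\<lambda>r. (t + r, x + c * r)) has_derivative (\<lambda>h. (h, c * h))) (at 0)"
    by (auto intro!: derivative_eq_intros)
  have "((\<lambda>r. ?f (t + r, x + c * r)) has_derivative (\<lambda>h. ft (t, x) * h + fx (t, x) * (c * h))) (at 0)"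
    using has_derivative_compose[OF line, of ?f "\<lambda>h. ft (t, x) * fst h + fx (t, x) * snd h"] d[of "(t, x)"] by simp
  then have 1: "((\<lambda>r. ?f (t + r, x + c * r)) has_real_derivative (ft (t, x) + c * fx (t, x))) (at 0)"
    unfolding has_field_derivative_def by (rule has_derivative_eq_rhs) (auto simp: algebra_simps)
  have "((\<lambda>r. flat 0 d (R - (t + r))) has_real_derivative - (d * flat 2 d (R - t))) (at 0)"
  proof -
    have "((\<lambda>r. R - (t + r)) has_real_derivative -1) (at 0)" by (auto intro!: derivative_eq_intros)
    from DERIV_chain2[OF _ this, of "flat 0 d"] flat_deriv[OF assms(1), of 0 "R - t"] show ?thesis
      by (simp add: numeral_2_eq_2)
  qed
  from DERIV_cmult_right[OF this, of "bump e y s (x - c * t)"]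
  have 2: "((\<lambda>r. ?f (t + r, x + c * r)) has_real_derivative - (d * flat 2 d (R - t)) * bump e y s (x - c * t)) (at 0)"
    by (simp add: probe_def algebra_simps)
  show ?thesis using DERIV_unique[OF 1 2] by (simp add: fd)
qed

section \<open>Passing from Lebesgue to Borel representatives\<close>

text \<open>Preimages under \<open>f\<close> and \<open>g\<close> differ by null sets, and Lebesgue
  measure is complete.\<close>

lemma lebesgue_measurable_cong_AE:
  fixes f g :: "'a::euclidean_space \<Rightarrow> real"
  assumes g: "g \<in> borel_measurable lebesgue" and ae: "AE x in lebesgue. f x = g x"
  shows "f \<in> borel_measurable lebesgue"
proof (rule measurableI)
  fix A :: "real set" assume A: "A \<in> sets borel"
  show "f -` A \<inter> space lebesgue \<in> sets lebesgue"
  proof (rule completion.in_sets_AE)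
    show "AE x in lebesgue. (x \<in> g -` A \<inter> space lebesgue) = (x \<in> f -` A \<inter> space lebesgue)"
      using ae by eventually_elim auto
    show "g -` A \<inter> space lebesgue \<in> sets lebesgue" using measurable_sets[OF g A] .
  qed simp
qed simp

lemma AE_lebesgue_on: "S \<in> sets lebesgue \<Longrightarrow> (AE z in lebesgue_on S. P z) \<longleftrightarrow> (AE z in lborel. z \<in> S \<longrightarrow> P z)"
  by (subst AE_restrict_space_iff) (auto simp: AE_completion_iff)

lemma AE_Tmeas: "(AE x in Tmeas. P x) \<longleftrightarrow> (AE x in mu. P x)"
  by (subst AE_lebesgue_on) (auto simp: AE_iv)

lemma integral_lebesgue_on_cong_borel:
  fixes f h :: "'a::euclidean_space \<Rightarrow> real"
  assumes S: "S \<in> sets lebesgue" and [measurable]: "h \<in> borel_measurable borel"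
    and ae: "AE z in lborel. indicator S z * f z = h z"
  shows "(LINT z|lebesgue_on S. f z) = (LINT z|lborel. h z)"
    and "integrable (lebesgue_on S) f \<longleftrightarrow> integrable lborel h"
proof -
  have ae': "AE z in lebesgue. indicator S z * f z = h z" using ae by (rule AE_completion)
  have h: "h \<in> borel_measurable lebesgue" by (simp add: measurable_completion)
  have m: "(\<lambda>z. indicator S z * f z) \<in> borel_measurable lebesgue"
    by (rule lebesgue_measurable_cong_AE[OF h ae'])
  have "(LINT z|lebesgue_on S. f z) = (LINT z|lebesgue. indicator S z * f z)"
    using S by (subst integral_restrict_space) auto
  also have "\<dots> = (LINT z|lebesgue. h z)" by (rule integral_cong_AE[OF m h ae'])
  also have "\<dots> = (LINT z|lborel. h z)" by (rule integral_completion) simp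
  finally show "(LINT z|lebesgue_on S. f z) = (LINT z|lborel. h z)" .
  have "integrable (lebesgue_on S) f \<longleftrightarrow> integrable lebesgue (\<lambda>z. indicator S z * f z)"
    using S by (subst integrable_restrict_space) auto
  also have "\<dots> \<longleftrightarrow> integrable lebesgue h" by (rule integrable_cong_AE[OF m h ae'])
  also have "\<dots> \<longleftrightarrow> integrable lborel h" by (rule integrable_completion) simp
  finally show "integrable (lebesgue_on S) f \<longleftrightarrow> integrable lborel h" .
qed

lemma Tmeas_mu:
  fixes f g :: "real \<Rightarrow> real"
  assumes [measurable]: "g \<in> borel_measurable borel" and ae: "AE x in mu. f x = g x"
  shows "(LINT x|Tmeas. f x) = (LINT x|mu. g x)" "integrable Tmeas f \<longleftrightarrow> integrable mu g"
proof -
  have ae': "AE x in lborel. indicator {0..1} x * f x = indicator {0..1} x * g x"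
    using ae unfolding AE_iv by eventually_elim (auto simp: indicator_def)
  have h: "(\<lambda>x. indicator {0..1} x * g x) \<in> borel_measurable borel" by measurable
  show "(LINT x|Tmeas. f x) = (LINT x|mu. g x)"
    using integral_lebesgue_on_cong_borel(1)[OF _ h ae'] by (simp add: integral_iv)
  show "integrable Tmeas f \<longleftrightarrow> integrable mu g"
    using integral_lebesgue_on_cong_borel(2)[OF _ h ae'] unfolding iv_def by (subst integrable_density) auto
qed

lemma lebesgue_on_borel_version:
  fixes f :: "'a::euclidean_space \<Rightarrow> real"
  assumes S: "S \<in> sets lebesgue" and f: "f \<in> borel_measurable (lebesgue_on S)"
  obtains g where "g \<in> borel_measurable borel" "AE z in lborel. z \<in> S \<longrightarrow> f z = g z"
proof -
  have "(\<lambda>z. indicator S z *\<^sub>R f z) \<in> borel_measurable lebesgue"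
    using f S by (subst (asm) borel_measurable_restrict_space_iff) auto
  from completion_ex_borel_measurable_real[OF this] obtain g where
    g: "g \<in> borel_measurable lborel" "AE z in lborel. indicator S z *\<^sub>R f z = g z" by blast
  from g(2) have "AE z in lborel. z \<in> S \<longrightarrow> f z = g z" by eventually_elim auto
  with g(1) that show thesis by simp
qed

lemma Tmeas_borel_version:
  fixes f :: "real \<Rightarrow> real"
  assumes "f \<in> borel_measurable Tmeas"
  obtains g where "g \<in> borel_measurable borel" "AE x in mu. f x = g x"
  using lebesgue_on_borel_version[OF _ assms] by (auto simp: AE_iv)

lemma AE_strip_sections:
  fixes P :: "real \<times> real \<Rightarrow> bool"
  assumes "AE z in lborel. z \<in> {0..<T} \<times> {0..1} \<longrightarrow> P z" "R < T"
  shows "AE t in iv 0 R. AE x in mu. P (t, x)"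
proof -
  have "AE z in lborel \<Otimes>\<^sub>M lborel. z \<in> {0..<T} \<times> {0..1} \<longrightarrow> P z" unfolding lborel_prod by (rule assms(1))
  from lborel_pair.AE_pair[OF this]
  have "AE t in lborel. AE x in lborel. (t, x) \<in> {0..<T} \<times> {0..1} \<longrightarrow> P (t, x)" .
  then show ?thesis unfolding AE_iv
  proof eventually_elim
    case (elim t)
    show ?case
    proof
      assume "0 \<le> t \<and> t \<le> R"
      with elim assms show "AE x in lborel. 0 \<le> x \<and> x \<le> 1 \<longrightarrow> P (t, x)"
        by (auto elim!: eventually_mono)
    qed
  qed
qed

text \<open>The weak form integrates over an unbounded strip, while a bounded Borel version is
  available only before time \<open>T\<close>. Both integrands vanish from \<open>R < T\<close> on,
  so an iterated Borel integral over \<open>{0..R}\<close> captures everything.\<close>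

lemma integral_strip:
  fixes g :: "real \<times> real \<Rightarrow> real" and h :: "real \<Rightarrow> real \<Rightarrow> real"
  assumes hm: "case_prod h \<in> borel_measurable (borel \<Otimes>\<^sub>M borel)" and K: "\<And>t x. \<bar>h t x\<bar> \<le> K"
    and ae: "AE z in lborel. z \<in> {0..<T} \<times> {0..1} \<longrightarrow> g z = h (fst z) (snd z)"
    and g0: "\<And>z. R \<le> fst z \<Longrightarrow> g z = 0" and h0: "\<And>t x. R \<le> t \<Longrightarrow> h t x = 0" and R: "R < T"
  shows "(LINT z|lebesgue_on ({0..} \<times> {0..1}). g z) = (LINT t|iv 0 R. LINT x|mu. h t x)"
proof -
  define k where "k z = indicator ({0..R} \<times> {0..1}) z * case_prod h z" for z
  have hm': "case_prod h \<in> borel_measurable borel" using hm by (simp add: borel_prod)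
  have S: "{0..} \<times> {0..1} \<in> sets (borel :: (real \<times> real) measure)" "{0..R} \<times> {0..1} \<in> sets (borel :: (real \<times> real) measure)"
    by (auto intro: borel_closed closed_Times)
  have km: "k \<in> borel_measurable borel" unfolding k_def[abs_def] using hm' S by measurable
  have aek: "AE z in lborel. indicator ({0..} \<times> {0..1}) z * g z = k z"
    using ae
  proof eventually_elim
    case (elim z)
    show ?case
    proof (cases "fst z < R")
      case True
      then show ?thesis using elim R by (auto simp: k_def indicator_def case_prod_unfold mem_Times_iff)
    next
      case False
      then show ?thesis using g0[of z] h0[of "fst z" "snd z"] by (auto simp: k_def case_prod_unfold)
    qed
  qed
  have "(LINT z|lebesgue_on ({0..} \<times> {0..1}). g z) = (LINT z|lborel. k z)"
    by (rule integral_lebesgue_on_cong_borel(1)[OF _ km aek]) (use S in auto)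
  also have "\<dots> = (LINT z|(lborel \<Otimes>\<^sub>M lborel). k z)" by (simp add: lborel_prod)
  also have "\<dots> = (LINT t|lborel. LINT x|lborel. k (t, x))"
  proof (rule lborel_pair.integral_fst'[symmetric])
    show "integrable (lborel \<Otimes>\<^sub>M lborel) k"
      unfolding lborel_prod
    proof (rule integrableI_bounded_set[where A="{0..R} \<times> {0..1}" and B=K])
      show "emeasure lborel ({0..R} \<times> {0..1::real}) < \<infinity>"
        by (intro emeasure_compact_finite compact_Times) auto
      show "AE x in lborel. x \<in> {0..R} \<times> {0..1} \<longrightarrow> norm (k x) \<le> K"
        using K by (auto simp: k_def)
    qed (use S km in \<open>auto simp: k_def\<close>)
  qed
  also have "\<dots> = (LINT t|lborel. indicator {0..R} t * (LINT x|mu. h t x))"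
  proof (rule Bochner_Integration.integral_cong[OF refl])
    fix t :: real
    have "(LINT x|lborel. k (t, x)) = (LINT x|lborel. indicator {0..R} t * (indicator {0..1} x * h t x))"
      by (rule Bochner_Integration.integral_cong) (auto simp: k_def indicator_def)
    also have "\<dots> = indicator {0..R} t * (LINT x|mu. h t x)"
      by (simp add: integral_iv measurable_section2[OF hm])
    finally show "(LINT x|lborel. k (t, x)) = indicator {0..R} t * (LINT x|mu. h t x)" .
  qed
  also have "\<dots> = (LINT t|iv 0 R. LINT x|mu. h t x)"
    by (rule integral_iv[symmetric], rule measurable_integral_iv[OF hm])
  finally show ?thesis .
qed

section \<open>Bumps separate integrable functions\<close>

lemma flat_tendsto:
  "(\<lambda>n. flat 0 (1 / real (Suc n)) s) \<longlonglongrightarrow> indicator {0<..} s"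
proof (cases "0 < s")
  case True
  have "(\<lambda>n. exp (- (1 / real (Suc n)) / s)) \<longlonglongrightarrow> exp (- 0 / s)"
    by (intro tendsto_intros LIMSEQ_inverse_real_of_nat[unfolded inverse_eq_divide]) (use True in auto)
  then show ?thesis using True by (simp add: flat_def)
qed (simp add: flat_def)

lemma bump_tendsto: "(\<lambda>n. bump (1 / real (Suc n)) y s x) \<longlonglongrightarrow> indicator {s<..} (cos (2 * pi * (x - y)))"
  using flat_tendsto[of "cos (2 * pi * (x - y)) - s"] by (simp add: bump_def indicator_def)

text \<open>Bumps converge to indicators of arcs, and every half line cuts \<open>[0, 1]\<close> in
  an arc, up to a null set. The half lines in turn determine the finite measures with the positive
  and the negative part of \<open>g\<close> as densities.\<close>

lemma AE_zero_if_bumps_zero: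
  fixes g :: "real \<Rightarrow> real"
  assumes g: "integrable mu g" and z: "\<And>e y s. 0 < e \<Longrightarrow> (LINT x|mu. g x * bump e y s x) = 0"
  shows "AE x in mu. g x = 0"
proof -
  have [measurable]: "g \<in> borel_measurable borel" using borel_measurable_integrable[OF g] by simp
  have arc: "(LINT x|mu. g x * indicator {s<..} (cos (2 * pi * (x - y)))) = 0" for y s
  proof -
    have "(\<lambda>n. LINT x|mu. g x * bump (1 / real (Suc n)) y s x) \<longlonglongrightarrow> (LINT x|mu. g x * indicator {s<..} (cos (2 * pi * (x - y))))"
    proof (rule integral_dominated_convergence[where w="\<lambda>x. \<bar>g x\<bar>"])
      show "AE x in mu. (\<lambda>n. g x * bump (1 / real (Suc n)) y s x) \<longlonglongrightarrow> g x * indicator {s<..} (cos (2 * pi * (x - y)))"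
        by (intro AE_I2 tendsto_intros bump_tendsto)
      have "\<bar>bump (1 / real (Suc n)) y s x\<bar> \<le> 1" for n x using bump_bounds[of "1 / real (Suc n)" y s x] by simp
      then show "AE x in mu. norm (g x * bump (1 / real (Suc n)) y s x) \<le> \<bar>g x\<bar>" for n
        by (auto simp: abs_mult intro!: mult_left_le)
      show "(\<lambda>x. g x * bump (1 / real (Suc n)) y s x) \<in> borel_measurable mu" for n
      proof -
        note [measurable] = bump_measurable[of "1 / real (Suc n)" y s]
        show ?thesis by measurable
      qed
    qed (use g in auto)
    moreover have "(LINT x|mu. g x * bump (1 / real (Suc n)) y s x) = 0" for n by (rule z) simp
    ultimately show ?thesis by (simp add: LIMSEQ_const_iff)
  qed
  have tail: "(LINT x|mu. g x * indicator {p<..} x) = 0" for p :: real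
  proof -
    consider "p \<le> 0" | "1 \<le> p" | "0 < p" "p < 1" by linarith
    then show ?thesis
    proof cases
      case 1
      \<comment> \<open>The height -2 lies below every value of the cosine, so the arc is the whole
        circle.\<close>
      have "(LINT x|mu. g x * indicator {p<..} x) = (LINT x|mu. g x * indicator {-2<..} (cos (2 * pi * (x - 0))))"
      proof (rule integral_cong_AE)
        have c2: "-2 < cos x" for x :: real using cos_ge_minus_one[of x] by linarith
        show "AE x in mu. g x * indicator {p<..} x = g x * indicator {-2<..} (cos (2 * pi * (x - 0)))"
          unfolding AE_iv using AE_lborel_singleton[of 0] by eventually_elim (use 1 c2 in \<open>auto simp: indicator_def\<close>)
      qed measurable
      then show ?thesis unfolding arc .
    next
      case 2
      then have "AE x in mu. g x * indicator {p<..} x = 0" by (intro AE_ivI) auto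
      then show ?thesis by (rule integral_eq_zero_AE)
    next
      case 3
      \<comment> \<open>Midpoint and half length of \<open>(p, 1)\<close>: a point lies in this arc
        exactly if its circle distance to \<open>y\<close> is below \<open>r\<close>, that is, if
        its cosine exceeds \<open>cos (2 * pi * r)\<close>.\<close>
      define y r where "y = (1 + p) / 2" and "r = (1 - p) / 2"
      have yr: "y = 1 - r" "0 < r" "r < 1/2" "p = 1 - 2 * r" using 3 by (auto simp: y_def r_def field_simps)
      have in_arc: "cos (2 * pi * r) < cos (2 * pi * (x - y))" if "p < x" "x < 1" for x
      proof -
        have ax: "\<bar>x - y\<bar> < r" using that yr by auto
        have "cos (2 * pi * r) < cos (2 * pi * \<bar>x - y\<bar>)"
          by (rule cos_monotone_0_pi) (use ax yr in \<open>auto simp: mult_less_cancel_left_pos\<close>)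
        also have "cos (2 * pi * \<bar>x - y\<bar>) = cos \<bar>2 * pi * (x - y)\<bar>" by (simp add: abs_mult)
        also have "\<dots> = cos (2 * pi * (x - y))" by (rule cos_abs_real)
        finally show ?thesis .
      qed
      have out_arc: "cos (2 * pi * (x - y)) \<le> cos (2 * pi * r)" if "0 \<le> x" "x \<le> p" for x
      proof -
        define d where "d = y - x"
        have d: "r \<le> d" "d \<le> 1 - r" using that yr by (auto simp: d_def)
        have "- (2 * pi * (x - y)) = 2 * pi * d" by (simp add: d_def algebra_simps)
        then have "cos (2 * pi * (x - y)) = cos (2 * pi * d)" by (metis cos_minus)
        also have "\<dots> \<le> cos (2 * pi * r)"
        proof (cases "d \<le> 1/2")
          case True
          then show ?thesis using d yr by (intro cos_monotone_0_pi_le) (auto simp: mult_left_mono)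
        next
          case False
          \<comment> \<open>Beyond half a turn the distance is measured the other way round, because
            the cosine decreases only on \<open>[0, pi]\<close>.\<close>
          have "cos (2 * pi * d) = cos (2 * pi * (1 - d))" by (simp add: right_diff_distrib cos_diff)
          also have "\<dots> \<le> cos (2 * pi * r)" using False d yr by (intro cos_monotone_0_pi_le) (auto simp: mult_left_mono)
          finally show ?thesis .
        qed
        finally show ?thesis .
      qed
      have "(LINT x|mu. g x * indicator {p<..} x) = (LINT x|mu. g x * indicator {cos (2 * pi * r)<..} (cos (2 * pi * (x - y))))"
      proof (rule integral_cong_AE)
        show "AE x in mu. g x * indicator {p<..} x = g x * indicator {cos (2 * pi * r)<..} (cos (2 * pi * (x - y)))"
          unfolding AE_iv using AE_lborel_singleton[of 1]
        proof eventually_elim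
          case (elim x)
          show ?case
          proof
            assume "0 \<le> x \<and> x \<le> 1"
            then show "g x * indicator {p<..} x = g x * indicator {cos (2 * pi * r)<..} (cos (2 * pi * (x - y)))"
              using in_arc[of x] out_arc[of x] elim by (cases "p < x") auto
          qed
        qed
      qed measurable
      then show ?thesis unfolding arc .
    qed
  qed
  \<comment> \<open>\<open>ennreal\<close> truncates negative values to 0, so these densities are
    the positive and the negative part of \<open>g\<close>.\<close>
  define P N where "P = density mu (\<lambda>x. ennreal (g x))" and "N = density mu (\<lambda>x. ennreal (- g x))"
  have fin: "(\<integral>\<^sup>+ x. ennreal (g x * indicator {p<..} x) \<partial>mu) < \<infinity>" "(\<integral>\<^sup>+ x. ennreal (- (g x * indicator {p<..} x)) \<partial>mu) < \<infinity>" for p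
  proof -
    have "integrable mu (\<lambda>x. g x * indicator {p<..} x)" using g by (intro integrable_real_mult_indicator) auto
    then show "(\<integral>\<^sup>+ x. ennreal (g x * indicator {p<..} x) \<partial>mu) < \<infinity>" "(\<integral>\<^sup>+ x. ennreal (- (g x * indicator {p<..} x)) \<partial>mu) < \<infinity>"
      unfolding real_integrable_def by (auto simp: less_top)
  qed
  have em: "emeasure P {p<..} = (\<integral>\<^sup>+ x. ennreal (g x * indicator {p<..} x) \<partial>mu)" 
    "emeasure N {p<..} = (\<integral>\<^sup>+ x. ennreal (- (g x * indicator {p<..} x)) \<partial>mu)" for p
    unfolding P_def N_def by (auto simp: emeasure_density intro!: nn_integral_cong split: split_indicator)
  have "P = N"
  proof (rule measure_eqI_lessThan)
    show "sets P = sets borel" "sets N = sets borel" by (simp_all add: P_def N_def)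
    fix p :: real
    show "emeasure P {p<..} < \<infinity>" using fin(1)[of p] by (simp add: em)
    have "integrable mu (\<lambda>x. g x * indicator {p<..} x)" using g by (intro integrable_real_mult_indicator) auto
    from real_lebesgue_integral_def[OF this] tail[of p]
    have "enn2real (emeasure P {p<..}) = enn2real (emeasure N {p<..})" unfolding em by simp
    then show "emeasure P {p<..} = emeasure N {p<..}"
      using fin[of p] unfolding em by (metis ennreal_enn2real infinity_ennreal_def)
  qed
  have "AE x in mu. ennreal (g x) = ennreal (- g x)"
  proof (rule finite_measure.density_unique_finite_measure)
    fix A assume A: "A \<in> sets mu"
    show "(\<integral>\<^sup>+ x. ennreal (g x) * indicator A x \<partial>mu) = (\<integral>\<^sup>+ x. ennreal (- g x) * indicator A x \<partial>mu)"
      using arg_cong[OF \<open>P = N\<close>, of "\<lambda>M. emeasure M A"] A unfolding P_def N_def by (simp add: emeasure_density)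
  qed auto
  then show ?thesis
  proof eventually_elim
    case (elim x)
    show ?case
    proof (cases "0 \<le> g x")
      case True
      then have "ennreal (- g x) = 0" by (simp add: ennreal_neg)
      then have "ennreal (g x) = 0" using elim by simp
      then show ?thesis using True by (simp only: ennreal_eq_0_iff)
    next
      case False
      then have "ennreal (g x) = 0" by (simp add: ennreal_neg)
      then have "ennreal (- g x) = 0" using elim by simp
      then show ?thesis using False by (simp add: ennreal_eq_0_iff)
    qed
  qed
qed

section \<open>Weak solutions are mild\<close>

lemma flat_measurable [measurable]: "0 < d \<Longrightarrow> flat j d \<in> borel_measurable borel"
  by (intro borel_measurable_continuous_onI flat_continuous)

text \<open>The kernel is the time derivative of \<open>- flat 0 d (R - t)\<close>. Its mass on
  \<open>{r..R}\<close> is therefore at most 1 and tends to 1 for every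
  \<open>r < R\<close>.\<close>

lemma flat_kernel_mass:
  assumes "0 < d" "r \<le> R"
  shows "(LINT t|iv r R. d * flat 2 d (R - t)) = flat 0 d (R - r)"
proof -
  note [measurable] = flat_measurable[OF assms(1)]
  have "(LINT t|iv r R. d * flat 2 d (R - t)) = (LINT t|lborel. indicator {r..R} t *\<^sub>R (d * flat 2 d (R - t)))"
    by (subst integral_iv) auto
  also have "\<dots> = - flat 0 d (R - R) - - flat 0 d (R - r)"
  proof (rule integral_FTC_atLeastAtMost)
    show "((\<lambda>t. - flat 0 d (R - t)) has_vector_derivative d * flat 2 d (R - t)) (at t within {r..R})" for t
    proof -
      have "((\<lambda>t. R - t) has_real_derivative -1) (at t)" by (auto intro!: derivative_eq_intros)
      from DERIV_chain2[OF _ this, of "flat 0 d"] flat_deriv[OF assms(1), of 0 "R - t"]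
      have "((\<lambda>t. flat 0 d (R - t)) has_real_derivative - (d * flat 2 d (R - t))) (at t)"
        by (simp add: numeral_2_eq_2)
      from DERIV_minus[OF this] show ?thesis
        by (auto simp: has_real_derivative_iff_has_vector_derivative[symmetric] intro: DERIV_subset)
    qed
    show "continuous_on {r..R} (\<lambda>t. d * flat 2 d (R - t))"
      by (intro continuous_intros continuous_on_compose2[OF flat_continuous[OF assms(1)]]) auto
  qed (use assms in auto)
  finally show ?thesis by (simp add: flat_def)
qed

text \<open>The kernels \<open>d * flat 2 d (R - t)\<close> concentrate at \<open>t = R\<close> as \<open>d\<close> tends to 0,
  which turns the weak formulation into its integrated form at time \<open>R\<close>.\<close>

lemma flat_kernel_limit:
  fixes a b :: "real \<Rightarrow> real"
  assumes [measurable]: "a \<in> borel_measurable borel" "b \<in> borel_measurable borel"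
    and C: "\<And>t. \<bar>a t\<bar> \<le> C" and K: "\<And>t. \<bar>b t\<bar> \<le> K" and R: "0 < R"
    and cont: "\<And>e. 0 < e \<Longrightarrow> \<exists>r. 0 \<le> r \<and> r < R \<and> (AE t in iv r R. \<bar>a t - \<alpha>\<bar> \<le> e)"
    and eq: "\<And>d. 0 < d \<Longrightarrow> - (LINT t|iv 0 R. d * flat 2 d (R - t) * a t) + flat 0 d R * \<beta> + (LINT t|iv 0 R. flat 0 d (R - t) * b t) = 0"
  shows "\<alpha> = \<beta> + (LINT t|iv 0 R. b t)"
proof -
  define D where "D n = 1 / real (Suc n)" for n
  have D: "0 < D n" for n by (simp add: D_def)
  have D0: "D \<longlonglongrightarrow> 0" unfolding D_def using LIMSEQ_inverse_real_of_nat by (simp add: inverse_eq_divide)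
  have C0: "0 \<le> C" using order_trans[OF abs_ge_zero C] .
  have lim: "(\<lambda>n. flat 0 (D n) R * (\<beta> - \<alpha>) + (LINT t|iv 0 R. flat 0 (D n) (R - t) * b t)) \<longlonglongrightarrow> 1 * (\<beta> - \<alpha>) + (LINT t|iv 0 R. b t)"
  proof (intro tendsto_intros)
    show "(\<lambda>n. flat 0 (D n) R) \<longlonglongrightarrow> 1" using flat_tendsto[of R] R by (simp add: D_def)
    show "(\<lambda>n. LINT t|iv 0 R. flat 0 (D n) (R - t) * b t) \<longlonglongrightarrow> (LINT t|iv 0 R. b t)"
    proof (rule integral_dominated_convergence[where w="\<lambda>_. K"])
      show "AE t in iv 0 R. (\<lambda>n. flat 0 (D n) (R - t) * b t) \<longlonglongrightarrow> b t"
        unfolding AE_iv using AE_lborel_singleton[of R]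
      proof eventually_elim
        case (elim t)
        show ?case
        proof
          assume "0 \<le> t \<and> t \<le> R"
          then have "(\<lambda>n. flat 0 (D n) (R - t)) \<longlonglongrightarrow> 1" using flat_tendsto[of "R - t"] elim by (simp add: D_def)
          from tendsto_mult_right[OF this, of "b t"] show "(\<lambda>n. flat 0 (D n) (R - t) * b t) \<longlonglongrightarrow> b t" by simp
        qed
      qed
      show "AE t in iv 0 R. norm (flat 0 (D n) (R - t) * b t) \<le> K" for n
      proof (rule AE_I2)
        fix t
        have "\<bar>flat 0 (D n) (R - t)\<bar> * \<bar>b t\<bar> \<le> 1 * K"
          using flat_nonneg[of 0 "D n" "R - t"] flat_le_one[of "D n" "R - t"] D[of n] K by (intro mult_mono) auto
        then show "norm (flat 0 (D n) (R - t) * b t) \<le> K" by (simp add: abs_mult)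
      qed
      show "(\<lambda>t. flat 0 (D n) (R - t) * b t) \<in> borel_measurable (iv 0 R)" for n
      proof -
        note [measurable] = flat_measurable[OF D[of n]]
        show ?thesis by measurable
      qed
      show "integrable (iv 0 R) (\<lambda>_. K)" by (rule integrable_iv[where K="\<bar>K\<bar>"]) auto
    qed simp
  qed
  have small: "\<bar>1 * (\<beta> - \<alpha>) + (LINT t|iv 0 R. b t)\<bar> \<le> e" if e: "0 < e" for e
  proof -
    obtain r where r: "0 \<le> r" "r < R" and ar: "AE t in iv r R. \<bar>a t - \<alpha>\<bar> \<le> e" using cont[OF e] by blast
    \<comment> \<open>Up to time \<open>r\<close> the kernel is at most \<open>d\<close> divided by
      the square of \<open>R - r\<close>, so this part contributes \<open>d * Q\<close> and
      disappears with \<open>d\<close>.\<close>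
    define Q where "Q = (C + \<bar>\<alpha>\<bar>) / (R - r)\<^sup>2 * r"
    have bound: "\<bar>flat 0 (D n) R * (\<beta> - \<alpha>) + (LINT t|iv 0 R. flat 0 (D n) (R - t) * b t)\<bar> \<le> D n * Q + e" for n
    proof -
      define d where "d = D n"
      have d: "0 < d" using D by (simp add: d_def)
      note [measurable] = flat_measurable[OF d]
      have k2: "\<bar>d * flat 2 d (R - t)\<bar> \<le> d * (real 2 / d)\<^sup>2" for t
        using d flat_nonneg[of 2 d "R - t"] flat_le[of d 2 "R - t"] by (simp add: abs_mult)
      have ka: "\<bar>d * flat 2 d (R - t) * (a t - \<alpha>)\<bar> \<le> d * (real 2 / d)\<^sup>2 * (C + \<bar>\<alpha>\<bar>)" for t
        unfolding abs_mult[of "d * flat 2 d (R - t)"] using k2[of t] C[of t] d by (intro mult_mono) auto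
      have I1: "integrable (iv p q) (\<lambda>t. d * flat 2 d (R - t) * a t)" for p q
        by (rule integrable_iv[where K="d * (real 2 / d)\<^sup>2 * C"])
           (use k2 C d in \<open>auto simp: abs_mult[of "d * flat 2 d _"] intro!: mult_mono\<close>)
      have I2: "integrable (iv p q) (\<lambda>t. d * flat 2 d (R - t))" for p q
        by (rule integrable_iv[where K="d * (real 2 / d)\<^sup>2"]) (use k2 in auto)
      have I3: "integrable (iv p q) (\<lambda>t. d * flat 2 d (R - t) * (a t - \<alpha>))" for p q
        by (rule integrable_iv[where K="d * (real 2 / d)\<^sup>2 * (C + \<bar>\<alpha>\<bar>)"]) (use ka in auto)
      \<comment> \<open>The mass of the kernel on \<open>{0..R}\<close> is exactly
        \<open>flat 0 d R\<close>, so \<alpha> can be subtracted under the integral and only the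
        deviation of \<open>a\<close> from \<alpha> remains.\<close>
      have "flat 0 d R * (\<beta> - \<alpha>) + (LINT t|iv 0 R. flat 0 d (R - t) * b t)
        = (LINT t|iv 0 R. d * flat 2 d (R - t) * a t) - (LINT t|iv 0 R. d * flat 2 d (R - t)) * \<alpha>"
        using eq[OF d] flat_kernel_mass[OF d, of 0 R] R by (simp add: algebra_simps)
      also have "\<dots> = (LINT t|iv 0 R. d * flat 2 d (R - t) * (a t - \<alpha>))"
        unfolding right_diff_distrib using I1 I2 by (subst Bochner_Integration.integral_diff) auto
      also have "\<dots> = (LINT t|iv 0 r. d * flat 2 d (R - t) * (a t - \<alpha>)) + (LINT t|iv r R. d * flat 2 d (R - t) * (a t - \<alpha>))"
        by (rule integral_iv_combine[OF _ ka]) (use r in auto)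
      finally have split: "flat 0 d R * (\<beta> - \<alpha>) + (LINT t|iv 0 R. flat 0 d (R - t) * b t) = \<dots>" .
      have "\<bar>LINT t|iv 0 r. d * flat 2 d (R - t) * (a t - \<alpha>)\<bar> \<le> (d / (R - r)\<^sup>2 * (C + \<bar>\<alpha>\<bar>)) * (r - 0)"
      proof (rule integral_iv_bound)
        fix t assume t: "0 \<le> t" "t \<le> r"
        have "flat 2 d (R - t) = exp (- d / (R - t)) / (R - t)\<^sup>2" using t r by (simp add: flat_def)
        also have "\<dots> \<le> 1 / (R - r)\<^sup>2"
          using t r d by (intro frac_le power_mono) auto
        finally have "\<bar>d * flat 2 d (R - t)\<bar> \<le> d / (R - r)\<^sup>2"
          using d flat_nonneg[of 2 d "R - t"] mult_left_mono[of "flat 2 d (R - t)" "1 / (R - r)\<^sup>2" d] by (simp add: abs_mult)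
        then show "\<bar>d * flat 2 d (R - t) * (a t - \<alpha>)\<bar> \<le> d / (R - r)\<^sup>2 * (C + \<bar>\<alpha>\<bar>)"
          unfolding abs_mult[of "d * flat 2 d (R - t)"] using C[of t] d by (intro mult_mono) auto
      qed (use r C0 d in auto)
      moreover have "\<bar>LINT t|iv r R. d * flat 2 d (R - t) * (a t - \<alpha>)\<bar> \<le> e"
      proof -
        have "\<bar>LINT t|iv r R. d * flat 2 d (R - t) * (a t - \<alpha>)\<bar> \<le> (LINT t|iv r R. \<bar>d * flat 2 d (R - t) * (a t - \<alpha>)\<bar>)"
          by (rule integral_abs_bound)
        also have "\<dots> \<le> (LINT t|iv r R. d * flat 2 d (R - t) * e)"
        proof (rule integral_mono_AE)
          show "AE t in iv r R. \<bar>d * flat 2 d (R - t) * (a t - \<alpha>)\<bar> \<le> d * flat 2 d (R - t) * e"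
            using ar by eventually_elim (use d flat_nonneg[of 2 d] in \<open>auto simp: abs_mult intro!: mult_left_mono\<close>)
        qed (use I2 I3 in auto)
        also have "\<dots> = flat 0 d (R - r) * e" using flat_kernel_mass[OF d, of r R] r by simp
        also have "\<dots> \<le> 1 * e" using flat_le_one[of d "R - r"] d e by (intro mult_right_mono) auto
        finally show ?thesis by simp
      qed
      ultimately have "\<bar>flat 0 d R * (\<beta> - \<alpha>) + (LINT t|iv 0 R. flat 0 d (R - t) * b t)\<bar> \<le> (d / (R - r)\<^sup>2 * (C + \<bar>\<alpha>\<bar>)) * (r - 0) + e"
        unfolding split by linarith
      also have "\<dots> = d * Q + e" by (simp add: Q_def)
      finally show ?thesis by (simp add: d_def)
    qed
    have "(\<lambda>n. D n * Q + e) \<longlonglongrightarrow> 0 * Q + e" by (intro tendsto_intros D0)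
    from LIMSEQ_le[OF tendsto_rabs[OF lim] this] bound show ?thesis by auto
  qed
  have "\<bar>1 * (\<beta> - \<alpha>) + (LINT t|iv 0 R. b t)\<bar> \<le> 0"
    by (rule field_le_epsilon) (simp only: add_0 small)
  then show ?thesis by simp
qed

lemma sol_space_L1:
  assumes "sol_space w" "0 \<le> t"
  shows "w t \<in> borel_measurable Tmeas" "integrable Tmeas (w t)"
    "((\<lambda>s. LINT x|Tmeas. \<bar>w s x - w t x\<bar>) \<longlongrightarrow> 0) (at t within {0..})"
proof -
  have "\<forall>t\<ge>0. \<forall>p\<ge>1. w t \<in> borel_measurable Tmeas \<and> integrable Tmeas (\<lambda>x. \<bar>w t x\<bar> powr p)
     \<and> ((\<lambda>s. LINT x|Tmeas. \<bar>w s x - w t x\<bar> powr p) \<longlongrightarrow> 0) (at t within {0..})"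
    using assms(1) unfolding sol_space_def by blast
  from this[rule_format, OF assms(2), of 1]
  have *: "w t \<in> borel_measurable Tmeas" "integrable Tmeas (\<lambda>x. \<bar>w t x\<bar>)"
     "((\<lambda>s. LINT x|Tmeas. \<bar>w s x - w t x\<bar>) \<longlongrightarrow> 0) (at t within {0..})"
    by simp_all
  then show "w t \<in> borel_measurable Tmeas" "integrable Tmeas (w t)"
    "((\<lambda>s. LINT x|Tmeas. \<bar>w s x - w t x\<bar>) \<longlongrightarrow> 0) (at t within {0..})"
    by (simp_all add: integrable_abs_iff)
qed

text \<open>Testing with \<open>probe\<close> and letting the time cutoff sharpen at
  \<open>R\<close> gives the balance at time \<open>R\<close> against every bump in the
  characteristic label. In label coordinates the bump does not depend on time, so the balance says
  that the defect \<open>g\<close> integrates to 0 against all bumps.\<close>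

lemma weak_solution_is_mild:
  fixes w :: "real \<Rightarrow> real \<Rightarrow> real" and Fw :: "real \<times> real \<Rightarrow> real"
  assumes sol: "sol_space w"
    and W0_meas[measurable]: "W0 \<in> borel_measurable borel" and W0: "AE x in mu. w0 x = W0 x" and B0: "\<And>x. \<bar>W0 x\<bar> \<le> B"
    and wb_meas: "case_prod wb \<in> borel_measurable (borel \<Otimes>\<^sub>M borel)" and Bw: "\<And>t x. \<bar>wb t x\<bar> \<le> Bw"
    and wb: "AE z in lborel. z \<in> {0..<T} \<times> {0..1} \<longrightarrow> w (fst z) (snd z) = wb (fst z) (snd z)"
    and Fb_meas: "case_prod Fb \<in> borel_measurable (borel \<Otimes>\<^sub>M borel)" and K: "\<And>t x. \<bar>Fb t x\<bar> \<le> K"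
    and Fb: "AE z in lborel. z \<in> {0..<T} \<times> {0..1} \<longrightarrow> Fw z = Fb (fst z) (snd z)"
    and weak: "\<And>\<psi>. test_fun \<psi> \<Longrightarrow>
       (LINT z|lebesgue_on ({0..} \<times> {0..1}). w (fst z) (snd z) * (d_t \<psi> z + c * d_x \<psi> z))
       + (LINT x|Tmeas. \<psi> (0, x) * w0 x) + (LINT z|lebesgue_on ({0..} \<times> {0..1}). Fw z * \<psi> z) = 0"
    and R: "0 < R" "R < T"
  shows "AE x in mu. w R x = mild c Fb W0 R x"
proof -
  interpret tr: transport_data c K B Fb W0
    by unfold_locales (use Fb_meas W0_meas K B0 in auto)
  note [measurable (raw)] = measurable_comp2[OF wb_meas]
  note L1 = sol_space_L1(1,2)[OF sol] and wcont = sol_space_L1(3)[OF sol less_imp_le[OF R(1)]]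
  obtain wR where wR[measurable]: "wR \<in> borel_measurable borel" and wR_eq: "AE x in mu. w R x = wR x"
    using Tmeas_borel_version[OF L1(1)] R by (metis less_imp_le)
  have wR_int: "integrable mu wR" using Tmeas_mu(2)[OF wR wR_eq] L1(2)[of R] R by simp
  define g where "g y = wR (frac (y + c * R)) - transport c Fb W0 R y" for y
  have wRs_int: "integrable mu (\<lambda>y. wR (frac (y + c * R)))"
  proof -
    have "integrable (distr mu borel (\<lambda>x. frac (x + c * R))) wR" unfolding distr_frac_shift by (rule wR_int)
    then show ?thesis by (subst (asm) integrable_distr_eq) auto
  qed
  have tr_b: "bdd_borel (transport c Fb W0 R)"
    by (rule bdd_borelI[OF measurable_section2[OF tr.transport_measurable] tr.transport_bound[of R R]]) (use R in auto)
  have g_int: "integrable mu g"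
    unfolding g_def[abs_def] using wRs_int bdd_borel_integrable[OF tr_b] by simp
  have "(LINT x|mu. g x * bump e y s x) = 0" if e: "0 < e" for e y s
  proof -
    define \<eta> where "\<eta> = bump e y s"
    have [measurable]: "\<eta> \<in> borel_measurable borel" unfolding \<eta>_def by (rule bump_measurable[OF e])
    have \<eta>1: "\<bar>\<eta> x\<bar> \<le> 1" for x using bump_bounds[OF e, of y s x] by (simp add: \<eta>_def)
    have \<eta>f: "\<eta> (frac x) = \<eta> x" for x by (simp add: \<eta>_def bump_frac)
    \<comment> \<open>\<open>A\<close> uses the slices of \<open>w\<close> and inherits their
      continuity at \<open>R\<close>; \<open>a\<close> uses the Borel version and is measurable and
      bounded. They agree at almost every time, which suffices for the limit, and \<open>A\<close>
      supplies the value at \<open>R\<close> itself.\<close>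
    define A where "A t = (LINT x|Tmeas. w t x * \<eta> (x - c * t))" for t
    define a where "a t = (LINT x|mu. wb t x * \<eta> (x - c * t))" for t
    define b where "b t = (LINT x|mu. Fb t x * \<eta> (x - c * t))" for t
    have am: "a \<in> borel_measurable borel" and bm: "b \<in> borel_measurable borel"
      unfolding a_def[abs_def] b_def[abs_def] by (rule measurable_integral_iv, measurable)+
    have Bw0: "0 \<le> Bw" "0 \<le> K" using order_trans[OF abs_ge_zero Bw] order_trans[OF abs_ge_zero K] by auto
    have wb\<eta>: "\<bar>wb t x * \<eta> z\<bar> \<le> Bw * 1" and Fb\<eta>: "\<bar>Fb t x * \<eta> z\<bar> \<le> K * 1" for t x z
      unfolding abs_mult using Bw[of t x] K[of t x] \<eta>1[of z] Bw0 by (auto intro!: mult_mono simp del: mult_1_right)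
    have ab: "\<bar>a t\<bar> \<le> Bw" and bb: "\<bar>b t\<bar> \<le> K" for t
      unfolding a_def b_def 
      using integral_iv_bound[of 0 1 "\<lambda>x. wb t x * \<eta> (x - c * t)" Bw] integral_iv_bound[of 0 1 "\<lambda>x. Fb t x * \<eta> (x - c * t)" K] wb\<eta> Fb\<eta> Bw0
      by auto
    have aA: "AE t in iv 0 R. a t = A t"
      using AE_strip_sections[OF wb R(2)]
    proof eventually_elim
      case (elim t)
      then have "AE x in mu. w t x * \<eta> (x - c * t) = wb t x * \<eta> (x - c * t)" by (auto elim!: eventually_mono)
      from Tmeas_mu(1)[OF _ this] show ?case unfolding A_def a_def by simp
    qed
    have A_int: "integrable Tmeas (\<lambda>x. w t x * \<eta> (x - z))" if "0 \<le> t" for t z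
    proof (rule Bochner_Integration.integrable_bound[OF L1(2)[OF that]])
      show "(\<lambda>x. w t x * \<eta> (x - z)) \<in> borel_measurable Tmeas"
      proof -
        have "(\<lambda>x. \<eta> (x - z)) \<in> borel_measurable borel" by measurable
        then have "(\<lambda>x. \<eta> (x - z)) \<in> borel_measurable Tmeas"
          by (intro measurable_restrict_space1 measurable_completion) simp
        then show ?thesis using L1(1)[OF that] by measurable
      qed
      show "AE x in Tmeas. norm (w t x * \<eta> (x - z)) \<le> norm (w t x)"
        using \<eta>1 by (auto simp: abs_mult intro!: mult_left_le)
    qed
    define N where "N = (LINT x|Tmeas. \<bar>w R x\<bar>)"
    define Le where "Le = 8 * pi / e"
    have A_cont: "\<bar>A t - A R\<bar> \<le> (LINT x|Tmeas. \<bar>w t x - w R x\<bar>) + Le * (\<bar>c\<bar> * \<bar>t - R\<bar>) * N" if t: "0 \<le> t" for t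
    proof -
      have R0: "0 \<le> R" using R by simp
      have "A t - A R = (LINT x|Tmeas. w t x * \<eta> (x - c * t) - w R x * \<eta> (x - c * R))"
        unfolding A_def by (rule Bochner_Integration.integral_diff[symmetric]; rule A_int; fact)
      then have "\<bar>A t - A R\<bar> \<le> (LINT x|Tmeas. \<bar>w t x * \<eta> (x - c * t) - w R x * \<eta> (x - c * R)\<bar>)"
        by (simp only: integral_abs_bound)
      also have "\<dots> \<le> (LINT x|Tmeas. \<bar>w t x - w R x\<bar> + Le * (\<bar>c\<bar> * \<bar>t - R\<bar>) * \<bar>w R x\<bar>)"
      proof (rule integral_mono)
        show "integrable Tmeas (\<lambda>x. \<bar>w t x * \<eta> (x - c * t) - w R x * \<eta> (x - c * R)\<bar>)"
          using A_int[OF t] A_int[OF R0] by auto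
        show "integrable Tmeas (\<lambda>x. \<bar>w t x - w R x\<bar> + Le * (\<bar>c\<bar> * \<bar>t - R\<bar>) * \<bar>w R x\<bar>)"
          using L1(2)[OF t] L1(2)[OF R0] by auto
        fix x
        have 1: "\<bar>(w t x - w R x) * \<eta> (x - c * t)\<bar> \<le> \<bar>w t x - w R x\<bar>" unfolding abs_mult using \<eta>1 by (intro mult_left_le) auto
        have "\<bar>\<eta> (x - c * t) - \<eta> (x - c * R)\<bar> \<le> Le * \<bar>(x - c * t) - (x - c * R)\<bar>"
          unfolding \<eta>_def Le_def by (rule bump_lipschitz[OF e])
        also have "\<bar>(x - c * t) - (x - c * R)\<bar> = \<bar>c\<bar> * \<bar>t - R\<bar>" by (simp add: abs_minus_commute flip: abs_mult right_diff_distrib)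
        finally have 2: "\<bar>w R x * (\<eta> (x - c * t) - \<eta> (x - c * R))\<bar> \<le> \<bar>w R x\<bar> * (Le * (\<bar>c\<bar> * \<bar>t - R\<bar>))"
          unfolding abs_mult[of "w R x"] by (rule mult_left_mono) simp
        have "w t x * \<eta> (x - c * t) - w R x * \<eta> (x - c * R) = (w t x - w R x) * \<eta> (x - c * t) + w R x * (\<eta> (x - c * t) - \<eta> (x - c * R))"
          by (simp add: algebra_simps)
        then have "\<bar>w t x * \<eta> (x - c * t) - w R x * \<eta> (x - c * R)\<bar> \<le> \<bar>(w t x - w R x) * \<eta> (x - c * t)\<bar> + \<bar>w R x * (\<eta> (x - c * t) - \<eta> (x - c * R))\<bar>"
          by (simp only: abs_triangle_ineq)
        also have "\<dots> \<le> \<bar>w t x - w R x\<bar> + \<bar>w R x\<bar> * (Le * (\<bar>c\<bar> * \<bar>t - R\<bar>))" by (rule add_mono[OF 1 2])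
        finally show "\<bar>w t x * \<eta> (x - c * t) - w R x * \<eta> (x - c * R)\<bar> \<le> \<bar>w t x - w R x\<bar> + Le * (\<bar>c\<bar> * \<bar>t - R\<bar>) * \<bar>w R x\<bar>"
          by (simp only: mult_ac)
      qed
      also have "\<dots> = (LINT x|Tmeas. \<bar>w t x - w R x\<bar>) + Le * (\<bar>c\<bar> * \<bar>t - R\<bar>) * N"
        unfolding N_def using L1(2)[OF t] L1(2)[OF R0] by (subst Bochner_Integration.integral_add) auto
      finally show ?thesis .
    qed
    have A_lim: "((\<lambda>t. (LINT x|Tmeas. \<bar>w t x - w R x\<bar>) + Le * (\<bar>c\<bar> * \<bar>t - R\<bar>) * N) \<longlongrightarrow> 0) (at R within {0..})"
      by (rule tendsto_eq_rhs[OF tendsto_add[OF wcont]]) (auto intro!: tendsto_eq_intros)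
    have cont: "\<exists>r. 0 \<le> r \<and> r < R \<and> (AE t in iv r R. \<bar>a t - A R\<bar> \<le> \<epsilon>)" if "0 < \<epsilon>" for \<epsilon>
    proof -
      from order_tendstoD(2)[OF A_lim that] obtain \<delta> where \<delta>: "0 < \<delta>"
        "\<And>t. 0 \<le> t \<Longrightarrow> t \<noteq> R \<Longrightarrow> \<bar>t - R\<bar> < \<delta> \<Longrightarrow> (LINT x|Tmeas. \<bar>w t x - w R x\<bar>) + Le * (\<bar>c\<bar> * \<bar>t - R\<bar>) * N < \<epsilon>"
        unfolding eventually_at by (auto simp: dist_real_def)
      define r where "r = max 0 (R - \<delta> / 2)"
      have r: "0 \<le> r" "r < R" using R \<delta>(1) by (auto simp: r_def)
      have "AE t in iv r R. a t = A t" using AE_iv_mono[OF aA r(1)] by simp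
      moreover have "AE t in iv r R. \<bar>A t - A R\<bar> \<le> \<epsilon>"
      proof (rule AE_ivI)
        fix t assume t: "r \<le> t" "t \<le> R"
        show "\<bar>A t - A R\<bar> \<le> \<epsilon>"
        proof (cases "t = R")
          case False
          then have "\<bar>t - R\<bar> < \<delta>" using t \<delta>(1) by (auto simp: r_def)
          then show ?thesis using \<delta>(2)[of t] A_cont[of t] t r False by force
        qed (use that in simp)
      qed
      ultimately have "AE t in iv r R. \<bar>a t - A R\<bar> \<le> \<epsilon>" by eventually_elim simp
      then show ?thesis using r by blast
    qed
    have "A R = (LINT x|mu. W0 x * \<eta> x) + (LINT t|iv 0 R. b t)"
    proof (rule flat_kernel_limit[OF am bm ab bb R(1) cont])
      fix d :: real assume d: "0 < d"
      note [measurable] = flat_measurable[OF d]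
      let ?\<psi> = "probe c R d e y s"
      have k2: "\<bar>- (d * flat 2 d q)\<bar> \<le> d * (real 2 / d)\<^sup>2" for q
        using d flat_nonneg[of 2 d q] flat_le[of d 2 q] by (simp add: abs_mult)
      have f1: "\<bar>flat 0 d q\<bar> \<le> 1" for q using flat_nonneg[of 0 d q] flat_le_one[of d q] d by simp
      have 1: "(LINT z|lebesgue_on ({0..} \<times> {0..1}). w (fst z) (snd z) * (d_t ?\<psi> z + c * d_x ?\<psi> z))
         = (LINT t|iv 0 R. LINT x|mu. - (d * flat 2 d (R - t)) * (wb t x * \<eta> (x - c * t)))"
      proof (rule integral_strip[where K="d * (real 2 / d)\<^sup>2 * (Bw * 1)" and T=T])
        show "\<bar>- (d * flat 2 d (R - t)) * (wb t x * \<eta> (x - c * t))\<bar> \<le> d * (real 2 / d)\<^sup>2 * (Bw * 1)" for t x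
          unfolding abs_mult[of "- (d * flat 2 d (R - t))"] using k2 wb\<eta> d by (intro mult_mono) auto
        have pt: "d_t ?\<psi> z + c * d_x ?\<psi> z = - (d * flat 2 d (R - fst z)) * \<eta> (snd z - c * fst z)" for z
          using probe_transport[OF d e, where t="fst z" and x="snd z"] by (simp add: \<eta>_def)
        show "AE z in lborel. z \<in> {0..<T} \<times> {0..1} \<longrightarrow> w (fst z) (snd z) * (d_t ?\<psi> z + c * d_x ?\<psi> z)
            = - (d * flat 2 d (R - fst z)) * (wb (fst z) (snd z) * \<eta> (snd z - c * fst z))"
          using wb by eventually_elim (simp add: pt)
        show "w (fst z) (snd z) * (d_t ?\<psi> z + c * d_x ?\<psi> z) = 0" if "R \<le> fst z" for z
          using that by (simp add: pt flat_def)
        show "- (d * flat 2 d (R - t)) * (wb t x * \<eta> (x - c * t)) = 0" if "R \<le> t" for t x using that by (simp add: flat_def)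
        show "R < T" by fact
      qed measurable
      have 2: "(LINT z|lebesgue_on ({0..} \<times> {0..1}). Fw z * ?\<psi> z) = (LINT t|iv 0 R. LINT x|mu. flat 0 d (R - t) * (Fb t x * \<eta> (x - c * t)))"
      proof (rule integral_strip[where K="1 * (K * 1)" and T=T])
        show "\<bar>flat 0 d (R - t) * (Fb t x * \<eta> (x - c * t))\<bar> \<le> 1 * (K * 1)" for t x
          unfolding abs_mult[of "flat 0 d (R - t)"] using f1 Fb\<eta> by (intro mult_mono) auto
        show "AE z in lborel. z \<in> {0..<T} \<times> {0..1} \<longrightarrow> Fw z * ?\<psi> z
            = flat 0 d (R - fst z) * (Fb (fst z) (snd z) * \<eta> (snd z - c * fst z))"
          using Fb by eventually_elim (simp add: probe_def \<eta>_def)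
        show "Fw z * ?\<psi> z = 0" if "R \<le> fst z" for z using that by (simp add: probe_def flat_def)
        show "flat 0 d (R - t) * (Fb t x * \<eta> (x - c * t)) = 0" if "R \<le> t" for t x using that by (simp add: flat_def)
        show "R < T" by fact
      qed measurable
      have 3: "(LINT x|Tmeas. ?\<psi> (0, x) * w0 x) = (LINT x|mu. flat 0 d R * (W0 x * \<eta> x))"
      proof (rule Tmeas_mu(1))
        show "AE x in mu. ?\<psi> (0, x) * w0 x = flat 0 d R * (W0 x * \<eta> x)"
          using W0 by eventually_elim (simp add: probe_def \<eta>_def)
      qed measurable
      show "- (LINT t|iv 0 R. d * flat 2 d (R - t) * a t) + flat 0 d R * (LINT x|mu. W0 x * \<eta> x) + (LINT t|iv 0 R. flat 0 d (R - t) * b t) = 0"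
        using weak[OF probe_test_fun[OF d e, of c R y s]] unfolding 1 2 3
        by (simp add: a_def b_def)
    qed
    moreover have "A R = (LINT y|mu. wR (frac (y + c * R)) * \<eta> y)"
    proof -
      have "A R = (LINT x|mu. wR x * \<eta> (x - c * R))"
        unfolding A_def by (rule Tmeas_mu(1)) (use wR_eq in \<open>auto elim!: eventually_mono\<close>)
      also have "\<dots> = (LINT x|mu. wR x * \<eta> (frac (x - c * R)))" by (simp add: \<eta>f)
      also have "\<dots> = (LINT y|mu. wR (frac (y + c * R)) * \<eta> y)"
        using integral_frac_shift_pair[of "\<lambda>y x. wR x * \<eta> y" "c * R"] by simp
      finally show ?thesis .
    qed
    \<comment> \<open>After the shift to labels the weight no longer depends on \<open>t\<close>, so
      Fubini produces the time integral along each characteristic.\<close>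
    moreover have "(LINT t|iv 0 R. b t) = (LINT y|mu. (LINT t|iv 0 R. Fb t (frac (y + c * t))) * \<eta> y)"
    proof -
      have "b t = (LINT y|mu. Fb t (frac (y + c * t)) * \<eta> y)" for t
      proof -
        have "b t = (LINT x|mu. Fb t x * \<eta> (frac (x - c * t)))" by (simp add: b_def \<eta>f)
        also have "\<dots> = (LINT y|mu. Fb t (frac (y + c * t)) * \<eta> y)"
          using integral_frac_shift_pair[of "\<lambda>y x. Fb t x * \<eta> y" "c * t"] by simp
        finally show ?thesis .
      qed
      then have "(LINT t|iv 0 R. b t) = (LINT t|iv 0 R. LINT y|mu. Fb t (frac (y + c * t)) * \<eta> y)" by simp
      also have "\<dots> = (LINT y|mu. LINT t|iv 0 R. Fb t (frac (y + c * t)) * \<eta> y)"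
        by (rule fubini_iv(1)[symmetric, where K="K * 1"]) (use Fb\<eta> in auto)
      finally show ?thesis by simp
    qed
    moreover have "(LINT y|mu. g y * \<eta> y) = (LINT y|mu. wR (frac (y + c * R)) * \<eta> y) 
       - ((LINT y|mu. W0 y * \<eta> y) + (LINT y|mu. (LINT t|iv 0 R. Fb t (frac (y + c * t))) * \<eta> y))"
    proof -
      have \<eta>b: "bdd_borel \<eta>" using \<eta>1 by (intro bdd_borelI) auto
      have W0b: "bdd_borel W0" using B0 by (intro bdd_borelI) auto
      have Ib: "bdd_borel (\<lambda>y. LINT t|iv 0 R. Fb t (frac (y + c * t)))"
        using bdd_borel_diff[OF tr_b W0b] by (simp add: transport_def[abs_def])
      have I1: "integrable mu (\<lambda>y. wR (frac (y + c * R)) * \<eta> y)"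
        by (rule Bochner_Integration.integrable_bound[OF wRs_int]) (use \<eta>1 in \<open>auto simp: abs_mult intro!: mult_left_le\<close>)
      have I2: "integrable mu (\<lambda>y. W0 y * \<eta> y)" "integrable mu (\<lambda>y. (LINT t|iv 0 R. Fb t (frac (y + c * t))) * \<eta> y)"
        by (intro bdd_borel_integrable bdd_borel_mult \<eta>b W0b Ib)+
      have "(LINT y|mu. g y * \<eta> y) = (LINT y|mu. wR (frac (y + c * R)) * \<eta> y - (W0 y * \<eta> y + (LINT t|iv 0 R. Fb t (frac (y + c * t))) * \<eta> y))"
        by (rule Bochner_Integration.integral_cong) (simp_all only: g_def transport_def algebra_simps)
      also have "\<dots> = (LINT y|mu. wR (frac (y + c * R)) * \<eta> y) 
       - ((LINT y|mu. W0 y * \<eta> y) + (LINT y|mu. (LINT t|iv 0 R. Fb t (frac (y + c * t))) * \<eta> y))"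
        using I1 I2 by (subst Bochner_Integration.integral_diff, simp, intro Bochner_Integration.integrable_add, simp, simp, 
            subst Bochner_Integration.integral_add) auto
      finally show ?thesis .
    qed
    ultimately show ?thesis by (simp add: \<eta>_def)
  qed
  from AE_frac_shift[OF AE_zero_if_bumps_zero[OF g_int this], of "- (c * R)"] wR_eq
  have "AE x in mu. g (frac (x - c * R)) = 0 \<and> w R x = wR x" by (simp add: AE_conjI)
  \<comment> \<open>Undoing the rotation returns \<open>frac x\<close>, which differs from
    \<open>x\<close> only at the endpoint 1.\<close>
  moreover have "AE x in mu. frac x = x"
    unfolding AE_iv using AE_lborel_singleton[of 1] by eventually_elim (auto simp: frac_eq)
  ultimately show ?thesis
  proof eventually_elim
    case (elim x)
    then show ?case by (simp add: g_def mild_def frac_add_frac)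
  qed
qed

section \<open>The decay theorem\<close>

lemma AE_Tmeas_const: "(AE x in Tmeas. P) \<longleftrightarrow> P"
  unfolding AE_Tmeas by (simp add: eventually_const_iff ae_filter_eq_bot_iff emeasure_iv)

lemma AE_ge_if_approx:
  fixes f :: "real \<Rightarrow> real"
  assumes "\<And>e. 0 < e \<Longrightarrow> AE x in Tmeas. b - e \<le> f x"
  shows "AE x in Tmeas. b \<le> f x"
proof -
  have "AE x in Tmeas. \<forall>n. b - 1 / real (Suc n) \<le> f x"
    unfolding AE_all_countable using assms by simp
  then show ?thesis
  proof eventually_elim
    case (elim x)
    have "(\<lambda>n. b - 1 / real (Suc n)) \<longlonglongrightarrow> b - 0"
      by (intro tendsto_intros LIMSEQ_inverse_real_of_nat[unfolded inverse_eq_divide])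
    from LIMSEQ_le_const2[OF this, of "f x"] elim show ?case by auto
  qed
qed

text \<open>Every level below the supremum is a lower bound almost everywhere, and countably many
  levels approach it. \<open>Sup\<close> is meaningful because the set of lower bounds is nonempty
  and bounded; boundedness uses that a constant statement true almost everywhere on a space of
  positive mass is true.\<close>

lemma ess_inf_T_le_AE:
  assumes "Linf_T f"
  shows "AE x in Tmeas. ess_inf_T f \<le> f x"
proof (rule AE_ge_if_approx)
  fix e :: real assume e: "0 < e"
  define S where "S = {b. AE x in Tmeas. b \<le> f x}"
  obtain C where C: "AE x in Tmeas. \<bar>f x\<bar> \<le> C" using assms by (auto simp: Linf_T_def)
  have "AE x in Tmeas. - C \<le> f x" using C by eventually_elim linarith
  then have ne: "S \<noteq> {}" by (auto simp: S_def)
  have "b \<le> C" if "b \<in> S" for b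
  proof -
    have "AE x in Tmeas. b \<le> f x" using that by (simp add: S_def)
    with C have "AE x in Tmeas. b \<le> C" by eventually_elim linarith
    then show ?thesis by (simp only: AE_Tmeas_const)
  qed
  then have "bdd_above S" by (meson bdd_aboveI)
  then obtain b where b: "b \<in> S" "ess_inf_T f - e < b"
    using less_cSup_iff[OF ne, of "ess_inf_T f - e"] e by (auto simp: ess_inf_T_def S_def)
  from b(1) have "AE x in Tmeas. b \<le> f x" by (simp add: S_def)
  then show "AE x in Tmeas. ess_inf_T f - e \<le> f x" by eventually_elim (use b(2) in linarith)
qed

lemma abs_le_Linf_norm_AE:
  assumes "Linf_T f"
  shows "AE x in Tmeas. \<bar>f x\<bar> \<le> Linf_norm f"
proof -
  have "AE x in Tmeas. - Linf_norm f \<le> - \<bar>f x\<bar>"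
  proof (rule AE_ge_if_approx)
    fix e :: real assume e: "0 < e"
    define S where "S = {b. AE x in Tmeas. \<bar>f x\<bar> \<le> b}"
    have ne: "S \<noteq> {}" using assms by (auto simp: Linf_T_def S_def)
    have "0 \<le> b" if "b \<in> S" for b
    proof -
      have "AE x in Tmeas. \<bar>f x\<bar> \<le> b" using that by (simp add: S_def)
      then have "AE x in Tmeas. 0 \<le> b" by eventually_elim linarith
      then show ?thesis by (simp only: AE_Tmeas_const)
    qed
    then have "bdd_below S" by (meson bdd_belowI)
    then obtain b where b: "b \<in> S" "b < Linf_norm f + e"
      using cInf_less_iff[OF ne, of "Linf_norm f + e"] e by (auto simp: Linf_norm_def S_def)
    from b(1) have "AE x in Tmeas. \<bar>f x\<bar> \<le> b" by (simp add: S_def)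
    then show "AE x in Tmeas. - Linf_norm f - e \<le> - \<bar>f x\<bar>" by eventually_elim (use b(2) in linarith)
  qed
  then show ?thesis by eventually_elim simp
qed

text \<open>The exponent \<open>\<alpha> - 1\<close> is at most 0, so the corresponding power of
  \<open>s\<close> is smallest at the top value \<open>2 * M\<close>. This is the origin of
  \<open>ks\<close>. At \<open>s = 0\<close> the left side vanishes.\<close>

lemma powr_ge_linear:
  fixes s M \<alpha> :: real
  assumes "0 \<le> s" "s \<le> 2 * M" "0 \<le> \<alpha>" "\<alpha> \<le> 1"
  shows "(2 * M) powr (\<alpha> - 1) * s \<le> (if \<alpha> = 0 then 1 else s powr \<alpha>)"
proof (cases "s = 0")
  case False
  then have s: "0 < s" using assms by simp
  have "(2 * M) powr (\<alpha> - 1) * s \<le> s powr (\<alpha> - 1) * s"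
    using s assms by (intro mult_right_mono powr_mono2') auto
  also have "\<dots> = s powr \<alpha>" using s by (simp add: powr_diff)
  finally show ?thesis using s by auto
qed auto

lemma initial_borel_version:
  assumes "Linf_T f" "AE x in Tmeas. 0 \<le> f x" "Linf_norm f \<le> M" "0 \<le> M"
  obtains g where "g \<in> borel_measurable borel" "AE x in mu. f x = g x" "\<And>x. 0 \<le> g x" "\<And>x. g x \<le> M"
proof -
  have "f \<in> borel_measurable Tmeas" using assms by (simp add: Linf_T_def)
  from Tmeas_borel_version[OF this] obtain h where [measurable]: "h \<in> borel_measurable borel" and h: "AE x in mu. f x = h x" .
  have "AE x in mu. f x = max 0 (min (h x) M)"
    using h assms(2)[unfolded AE_Tmeas] abs_le_Linf_norm_AE[OF assms(1), unfolded AE_Tmeas]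
    by eventually_elim (use assms in auto)
  then show thesis using assms(4) by (intro that[of "\<lambda>x. max 0 (min (h x) M)"]) auto
qed

text \<open>Clamping to \<open>[0, \<bar>B\<bar>]\<close> changes the Borel version only on a null
  set of the strip and makes its bounds hold everywhere, as needed for an exchange term bounded at
  every point.\<close>

lemma strip_borel_version:
  assumes "sol_space u" "0 < T"
  obtains ub B where "case_prod ub \<in> borel_measurable (borel \<Otimes>\<^sub>M borel)"
    "AE z in lborel. z \<in> {0..<T} \<times> {0..1} \<longrightarrow> u (fst z) (snd z) = ub (fst z) (snd z)"
    "0 \<le> B" "\<And>t x. 0 \<le> ub t x" "\<And>t x. ub t x \<le> B"
proof -
  have strip: "{0..<T} \<times> {0..1} \<in> sets (borel :: (real \<times> real) measure)" "{0..} \<times> {0..1} \<in> sets (borel :: (real \<times> real) measure)"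
    unfolding borel_prod[symmetric] by measurable
  then have S: "{0..<T} \<times> {0..1} \<in> sets (lebesgue :: (real \<times> real) measure)" "{0..} \<times> {0..1} \<in> sets (lebesgue :: (real \<times> real) measure)" by auto
  have m: "(\<lambda>(t, x). u t x) \<in> borel_measurable (lebesgue_on ({0..<T} \<times> {0..1}))"
    and "\<exists>B. AE z in lebesgue_on ({0..<T} \<times> {0..1}). \<bar>(\<lambda>(t, x). u t x) z\<bar> \<le> B"
    and nn: "AE z in lebesgue_on ({0..} \<times> {0..1}). 0 \<le> (\<lambda>(t, x). u t x) z"
    using assms unfolding sol_space_def by blast+
  then obtain B where B: "AE z in lebesgue_on ({0..<T} \<times> {0..1}). \<bar>(\<lambda>(t, x). u t x) z\<bar> \<le> B" by blast
  obtain h where h: "h \<in> borel_measurable borel" "AE z in lborel. z \<in> {0..<T} \<times> {0..1} \<longrightarrow> (\<lambda>(t, x). u t x) z = h z"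
    using lebesgue_on_borel_version[OF S(1) m] .
  define ub where "ub t x = max 0 (min (h (t, x)) \<bar>B\<bar>)" for t x
  show thesis
  proof (rule that[of ub "\<bar>B\<bar>"])
    have [measurable]: "h \<in> borel_measurable (borel \<Otimes>\<^sub>M borel)" using h(1) by (simp add: borel_prod)
    show "case_prod ub \<in> borel_measurable (borel \<Otimes>\<^sub>M borel)" unfolding ub_def[abs_def] by measurable
    show "AE z in lborel. z \<in> {0..<T} \<times> {0..1} \<longrightarrow> u (fst z) (snd z) = ub (fst z) (snd z)"
      using h(2) B[unfolded AE_lebesgue_on[OF S(1)]] nn[unfolded AE_lebesgue_on[OF S(2)]]
      by eventually_elim (auto simp: ub_def case_prod_unfold)
  qed (auto simp: ub_def)
qed

lemma interaction_rate_extension: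
  assumes "interaction_rate k"
  shows "(\<lambda>z. indicator ({0..} \<times> {0..} \<times> {0..1}) z * (\<lambda>(a, b, x). k a b x) z) \<in> borel_measurable (borel :: (real \<times> real \<times> real) measure)"
proof -
  have "{0..} \<times> {0..} \<times> {0..1} \<in> sets (borel :: (real \<times> real \<times> real) measure)"
    by (intro borel_closed closed_Times) auto
  then show ?thesis using assms unfolding interaction_rate_def
    by (subst (asm) borel_measurable_restrict_space_iff) auto
qed

text \<open>The exchange term \<open>F\<close> is formed from Borel versions of \<open>u\<close> and
  \<open>v\<close>. As these agree with the mild solutions driven by \<open>F\<close> and
  \<open>- F\<close>, the term becomes a function of the mild solutions themselves, which closes the
  system required by \<open>relaxation\<close>.\<close>

lemma decay_at_positive_time:
  fixes c M m \<alpha> \<kappa> t :: real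
  assumes c: "0 < c" and ir: "interaction_rate k" and t1: "type1 k" and \<alpha>: "0 \<le> \<alpha>" "\<alpha> \<le> 1"
    and k1: "Linf_T k1" "ess_inf_T k1 > 0"
    and lower: "\<And>a b x. 0 \<le> a \<Longrightarrow> 0 \<le> b \<Longrightarrow> x \<in> {0..1} \<Longrightarrow> k1 x * (if \<alpha> = 0 then 1 else (a + b) powr \<alpha>) \<le> k a b x"
    and u0: "Linf_T u0" "AE x in Tmeas. 0 \<le> u0 x" and v0: "Linf_T v0" "AE x in Tmeas. 0 \<le> v0 x"
    and M: "Linf_norm u0 \<le> M" "Linf_norm v0 \<le> M" "0 < M"
    and m: "m = (1/2) * (LINT x|Tmeas. u0 x + v0 x)" "0 < m"
    and upper: "\<And>a b x. 0 \<le> a \<Longrightarrow> a \<le> M \<Longrightarrow> 0 \<le> b \<Longrightarrow> b \<le> M \<Longrightarrow> x \<in> {0..1} \<Longrightarrow> k a b x \<le> \<kappa>" and \<kappa>: "0 < \<kappa>"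
    and ws: "weak_solution c k u0 v0 u v" and t: "0 < t"
  defines "ks \<equiv> ess_inf_T k1 * (2 * M) powr (\<alpha> - 1)"
  shows "(LINT x|Tmeas. (u t x - m)\<^sup>2) + (LINT x|Tmeas. (v t x - m)\<^sup>2)
     \<le> 2 * exp (- decay_rate c m ks \<kappa> * t) * ((LINT x|Tmeas. (u0 x - m)\<^sup>2) + (LINT x|Tmeas. (v0 x - m)\<^sup>2))"
proof -
  have sol: "sol_space u" "sol_space v" using ws by (auto simp: weak_solution_def)
  \<comment> \<open>Identification with a mild solution at time \<open>R\<close> needs Borel
    versions on a strip with \<open>R < T\<close>; one extra unit of time provides it up to and
    including \<open>t\<close>.\<close>
  define T where "T = t + 1"
  have T: "0 < T" and tT: "t < T" using t by (auto simp: T_def)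
  obtain ub Bu where ub: "case_prod ub \<in> borel_measurable (borel \<Otimes>\<^sub>M borel)"
    "AE z in lborel. z \<in> {0..<T} \<times> {0..1} \<longrightarrow> u (fst z) (snd z) = ub (fst z) (snd z)"
    "0 \<le> Bu" "\<And>t x. 0 \<le> ub t x" "\<And>t x. ub t x \<le> Bu" by (rule strip_borel_version[OF sol(1) T]) blast
  obtain vb Bv where vb: "case_prod vb \<in> borel_measurable (borel \<Otimes>\<^sub>M borel)"
    "AE z in lborel. z \<in> {0..<T} \<times> {0..1} \<longrightarrow> v (fst z) (snd z) = vb (fst z) (snd z)"
    "0 \<le> Bv" "\<And>t x. 0 \<le> vb t x" "\<And>t x. vb t x \<le> Bv" by (rule strip_borel_version[OF sol(2) T]) blast
  obtain U0 where U0: "U0 \<in> borel_measurable borel" "AE x in mu. u0 x = U0 x" "\<And>x. 0 \<le> U0 x" "\<And>x. U0 x \<le> M"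
    by (rule initial_borel_version[OF u0 M(1) less_imp_le[OF M(3)]]) blast
  obtain V0 where V0: "V0 \<in> borel_measurable borel" "AE x in mu. v0 x = V0 x" "\<And>x. 0 \<le> V0 x" "\<And>x. V0 x \<le> M"
    by (rule initial_borel_version[OF v0 M(2) less_imp_le[OF M(3)]]) blast
  define \<Omega> where "\<Omega> = {0::real..} \<times> {0::real..} \<times> {0..1::real}"
  \<comment> \<open>The rate is only known to be measurable on its domain; extension by 0 makes
    \<open>F\<close> Borel on the whole plane.\<close>
  define q where "q a b x = indicator \<Omega> (a, b, x) * k a b x" for a b x :: real
  \<comment> \<open>This is the sup bound that the solution space provides before the maximum
    principle. The rate bound at this level only serves to make \<open>F\<close> bounded; the decay
    rate is expressed by \<kappa>, the bound at level \<open>M\<close>.\<close>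
  define \<gamma> where "\<gamma> = max Bu Bv + 1"
  have \<gamma>: "0 < \<gamma>" "ub s x \<le> \<gamma>" "vb s x \<le> \<gamma>" for s x
    using ub(3) vb(3) ub(5)[of s x] vb(5)[of s x] by (auto simp: \<gamma>_def)
  obtain \<kappa>1 where \<kappa>1: "0 < \<kappa>1" "\<And>a b x. 0 \<le> a \<Longrightarrow> a \<le> \<gamma> \<Longrightarrow> 0 \<le> b \<Longrightarrow> b \<le> \<gamma> \<Longrightarrow> x \<in> {0..1} \<Longrightarrow> k a b x \<le> \<kappa>1"
    using t1 \<gamma>(1) unfolding type1_def by blast
  have k0: "0 \<le> k a b x" if "0 \<le> a" "0 \<le> b" "x \<in> {0..1}" for a b x using ir that unfolding interaction_rate_def by blast
  define F where "F s x = q (ub s x) (vb s x) x * (vb s x - ub s x)" for s x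
  have F_bdd: "\<bar>F s x\<bar> \<le> \<kappa>1 * \<gamma>" for s x
  proof -
    have "0 \<le> q (ub s x) (vb s x) x \<and> q (ub s x) (vb s x) x \<le> \<kappa>1"
    proof (cases "x \<in> {0..1}")
      case True
      then show ?thesis unfolding q_def \<Omega>_def using k0[of "ub s x" "vb s x" x] \<kappa>1(2)[of "ub s x" "vb s x" x] ub(4) vb(4) \<gamma> by simp
    next
      case False then show ?thesis using \<kappa>1(1) by (auto simp: q_def \<Omega>_def)
    qed
    moreover have "\<bar>vb s x - ub s x\<bar> \<le> \<gamma>" using ub(4)[of s x] vb(4)[of s x] \<gamma>(2,3)[of s x] by linarith
    ultimately show ?thesis unfolding F_def abs_mult using \<gamma>(1) by (intro mult_mono) auto
  qed
  have F_meas: "case_prod F \<in> borel_measurable (borel \<Otimes>\<^sub>M borel)"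
  proof -
    have [measurable]: "(\<lambda>z. indicator \<Omega> z * (\<lambda>(a, b, x). k a b x) z) \<in> borel_measurable (borel \<Otimes>\<^sub>M (borel \<Otimes>\<^sub>M borel))"
      using interaction_rate_extension[OF ir] unfolding \<Omega>_def by (simp add: borel_prod)
    note [measurable (raw)] = measurable_comp2[OF ub(1)] measurable_comp2[OF vb(1)]
    have "(\<lambda>z. (\<lambda>z. indicator \<Omega> z * (\<lambda>(a, b, x). k a b x) z) (ub (fst z) (snd z), vb (fst z) (snd z), snd z) * (vb (fst z) (snd z) - ub (fst z) (snd z)))
       \<in> borel_measurable (borel \<Otimes>\<^sub>M borel)" by measurable
    then show ?thesis by (simp add: F_def q_def case_prod_unfold)
  qed
  have F_ae: "AE z in lborel. z \<in> {0..<T} \<times> {0..1} \<longrightarrow>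
       k (u (fst z) (snd z)) (v (fst z) (snd z)) (snd z) * (v (fst z) (snd z) - u (fst z) (snd z)) = F (fst z) (snd z)"
    using ub(2) vb(2) by eventually_elim (use ub(4) vb(4) in \<open>auto simp: F_def q_def \<Omega>_def\<close>)
  have mild_u: "AE x in mu. u s x = mild c F U0 s x" if "0 < s" "s < T" for s
  proof (rule weak_solution_is_mild[OF sol(1) U0(1,2) _ ub(1) _ ub(2) F_meas F_bdd F_ae _ that])
    show "\<bar>U0 x\<bar> \<le> M" for x using U0(3,4)[of x] by simp
    show "\<bar>ub s x\<bar> \<le> Bu" for s x using ub(4,5)[of s x] by simp
    fix \<psi> assume "test_fun \<psi>"
    then show "(LINT z|lebesgue_on ({0..} \<times> {0..1}). u (fst z) (snd z) * (d_t \<psi> z + c * d_x \<psi> z))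
       + (LINT x|Tmeas. \<psi> (0, x) * u0 x) + (LINT z|lebesgue_on ({0..} \<times> {0..1}).
       k (u (fst z) (snd z)) (v (fst z) (snd z)) (snd z) * (v (fst z) (snd z) - u (fst z) (snd z)) * \<psi> z) = 0"
      using ws unfolding weak_solution_def by (simp add: case_prod_unfold)
  qed
  have mild_v: "AE x in mu. v s x = mild (- c) (\<lambda>t x. - F t x) V0 s x" if "0 < s" "s < T" for s
  proof (rule weak_solution_is_mild[OF sol(2) V0(1,2) _ vb(1) _ vb(2) _ _ _ _ that])
    show "\<bar>V0 x\<bar> \<le> M" for x using V0(3,4)[of x] by simp
    show "\<bar>vb s x\<bar> \<le> Bv" for s x using vb(4,5)[of s x] by simp
    have "(\<lambda>z. - case_prod F z) \<in> borel_measurable (borel \<Otimes>\<^sub>M borel)" using F_meas by measurable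
    then show "(\<lambda>(t, x). - F t x) \<in> borel_measurable (borel \<Otimes>\<^sub>M borel)" by (simp add: case_prod_unfold)
    show "\<bar>- F t x\<bar> \<le> \<kappa>1 * \<gamma>" for t x using F_bdd by simp
    show "AE z in lborel. z \<in> {0..<T} \<times> {0..1} \<longrightarrow>
       k (u (fst z) (snd z)) (v (fst z) (snd z)) (snd z) * (u (fst z) (snd z) - v (fst z) (snd z)) = - F (fst z) (snd z)"
      using F_ae by eventually_elim (auto simp: algebra_simps)
    fix \<psi> assume "test_fun \<psi>"
    then show "(LINT z|lebesgue_on ({0..} \<times> {0..1}). v (fst z) (snd z) * (d_t \<psi> z + - c * d_x \<psi> z))
       + (LINT x|Tmeas. \<psi> (0, x) * v0 x) + (LINT z|lebesgue_on ({0..} \<times> {0..1}).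
       k (u (fst z) (snd z)) (v (fst z) (snd z)) (snd z) * (u (fst z) (snd z) - v (fst z) (snd z)) * \<psi> z) = 0"
      using ws unfolding weak_solution_def by (simp add: case_prod_unfold)
  qed
  have ks: "0 < ks" using k1(2) M(3) by (simp add: ks_def)
  have U0b: "bdd_borel U0" "bdd_borel V0" using U0 V0 by (auto intro!: bdd_borelI[where K=M])
  interpret relaxation c t "\<kappa>1 * \<gamma>" M m M \<kappa> ks F U0 V0
  proof
    show "(LINT y|mu. U0 y) + (LINT y|mu. V0 y) = 2 * m"
    proof -
      have "(LINT x|Tmeas. u0 x + v0 x) = (LINT x|mu. U0 x + V0 x)"
        by (rule Tmeas_mu(1)) (use U0(1,2) V0(1,2) in auto)
      also have "\<dots> = (LINT y|mu. U0 y) + (LINT y|mu. V0 y)"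
        using U0b by (intro Bochner_Integration.integral_add bdd_borel_integrable)
      finally show ?thesis using m(1) by simp
    qed
    have k1_ae: "AE x in mu. ess_inf_T k1 \<le> k1 x" using ess_inf_T_le_AE[OF k1(1)] by (simp only: AE_Tmeas)
    have x01: "AE x in mu. x \<in> {0..1}" by (rule AE_ivI) auto
    \<comment> \<open>The mild identities are available at positive times; dropping time 0 costs a
      null set.\<close>
    have pos_t: "AE s in iv 0 t. 0 < s \<and> s < T"
      unfolding AE_iv using AE_lborel_singleton[of 0] by eventually_elim (use tT in auto)
    show "AE s in iv 0 t. AE x in mu. \<exists>q. 
        F s x = q * (mild (- c) (\<lambda>t x. - F t x) V0 s x - mild c F U0 s x) \<and> 0 \<le> q
        \<and> 0 \<le> mild c F U0 s x \<and> 0 \<le> mild (- c) (\<lambda>t x. - F t x) V0 s x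
        \<and> (mild c F U0 s x \<le> M \<longrightarrow> mild (- c) (\<lambda>t x. - F t x) V0 s x \<le> M
           \<longrightarrow> q \<le> \<kappa> \<and> ks * (mild c F U0 s x + mild (- c) (\<lambda>t x. - F t x) V0 s x) \<le> q)"
      using AE_strip_sections[OF ub(2) tT] AE_strip_sections[OF vb(2) tT] pos_t
    proof eventually_elim
      case (elim s)
      note s = elim(3)[THEN conjunct1] elim(3)[THEN conjunct2]
      show ?case
        using elim(1,2) mild_u[OF s] mild_v[OF s] k1_ae x01
      proof eventually_elim
        case (elim x)
        let ?a = "mild c F U0 s x" and ?b = "mild (- c) (\<lambda>t x. - F t x) V0 s x"
        have e: "ub s x = ?a" "vb s x = ?b" using elim(1-4) by auto
        have ab: "0 \<le> ?a" "0 \<le> ?b" unfolding e[symmetric] by (fact ub(4) vb(4))+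
        have "F s x = k ?a ?b x * (?b - ?a)" using ab elim(6) by (simp add: F_def e q_def \<Omega>_def)
        moreover have "0 \<le> k ?a ?b x" by (rule k0[OF ab elim(6)])
        moreover have "k ?a ?b x \<le> \<kappa>" "ks * (?a + ?b) \<le> k ?a ?b x" if le: "?a \<le> M" "?b \<le> M"
        proof -
          show "k ?a ?b x \<le> \<kappa>" using upper ab le elim(6) by blast
          have "ks * (?a + ?b) = ess_inf_T k1 * ((2 * M) powr (\<alpha> - 1) * (?a + ?b))" by (simp add: ks_def)
          also have "\<dots> \<le> ess_inf_T k1 * (if \<alpha> = 0 then 1 else (?a + ?b) powr \<alpha>)"
            using powr_ge_linear[of "?a + ?b" M \<alpha>] ab le \<alpha> k1(2) by (intro mult_left_mono) auto
          also have "\<dots> \<le> k1 x * (if \<alpha> = 0 then 1 else (?a + ?b) powr \<alpha>)" using elim(5) by (intro mult_right_mono) auto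
          also have "\<dots> \<le> k ?a ?b x" by (rule lower[OF ab elim(6)])
          finally show "ks * (?a + ?b) \<le> k ?a ?b x" .
        qed
        ultimately show ?case using ab by blast
      qed
    qed
    show "\<bar>U0 y\<bar> \<le> M" "\<bar>V0 y\<bar> \<le> M" for y using U0(3,4)[of y] V0(3,4)[of y] by auto
  qed (use c t F_meas F_bdd U0 V0 m(2) ks \<kappa> in auto)
  have bt: "bdd_borel (mild c F U0 t)" "bdd_borel (mild (- c) (\<lambda>t x. - F t x) V0 t)" by (rule bdd_borel_sol[OF order_refl])+
  note meas = bdd_borel_measurable[OF bt(1)] bdd_borel_measurable[OF bt(2)]
  have 1: "(LINT x|Tmeas. (u t x - m)\<^sup>2) + (LINT x|Tmeas. (v t x - m)\<^sup>2) = energy t"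
  proof -
    have "(LINT x|Tmeas. (u t x - m)\<^sup>2) = (LINT x|mu. (mild c F U0 t x - m)\<^sup>2)"
      by (rule Tmeas_mu(1)) (use meas mild_u[OF t tT] in \<open>auto elim!: eventually_mono\<close>)
    moreover have "(LINT x|Tmeas. (v t x - m)\<^sup>2) = (LINT x|mu. (mild (- c) (\<lambda>t x. - F t x) V0 t x - m)\<^sup>2)"
      by (rule Tmeas_mu(1)) (use meas mild_v[OF t tT] in \<open>auto elim!: eventually_mono\<close>)
    ultimately show ?thesis by (simp add: energy_def)
  qed
  have 2: "(LINT x|Tmeas. (u0 x - m)\<^sup>2) + (LINT x|Tmeas. (v0 x - m)\<^sup>2) = energy 0"
  proof -
    have "(LINT x|Tmeas. (u0 x - m)\<^sup>2) = (LINT x|mu. (U0 x - m)\<^sup>2)"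
      by (rule Tmeas_mu(1)) (use U0 in \<open>auto elim!: eventually_mono\<close>)
    moreover have "(LINT x|Tmeas. (v0 x - m)\<^sup>2) = (LINT x|mu. (V0 x - m)\<^sup>2)"
      by (rule Tmeas_mu(1)) (use V0 in \<open>auto elim!: eventually_mono\<close>)
    ultimately show ?thesis using integral_initial[of "\<lambda>x. (x - m)\<^sup>2"] by (simp add: energy_def)
  qed
  show ?thesis unfolding 1 2 using energy_decay[of t] t by simp
qed

lemma sol_space_L2:
  assumes "sol_space w" "0 \<le> t"
  shows "integrable Tmeas (\<lambda>x. (w t x - m)\<^sup>2)"
    "((\<lambda>s. LINT x|Tmeas. (w s x - w t x)\<^sup>2) \<longlongrightarrow> 0) (at t within {0..})"
proof -
  have p2: "\<bar>y\<bar> powr 2 = y\<^sup>2" for y :: real by (cases "y = 0") (simp_all add: powr_numeral)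
  have "\<forall>t\<ge>0. \<forall>p\<ge>1. w t \<in> borel_measurable Tmeas \<and> integrable Tmeas (\<lambda>x. \<bar>w t x\<bar> powr p)
     \<and> ((\<lambda>s. LINT x|Tmeas. \<bar>w s x - w t x\<bar> powr p) \<longlongrightarrow> 0) (at t within {0..})"
    using assms(1) unfolding sol_space_def by blast
  from this[rule_format, OF assms(2), of 2]
  have *: "integrable Tmeas (\<lambda>x. (w t x)\<^sup>2)" "((\<lambda>s. LINT x|Tmeas. (w s x - w t x)\<^sup>2) \<longlongrightarrow> 0) (at t within {0..})"
    by (simp_all add: p2)
  have c: "integrable Tmeas (\<lambda>x. m\<^sup>2)" using Tmeas_mu(2)[of "\<lambda>x. m\<^sup>2" "\<lambda>x. m\<^sup>2"] by (simp add: bdd_borel_integrable bdd_borel_const)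
  have "integrable Tmeas (\<lambda>x. (w t x)\<^sup>2 - 2 * m * w t x + m\<^sup>2)"
    using *(1) sol_space_L1(2)[OF assms] c by (intro Bochner_Integration.integrable_add Bochner_Integration.integrable_diff integrable_mult_right)
  then show "integrable Tmeas (\<lambda>x. (w t x - m)\<^sup>2)" by (simp add: power2_eq_square algebra_simps)
  show "((\<lambda>s. LINT x|Tmeas. (w s x - w t x)\<^sup>2) \<longlongrightarrow> 0) (at t within {0..})" by (rule *(2))
qed

text \<open>Carries a bound from small positive times to time 0. The initial data enter through the
  weak identity, so the slice at time 0 is reached through later slices; the elementary inequality
  for the square of a sum costs a factor 2.\<close>

lemma L2_distance_at_zero:
  assumes w: "sol_space w" and s: "0 \<le> s"
  shows "(LINT x|Tmeas. (w 0 x - m)\<^sup>2) \<le> 2 * (LINT x|Tmeas. (w s x - m)\<^sup>2) + 2 * (LINT x|Tmeas. (w s x - w 0 x)\<^sup>2)"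
proof -
  have I: "integrable Tmeas (\<lambda>x. (w s x - m)\<^sup>2)" "integrable Tmeas (\<lambda>x. (w 0 x - m)\<^sup>2)" using sol_space_L2(1)[OF w] s by auto
  have meas: "w s \<in> borel_measurable Tmeas" "w 0 \<in> borel_measurable Tmeas" using sol_space_L1(1)[OF w] s by auto
  have sq: "(a + b)\<^sup>2 \<le> 2 * a\<^sup>2 + 2 * b\<^sup>2" for a b :: real using sum_squares_bound[of a b] by (simp add: power2_sum)
  have I2: "integrable Tmeas (\<lambda>x. (w s x - w 0 x)\<^sup>2)"
  proof (rule Bochner_Integration.integrable_bound)
    show "integrable Tmeas (\<lambda>x. 2 * (w s x - m)\<^sup>2 + 2 * (w 0 x - m)\<^sup>2)" using I by auto
    show "(\<lambda>x. (w s x - w 0 x)\<^sup>2) \<in> borel_measurable Tmeas" using meas by measurable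
    show "AE x in Tmeas. norm ((w s x - w 0 x)\<^sup>2) \<le> norm (2 * (w s x - m)\<^sup>2 + 2 * (w 0 x - m)\<^sup>2)"
    proof (rule AE_I2)
      fix x
      show "norm ((w s x - w 0 x)\<^sup>2) \<le> norm (2 * (w s x - m)\<^sup>2 + 2 * (w 0 x - m)\<^sup>2)"
        using sq[of "w s x - m" "m - w 0 x"] by (simp add: power2_commute[of m])
    qed
  qed
  have "(LINT x|Tmeas. (w 0 x - m)\<^sup>2) \<le> (LINT x|Tmeas. 2 * (w s x - m)\<^sup>2 + 2 * (w s x - w 0 x)\<^sup>2)"
  proof (rule integral_mono)
    show "(w 0 x - m)\<^sup>2 \<le> 2 * (w s x - m)\<^sup>2 + 2 * (w s x - w 0 x)\<^sup>2" for x
      using sq[of "w s x - m" "w 0 x - w s x"] by (simp add: power2_commute[of "w 0 x" "w s x"])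
  qed (use I I2 in auto)
  also have "\<dots> = 2 * (LINT x|Tmeas. (w s x - m)\<^sup>2) + 2 * (LINT x|Tmeas. (w s x - w 0 x)\<^sup>2)"
    using I I2 by (subst Bochner_Integration.integral_add) auto
  finally show ?thesis .
qed

text \<open>The order of the quantifiers expresses the dependence of the constants:
  \<open>\<Lambda>\<close> is chosen before \<alpha>, \<open>kinf\<close> and \<kappa>, and
  \<open>lam\<close> before rate, data and solution. The case distinction on \<alpha> is there
  because \<open>0 powr 0\<close> is 0, whereas the intended zeroth power is 1.\<close>

theorem theorem2p4:
  fixes c :: real
  assumes "c > 0"
  shows "\<forall>M m. \<exists>\<Lambda>>0. \<forall>\<alpha> kinf \<kappa>. \<exists>lam>0.
    \<forall>k k1 u0 v0 u v.
      interaction_rate k \<and> type1 k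
      \<and> 0 \<le> \<alpha> \<and> \<alpha> \<le> 1
      \<and> Linf_T k1 \<and> ess_inf_T k1 > 0
      \<and> (\<forall>a b x. 0 \<le> a \<longrightarrow> 0 \<le> b \<longrightarrow> x \<in> {0..1} \<longrightarrow> k a b x \<ge> k1 x * (if \<alpha> = 0 then 1 else (a + b) powr \<alpha>))
      \<and> Linf_T u0 \<and> Linf_T v0
      \<and> (AE x in Tmeas. 0 \<le> u0 x) \<and> (AE x in Tmeas. 0 \<le> v0 x)
      \<and> M = max (Linf_norm u0) (Linf_norm v0)
      \<and> m = (1/2) * (LINT x|Tmeas. u0 x + v0 x) \<and> m > 0
      \<and> kinf = ess_inf_T k1
      \<and> (\<forall>a b x. 0 \<le> a \<longrightarrow> a \<le> M \<longrightarrow> 0 \<le> b \<longrightarrow> b \<le> M \<longrightarrow> x \<in> {0..1} \<longrightarrow> k a b x \<le> \<kappa>)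
      \<and> weak_solution c k u0 v0 u v
      \<longrightarrow> (\<forall>t\<ge>0. (LINT x|Tmeas. (u t x - m)\<^sup>2) + (LINT x|Tmeas. (v t x - m)\<^sup>2)
              \<le> \<Lambda> * exp (- 2 * lam * t)
                 * ((LINT x|Tmeas. (u0 x - m)\<^sup>2) + (LINT x|Tmeas. (v0 x - m)\<^sup>2)))"
    (is "\<forall>M m. \<exists>\<Lambda>>0. \<forall>\<alpha> kinf \<kappa>. \<exists>lam>0. ?P M m \<Lambda> \<alpha> kinf \<kappa> lam")
proof (intro allI)
  fix M m :: real
  \<comment> \<open>Half of \<open>decay_rate\<close>, as the exponent in the claim is
    \<open>- 2 * lam * t\<close>. Replacing \<kappa> by \<open>max \<kappa> 1\<close> gives a
    positive upper bound for the rate whatever the sign of \<kappa>.\<close>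
  let ?lam = "\<lambda>\<alpha> kinf \<kappa>. decay_rate c m (kinf * (2 * M) powr (\<alpha> - 1)) (max \<kappa> 1) / 2"
  have pos: "0 < ?lam \<alpha> kinf \<kappa>" if "0 < M" "0 < m" "0 < kinf" for \<alpha> kinf \<kappa>
    using decay_rate_pos[of c m "kinf * (2 * M) powr (\<alpha> - 1)" "max \<kappa> 1"] that assms by simp
  show "\<exists>\<Lambda>>0. \<forall>\<alpha> kinf \<kappa>. \<exists>lam>0. ?P M m \<Lambda> \<alpha> kinf \<kappa> lam"
  \<comment> \<open>For \<open>t > 0\<close> the constant is 2; it doubles at \<open>t = 0\<close>, which is only reached through \<open>L\<^sup>2\<close> continuity.\<close>
  proof (rule exI[of _ 4], intro conjI allI)
    fix \<alpha> kinf \<kappa> :: real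
    show "\<exists>lam>0. ?P M m 4 \<alpha> kinf \<kappa> lam"
    \<comment> \<open>A positive \<open>lam\<close> is owed for all parameters; the value 1 covers
      those that no admissible data realize.\<close>
    proof (rule exI[of _ "if 0 < M \<and> 0 < m \<and> 0 < kinf then ?lam \<alpha> kinf \<kappa> else 1"], intro conjI allI impI)
      show "0 < (if 0 < M \<and> 0 < m \<and> 0 < kinf then ?lam \<alpha> kinf \<kappa> else 1)" using pos by simp
    next
      fix k k1 u0 v0 u v and t :: real
      assume H: "interaction_rate k \<and> type1 k
      \<and> 0 \<le> \<alpha> \<and> \<alpha> \<le> 1
      \<and> Linf_T k1 \<and> ess_inf_T k1 > 0
      \<and> (\<forall>a b x. 0 \<le> a \<longrightarrow> 0 \<le> b \<longrightarrow> x \<in> {0..1} \<longrightarrow> k a b x \<ge> k1 x * (if \<alpha> = 0 then 1 else (a + b) powr \<alpha>))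
      \<and> Linf_T u0 \<and> Linf_T v0
      \<and> (AE x in Tmeas. 0 \<le> u0 x) \<and> (AE x in Tmeas. 0 \<le> v0 x)
      \<and> M = max (Linf_norm u0) (Linf_norm v0)
      \<and> m = (1/2) * (LINT x|Tmeas. u0 x + v0 x) \<and> m > 0
      \<and> kinf = ess_inf_T k1
      \<and> (\<forall>a b x. 0 \<le> a \<longrightarrow> a \<le> M \<longrightarrow> 0 \<le> b \<longrightarrow> b \<le> M \<longrightarrow> x \<in> {0..1} \<longrightarrow> k a b x \<le> \<kappa>)
      \<and> weak_solution c k u0 v0 u v" and t: "0 \<le> t"
      have kpos: "0 < kinf" and mpos: "0 < m" and kinf: "kinf = ess_inf_T k1" using H by auto
      have ae: "AE x in mu. \<bar>u0 x\<bar> \<le> Linf_norm u0" "AE x in mu. \<bar>v0 x\<bar> \<le> Linf_norm v0"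
        using H abs_le_Linf_norm_AE by (auto simp flip: AE_Tmeas)
      \<comment> \<open>With \<open>M \<le> 0\<close> the initial data would vanish almost
        everywhere, contradicting positive mass.\<close>
      have M0: "0 < M"
      proof (rule ccontr)
        assume nM: "\<not> 0 < M"
        have "AE x in mu. u0 x + v0 x = 0"
          using ae by eventually_elim (use H nM in auto)
        then have "(LINT x|Tmeas. u0 x + v0 x) = 0" using Tmeas_mu(1)[of "\<lambda>x. 0" "\<lambda>x. u0 x + v0 x"] by simp
        then show False using H by simp
      qed
      define E where "E = (LINT x|Tmeas. (u0 x - m)\<^sup>2) + (LINT x|Tmeas. (v0 x - m)\<^sup>2)"
      define h where "h s = (LINT x|Tmeas. (u s x - m)\<^sup>2) + (LINT x|Tmeas. (v s x - m)\<^sup>2)" for s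
      have E0: "0 \<le> E" by (simp add: E_def)
      define \<beta> where "\<beta> = decay_rate c m (kinf * (2 * M) powr (\<alpha> - 1)) (max \<kappa> 1)"
      have \<beta>: "0 < \<beta>" using pos[OF M0 mpos kpos, of \<alpha> \<kappa>] by (simp add: \<beta>_def)
      have lam: "- 2 * (if 0 < M \<and> 0 < m \<and> 0 < kinf then ?lam \<alpha> kinf \<kappa> else 1) = - \<beta>"
        using mpos kpos M0 by (simp add: \<beta>_def)
      have upper: "k a b x \<le> max \<kappa> 1" if "0 \<le> a" "a \<le> M" "0 \<le> b" "b \<le> M" "x \<in> {0..1}" for a b x
      proof -
        have "k a b x \<le> \<kappa>" using H that by blast
        then show ?thesis by simp
      qed
      have pos_time: "h s \<le> 2 * exp (- \<beta> * s) * E" if "0 < s" for s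
        unfolding h_def E_def \<beta>_def kinf
      proof (rule decay_at_positive_time[where k=k and v=v and u=u])
        show "Linf_norm u0 \<le> M" "Linf_norm v0 \<le> M" using H by auto
        show "k1 x * (if \<alpha> = 0 then 1 else (a + b) powr \<alpha>) \<le> k a b x" if "0 \<le> a" "0 \<le> b" "x \<in> {0..1}" for a b x
          using H that by blast
        show "k a b x \<le> max \<kappa> 1" if "0 \<le> a" "a \<le> M" "0 \<le> b" "b \<le> M" "x \<in> {0..1}" for a b x
          using upper[OF that] .
        show "0 < max \<kappa> 1" by simp
      qed (use H M0 assms that in blast)+
      have "h t \<le> 4 * exp (- \<beta> * t) * E"
      proof (cases "t = 0")
        case False
        then have "h t \<le> 2 * exp (- \<beta> * t) * E" using t by (intro pos_time) simp
        also have "\<dots> \<le> 4 * exp (- \<beta> * t) * E" using E0 by (intro mult_right_mono) auto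
        finally show ?thesis .
      next
        case True
        have sol: "sol_space u" "sol_space v" using H by (auto simp: weak_solution_def)
        have "h 0 \<le> 4 * E"
        proof (rule field_le_epsilon)
          fix e :: real assume e: "0 < e"
          have "((\<lambda>s. (LINT x|Tmeas. (u s x - u 0 x)\<^sup>2) + (LINT x|Tmeas. (v s x - v 0 x)\<^sup>2)) \<longlongrightarrow> 0 + 0) (at 0 within {0..})"
            by (intro tendsto_add sol_space_L2(2) sol) auto
          from order_tendstoD(2)[OF this, of "e / 2"] e obtain d where d: "0 < d"
            "\<And>s. 0 \<le> s \<Longrightarrow> s \<noteq> 0 \<Longrightarrow> dist s 0 < d \<Longrightarrow> (LINT x|Tmeas. (u s x - u 0 x)\<^sup>2) + (LINT x|Tmeas. (v s x - v 0 x)\<^sup>2) < e / 2"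
            unfolding eventually_at by auto
          define s where "s = d / 2"
          have s: "0 < s" "dist s 0 < d" using d(1) by (auto simp: s_def dist_real_def)
          have "exp (- \<beta> * s) \<le> 1" using \<beta> s by simp
          then have "2 * exp (- \<beta> * s) * E \<le> 2 * 1 * E" using E0 by (intro mult_right_mono) auto
          then have "h s \<le> 2 * E" using pos_time[OF s(1)] by simp
          moreover have "h 0 \<le> 2 * h s + 2 * ((LINT x|Tmeas. (u s x - u 0 x)\<^sup>2) + (LINT x|Tmeas. (v s x - v 0 x)\<^sup>2))"
            using L2_distance_at_zero[OF sol(1), of s m] L2_distance_at_zero[OF sol(2), of s m] s unfolding h_def by simp
          ultimately show "h 0 \<le> 4 * E + e" using d(2)[of s] s by simp
        qed
        then show ?thesis using True by simp
      qed
      then show "(LINT x|Tmeas. (u t x - m)\<^sup>2) + (LINT x|Tmeas. (v t x - m)\<^sup>2)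
              \<le> 4 * exp (- 2 * (if 0 < M \<and> 0 < m \<and> 0 < kinf then ?lam \<alpha> kinf \<kappa> else 1) * t)
                 * ((LINT x|Tmeas. (u0 x - m)\<^sup>2) + (LINT x|Tmeas. (v0 x - m)\<^sup>2))"
        unfolding lam by (simp only: h_def E_def)
    qed
  qed simp
qed

end
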